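(* Let $\mathcal C$ be a proper substitution-closed permutation class with $12,21\in\mathcal C$, let $\mathcal S$ be the set of simple permutations in $\mathcal C$, and assume that $$\mathcal S'(\rho_{\mathcal S})\ \ge\ \frac{2}{(1+\rho_{\mathcal S})^2}-1 .$$ For each $n\in\mathbb N$, let $\boldsymbol\nu_n$ be a uniform random permutation of size $n$ in $\mathcal C$. Then, for each pattern $\pi\in\mathcal C$, there exists a (deterministic) number $\gamma_{\pi,\mathcal C}\in[0,1]$ such that, as $n\to\infty$, $$\frac1n\, c\text{-}occ(\pi,\boldsymbol\nu_n)\ \longrightarrow\ \gamma_{\pi,\mathcal C}\quad\text{in probability.}$$
   Context: A permutation $\nu$ of size $|\nu|=n\ge 1$ is a bijection of $[n]=\{1,\dots,n\}$. For $I\subseteq[n]$, $\mathrm{pat}_I(\nu)$ is the permutation of size $|I|$ in the same relative order as $(\nu(i))_{i\in I}$; $\pi$ is a pattern of $\nu$ if $\pi=\mathrm{pat}_I(\nu)$ for some $I$. The number of consecutive occurrences of $\pi$ in $\nu$, denoted $c\text{-}occ(\pi,\nu)$, is the number of intervals of integers $I\subseteq[n]$ such that $\mathrm{pat}_I(\nu)=\pi$. A permutation class is a set of permutations closed under taking patterns; it is proper if it is not the set of all permutations. For $\theta$ of size $d$, the substitution $\theta[\nu^{(1)},\dots,\nu^{(d)}]$ is the permutation of size $\sum_i|\nu^{(i)}|$ obtained by replacing each $\theta(i)$ by a sequence of integers (forming an interval of values) order-isomorphic to $\nu^{(i)}$, keeping the relative order induced by $\theta$ between these subsequences. A class $\mathcal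 C$ is substitution-closed if $\theta,\nu^{(1)},\dots,\nu^{(d)}\in\mathcal C$ implies $\theta[\nu^{(1)},\dots,\nu^{(d)}]\in\mathcal C$. A permutation of size $n>2$ is simple if it maps no interval of $[n]$ with at least $2$ and at most $n-1$ elements onto an interval. $\mathcal S(z)=\sum_{\alpha\in\mathcal S}z^{|\alpha|}$, with radius of convergence $\rho_{\mathcal S}\in(0,\infty]$ (positive since $\mathcal C$ is proper); $\mathcal S'(\rho_{\mathcal S})$ is the limit of $\mathcal S'(z)$ as $z\nearrow\rho_{\mathcal S}$ (possibly infinite), and $2/(1+\rho_{\mathcal S})^2=0$ if $\rho_{\mathcal S}=\infty$. *)

theory Defs
  imports "HOL-Probability.Probability" "HOL-Combinatorics.Multiset_Permutations"
begin

text \<open>A permutation of size \<open>n \<ge> 1\<close> is given in one-line notation, as a list containing each of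
  \<open>1, \<dots>, n\<close> exactly once. Values are thus 1-based, whereas positions are list indices, so that
  the position set is \<open>{..<n}\<close> and \<open>\<nu>(i)\<close> is \<open>\<nu> ! (i - 1)\<close>.\<close>

definition perms :: "nat list set" where
  "perms = {\<nu>. \<nu> \<noteq> [] \<and> \<nu> \<in> permutations_of_set {1..length \<nu>}}"

definition nat_interval :: "nat set \<Rightarrow> bool" where
  "nat_interval I \<longleftrightarrow> (\<exists>a b. I = {a..b})"

text \<open>Replaces every entry of a list of distinct numbers by its rank.\<close>

definition standardize :: "nat list \<Rightarrow> nat list" where
  "standardize xs = map (\<lambda>x. card {y \<in> set xs. y \<le> x}) xs"

definition pat :: "nat set \<Rightarrow> nat list \<Rightarrow> nat list" where
  "pat I \<nu> = standardize (nths \<nu> I)"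

definition is_pattern :: "nat list \<Rightarrow> nat list \<Rightarrow> bool" where
  "is_pattern \<pi> \<nu> \<longleftrightarrow> (\<exists>I. I \<noteq> {} \<and> I \<subseteq> {..<length \<nu>} \<and> \<pi> = pat I \<nu>)"

definition c_occ :: "nat list \<Rightarrow> nat list \<Rightarrow> nat" where
  "c_occ \<pi> \<nu> = card {I. nat_interval I \<and> I \<subseteq> {..<length \<nu>} \<and> pat I \<nu> = \<pi>}"

definition permutation_class :: "nat list set \<Rightarrow> bool" where
  "permutation_class C \<longleftrightarrow> C \<subseteq> perms \<and> (\<forall>\<nu>\<in>C. \<forall>\<pi>. is_pattern \<pi> \<nu> \<longrightarrow> \<pi> \<in> C)"

definition proper_class :: "nat list set \<Rightarrow> bool" where
  "proper_class C \<longleftrightarrow> permutation_class C \<and> C \<noteq> perms"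

text \<open>The substitution \<open>\<theta>[\<nu>\<^sup>(\<^sup>1\<^sup>), \<dots>, \<nu>\<^sup>(\<^sup>d\<^sup>)]\<close>: the block replacing \<open>\<theta>(i)\<close> is \<open>\<nu>\<^sup>(\<^sup>i\<^sup>)\<close> shifted upwards by
  the total size of the blocks that replace the smaller values of \<open>\<theta>\<close>.\<close>

definition substitution :: "nat list \<Rightarrow> nat list list \<Rightarrow> nat list" where
  "substitution \<theta> \<nu>s =
     concat (map (\<lambda>i. map (\<lambda>v. v + (\<Sum>j | j < length \<theta> \<and> \<theta> ! j < \<theta> ! i. length (\<nu>s ! j))) (\<nu>s ! i))
       [0..<length \<theta>])"

definition substitution_closed :: "nat list set \<Rightarrow> bool" where
  "substitution_closed C \<longleftrightarrow>
     (\<forall>\<theta>\<in>C. \<forall>\<nu>s. length \<nu>s = length \<theta> \<and> set \<nu>s \<subseteq> C \<longrightarrow> substitution \<theta> \<nu>s \<in> C)"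

definition simple_perm :: "nat list \<Rightarrow> bool" where
  "simple_perm \<nu> \<longleftrightarrow> \<nu> \<in> perms \<and> length \<nu> > 2 \<and>
     \<not> (\<exists>I. nat_interval I \<and> I \<subseteq> {..<length \<nu>} \<and> 2 \<le> card I \<and> card I \<le> length \<nu> - 1 \<and>
          nat_interval ((\<lambda>i. \<nu> ! i) ` I))"

definition simples :: "nat list set \<Rightarrow> nat list set" where
  "simples C = {\<alpha> \<in> C. simple_perm \<alpha>}"

definition gen_fun :: "nat list set \<Rightarrow> real fps" where
  "gen_fun A = Abs_fps (\<lambda>n. real (card {\<alpha> \<in> A. length \<alpha> = n}))"

text \<open>The limit of \<open>F'(z)\<close> as \<open>z\<close> increases to the radius of convergence of \<open>F\<close>. Both the radius and
  the limit may be infinite; \<open>at_left \<infinity>\<close> on \<^typ>\<open>ereal\<close> covers the case of real \<open>z\<close> tending to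
  infinity.\<close>

definition deriv_at_radius :: "real fps \<Rightarrow> ereal" where
  "deriv_at_radius F =
     Lim (at_left (fps_conv_radius F)) (\<lambda>z. ereal (eval_fps (fps_deriv F) (real_of_ereal z)))"

definition uniform_perm :: "nat list set \<Rightarrow> nat \<Rightarrow> nat list pmf" where
  "uniform_perm C n = pmf_of_set {\<nu> \<in> C. length \<nu> = n}"

text \<open>Convergence in probability to a constant; the variables may live on different spaces.\<close>

definition tendsto_in_prob :: "(nat \<Rightarrow> 'a measure) \<Rightarrow> (nat \<Rightarrow> 'a \<Rightarrow> real) \<Rightarrow> real \<Rightarrow> bool" where
  "tendsto_in_prob M X c \<longleftrightarrow>
     (\<forall>\<epsilon>>0. (\<lambda>n. measure (M n) {x \<in> space (M n). \<bar>X n x - c\<bar> > \<epsilon>}) \<longlonglongrightarrow> 0)"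

end

theory Submission
  imports Defs "HOL-Library.Sublist"
begin

text \<open>
  Let \<open>S\<close> be the generating function of the simple permutations of the class. Substitution decomposition
  shows that the generating function of the class is the inverse of
  \<open>G(u) = u - 2 u\<^sup>2 / (1 + u) - S(u)\<close>. Let \<open>R\<close> be its radius of convergence, which is positive by the
  Marcus--Tardos theorem, and \<open>\<tau>\<close> its value at \<open>R\<close>, so that \<open>G(\<tau>) = R\<close>. The hypothesis on \<open>S'\<close> gives
  \<open>G'(\<tau>) \<le> 0\<close>. The class is closed under direct sums, so its counting sequence is supermultiplicative
  and equals \<open>R ^ (- n)\<close> up to a subexponential factor. Hence it suffices to show that deviations of
  order \<open>n\<close> have exponentially small probability.

  Up to an error \<open>k\<close> per part, with \<open>k\<close> the size of the pattern, the number of consecutive occurrences is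
  additive under substitution; therefore \<open>v = \<plusminus>c-occ + k\<close> is subadditive and \<open>exp (t v)\<close> is
  submultiplicative. Using the exact weights up to size \<open>M\<close> and submultiplicativity beyond \<open>M\<close>, the
  weighted generating function stays bounded by \<open>\<tau>\<close> as long as an explicit finite expression, a
  perturbation of \<open>G(\<tau>) = R\<close>, does not exceed \<open>R\<close>. Its derivative at \<open>t = 0\<close> determines the speed
  of \<open>c-occ\<close> up to the contribution of the constant \<open>k\<close>, which tends to \<open>k \<tau> G'(\<tau>) \<le> 0\<close> as
  \<open>M \<rightarrow> \<infinity>\<close>; Chernoff bounds from both sides then give the concentration.
\<close>

subsection \<open>Standardization and block decompositions\<close>

text \<open>The term \<open>2 u^2 / (1 + u)\<close> of \<open>G\<close> collects the two kinds of
  decomposable permutations. For each of 12 and 21 the decomposition is unique once the first part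
  is itself indecomposable, so indecomposables \<open>A\<close> and decomposables \<open>D\<close>
  satisfy \<open>D = A u\<close> and \<open>A + D = u\<close>, whence
  \<open>D = u^2 / (1 + u)\<close>. An error \<open>v\<close> in the first equation changes
  \<open>D\<close> by \<open>v / (1 + u)\<close>; this is the origin of the factors
  \<open>1 / (1 + \<tau>)\<close>. Of \<open>G(\<tau>) = R\<close>, the inequality
  \<open>R <= G(\<tau>)\<close> is what is proved and used. The obstacle is that the perturbed total
  is not known to be finite for any t > 0. It is therefore never treated as a series: the work is
  done with partial sums over sizes at most N, and induction on N propagates the bound
  \<open>\<tau>\<close>. The induction starts at size M from strict inequalities, which survive a
  small change of t. Criticality enters because the constant function 1 multiplies every weight by
  \<open>e^t\<close>. Formally this moves \<open>G(\<tau>)\<close> to \<open>G(e^t \<tau>)\<close>,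
  with derivative \<open>\<tau> G'(\<tau>)\<close> at t = 0. Were it positive, the upper and lower
  bounds on the speed would stay apart by a multiple of k.\<close>

lemma perms_iff: "\<nu> \<in> perms \<longleftrightarrow> \<nu> \<noteq> [] \<and> distinct \<nu> \<and> set \<nu> = {1..length \<nu>}"
  by (auto simp: perms_def permutations_of_set_def)

lemma nat_interval_atLeastAtMost: "nat_interval {a..b}"
  unfolding nat_interval_def by (intro exI) (rule refl)

lemma nat_interval_iff:
  "nat_interval A \<longleftrightarrow> finite A \<and> (\<forall>x\<in>A. \<forall>z\<in>A. \<forall>y. x \<le> y \<and> y \<le> z \<longrightarrow> y \<in> A)" (is "?L \<longleftrightarrow> ?R")
proof
  assume ?L
  then obtain a b where "A = {a..b}" unfolding nat_interval_def by (elim exE)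
  then show ?R by simp
next
  assume R: ?R
  show ?L
  proof (cases "A = {}")
    case True
    then have "A = {1..0}" by simp
    then show ?thesis unfolding nat_interval_def by (intro exI)
  next
    case False
    moreover have "finite A" using R by blast
    ultimately have mm: "Min A \<in> A" "Max A \<in> A" by simp_all
    have "A = {Min A..Max A}"
    proof (intro subset_antisym subsetI)
      fix y assume "y \<in> {Min A..Max A}"
      then have "Min A \<le> y \<and> y \<le> Max A" by simp
      then show "y \<in> A" using R mm by blast
    next
      fix y assume "y \<in> A"
      moreover have "finite A" using R by blast
      ultimately show "y \<in> {Min A..Max A}" by simp
    qed
    then show ?thesis unfolding nat_interval_def by (intro exI)
  qed
qed

text \<open>The set is a parameter because ranks of a piece of a list are also taken in the value
  set of the whole list: standardizing first and cutting afterwards yields such ranks.\<close>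

definition rank_in :: "nat set \<Rightarrow> nat \<Rightarrow> nat" where
  "rank_in A x = card {y \<in> A. y \<le> x}"

lemma standardize_rank: "standardize xs = map (rank_in (set xs)) xs"
  by (simp add: standardize_def rank_in_def)

lemma rank_in_less:
  assumes "finite A" "y \<in> A" "x < y"
  shows "rank_in A x < rank_in A y"
proof -
  have "y \<in> {z \<in> A. z \<le> y}" "y \<notin> {z \<in> A. z \<le> x}" using assms by simp_all
  moreover have "{z \<in> A. z \<le> x} \<subseteq> {z \<in> A. z \<le> y}" using assms(3) by (intro Collect_mono) simp
  ultimately have "{z \<in> A. z \<le> x} \<subset> {z \<in> A. z \<le> y}" by blast
  then show ?thesis unfolding rank_in_def using assms(1) by (intro psubset_card_mono) simp_all
qed

lemma strict_mono_on_rank: "finite A \<Longrightarrow> strict_mono_on A (rank_in A)"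
  by (auto simp: strict_mono_on_def rank_in_less)

lemma rank_in_less_iff:
  "finite A \<Longrightarrow> x \<in> A \<Longrightarrow> y \<in> A \<Longrightarrow> rank_in A x < rank_in A y \<longleftrightarrow> x < y"
  using rank_in_less[of A x y] rank_in_less[of A y x] by (cases x y rule: linorder_cases) auto

lemma length_standardize [simp]: "length (standardize xs) = length xs"
  by (simp add: standardize_def)

lemma standardize_Nil_iff [simp]: "standardize xs = [] \<longleftrightarrow> xs = []"
  by (simp add: standardize_def)

lemma standardize_nth_less_iff:
  "i < length xs \<Longrightarrow> j < length xs \<Longrightarrow> standardize xs ! i < standardize xs ! j \<longleftrightarrow> xs ! i < xs ! j"
  by (simp add: standardize_rank rank_in_less_iff)

lemma standardize_map:
  assumes "strict_mono_on (set xs) f"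
  shows "standardize (map f xs) = standardize xs"
proof -
  have inj: "inj_on f (set xs)" by (rule strict_mono_on_imp_inj_on[OF assms])
  have "card {y \<in> f ` set xs. y \<le> f x} = card {y \<in> set xs. y \<le> x}" if "x \<in> set xs" for x
  proof -
    have "{y \<in> f ` set xs. y \<le> f x} = f ` {y \<in> set xs. y \<le> x}"
      using assms that by (auto simp: strict_mono_on_less_eq)
    moreover have "inj_on f {y \<in> set xs. y \<le> x}" using inj by (rule inj_on_subset) auto
    ultimately show ?thesis by (simp add: card_image)
  qed
  then show ?thesis by (simp add: standardize_def)
qed

lemma standardize_map_rank:
  "finite A \<Longrightarrow> set xs \<subseteq> A \<Longrightarrow> standardize (map (rank_in A) xs) = standardize xs"
  by (intro standardize_map monotone_on_subset[OF strict_mono_on_rank])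

lemma distinct_standardize: "distinct xs \<Longrightarrow> distinct (standardize xs)"
  by (auto simp: standardize_rank distinct_map
      intro!: strict_mono_on_imp_inj_on strict_mono_on_rank)

lemma standardize_perms:
  assumes "distinct xs" "xs \<noteq> []"
  shows "standardize xs \<in> perms"
proof -
  have sub: "set (standardize xs) \<subseteq> {1..length xs}"
  proof
    fix r assume "r \<in> set (standardize xs)"
    then obtain x where x: "x \<in> set xs" "r = card {y \<in> set xs. y \<le> x}"
      by (auto simp: standardize_def)
    have "{y \<in> set xs. y \<le> x} \<noteq> {}" using x(1) by auto
    then have "r > 0" using x by (simp add: card_gt_0_iff)
    moreover have "r \<le> card (set xs)" unfolding x(2) by (intro card_mono) auto
    ultimately show "r \<in> {1..length xs}" using card_length[of xs] by auto
  qed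
  moreover have "card (set (standardize xs)) = length xs"
    using distinct_card[OF distinct_standardize[OF assms(1)]] by simp
  ultimately have "set (standardize xs) = {1..length xs}"
    by (intro card_subset_eq) auto
  then show ?thesis using assms by (auto simp: perms_iff distinct_standardize)
qed

lemma standardize_perm_id:
  assumes "\<nu> \<in> perms"
  shows "standardize \<nu> = \<nu>"
proof -
  have "card {y \<in> set \<nu>. y \<le> x} = x" if "x \<in> set \<nu>" for x
  proof -
    have "{y \<in> set \<nu>. y \<le> x} = {1..x}" using that assms by (auto simp: perms_iff)
    then show ?thesis by simp
  qed
  then show ?thesis by (simp add: standardize_def map_idI)
qed

lemma standardize_eqI:
  assumes "length xs = length ys" "distinct xs" "distinct ys"
    and "\<And>i j. i < length xs \<Longrightarrow> j < length xs \<Longrightarrow> xs ! i < xs ! j \<longleftrightarrow> ys ! i < ys ! j"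
  shows "standardize xs = standardize ys"
proof (rule nth_equalityI)
  show "length (standardize xs) = length (standardize ys)" using assms by simp
  fix i assume "i < length (standardize xs)"
  then have i: "i < length xs" "i < length ys" using assms by auto
  have *: "card {y \<in> set zs. y \<le> zs ! i} = card {j. j < length zs \<and> zs ! j \<le> zs ! i}"
    if "distinct zs" for zs :: "nat list"
  proof -
    have "{y \<in> set zs. y \<le> zs ! i} = (!) zs ` {j. j < length zs \<and> zs ! j \<le> zs ! i}"
      by (auto simp: in_set_conv_nth)
    moreover have "inj_on ((!) zs) {j. j < length zs \<and> zs ! j \<le> zs ! i}"
      using that by (auto simp: inj_on_def nth_eq_iff_index_eq)
    ultimately show ?thesis by (simp add: card_image)
  qed
  have "{j. j < length xs \<and> xs ! j \<le> xs ! i} = {j. j < length ys \<and> ys ! j \<le> ys ! i}"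
    using assms(1) assms(4) i by (auto simp: not_less[symmetric])
  then show "standardize xs ! i = standardize ys ! i"
    using *[OF assms(2)] *[OF assms(3)] i by (simp add: standardize_def)
qed

text \<open>The alternative \<open>Min (set xs) = 0\<close> is there because the shift by the
  minimum minus one is truncated at 0. It does not occur for entries of a permutation.\<close>

lemma standardize_interval:
  assumes "nat_interval (set xs)" "xs \<noteq> []"
  shows "xs = map (\<lambda>v. v + (Min (set xs) - 1)) (standardize xs)
     \<or> Min (set xs) = 0"
proof (cases "Min (set xs) = 0")
  case False
  obtain a b where ab: "set xs = {a..b}" using assms by (auto simp: nat_interval_def)
  then have "a \<le> b" using assms by (metis atLeastatMost_empty_iff2 set_empty)
  then have m: "Min (set xs) = a" unfolding ab by (intro Min_eqI) auto
  have "card {y \<in> set xs. y \<le> x} + (a - 1) = x" if "x \<in> set xs" for x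
  proof -
    have "{y \<in> set xs. y \<le> x} = {a..x}" using that ab by auto
    then show ?thesis using that ab False m by auto
  qed
  then show ?thesis unfolding m by (simp add: standardize_def map_idI)
qed auto

lemma is_pattern_subseq:
  assumes "subseq ys \<nu>" "ys \<noteq> []"
  shows "is_pattern (standardize ys) \<nu>"
proof -
  obtain N where N: "ys = nths \<nu> N" using assms(1) by (auto simp: subseq_conv_nths)
  \<comment> \<open>\<open>nths\<close> ignores indices beyond the end of the list, but
    \<open>is_pattern\<close> demands that there be none.\<close>
  define I where "I = N \<inter> {..<length \<nu>}"
  have "nths \<nu> I = nths \<nu> N"
    unfolding I_def nths_def by (intro arg_cong[where f = "map fst"] filter_cong) (auto simp: set_zip)
  then have "nths \<nu> I = ys" using N by simp
  moreover from this have "I \<noteq> {}" using assms(2) by auto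
  ultimately show ?thesis unfolding is_pattern_def pat_def
    by (intro exI[of _ I]) (auto simp: I_def)
qed

section \<open>Substitutions as concatenations of interval blocks\<close>

definition blocks :: "nat list \<Rightarrow> nat list list \<Rightarrow> nat list list" where
  "blocks \<theta> \<nu>s = map (\<lambda>i. map (\<lambda>v. v + (\<Sum>j | j < length \<theta> \<and> \<theta> ! j < \<theta> ! i. length (\<nu>s ! j))) (\<nu>s ! i))
       [0..<length \<theta>]"

lemma substitution_blocks: "substitution \<theta> \<nu>s = concat (blocks \<theta> \<nu>s)"
  by (simp add: substitution_def blocks_def)

text \<open>The first entry stands for its block. In a block decomposition with distinct entries any
  other entry would do, by \<open>block_decomp_less_iff\<close>.\<close>

definition block_quotient :: "nat list list \<Rightarrow> nat list" where
  "block_quotient xss = standardize (map hd xss)"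

text \<open>Positions of a block are consecutive by concatenation, values by the second condition.
  For a permutation these are therefore its presentations as an inflation; see
  \<open>block_decomp_blocks\<close> and \<open>substitution_of_block_decomp\<close>.\<close>

definition block_decomp :: "nat list list \<Rightarrow> nat list \<Rightarrow> bool" where
  "block_decomp xss \<nu> \<longleftrightarrow> \<nu> = concat xss \<and> (\<forall>xs\<in>set xss. xs \<noteq> [] \<and> nat_interval (set xs))"

lemma length_blocks [simp]: "length (blocks \<theta> \<nu>s) = length \<theta>"
  by (simp add: blocks_def)

lemma length_block_quotient [simp]: "length (block_quotient xss) = length xss"
  by (simp add: block_quotient_def)

lemma standardize_shift: "standardize (map (\<lambda>v. v + k) xs) = standardize xs"
  by (rule standardize_map) (auto simp: strict_mono_on_def)

lemma set_shift_perm: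
  assumes "\<nu> \<in> perms"
  shows "set (map (\<lambda>v. v + k) \<nu>) = {k+1..k+length \<nu>}"
proof -
  have "set (map (\<lambda>v. v + k) \<nu>) = (\<lambda>v. v + k) ` {1..length \<nu>}"
    using assms by (simp add: perms_iff)
  also have "\<dots> = {1+k..length \<nu>+k}" by (simp only: image_add_atLeastAtMost')
  finally show ?thesis by (simp add: add.commute)
qed

text \<open>The top of block i is its offset plus its length, a sum over i and the indices of
  smaller values. All these indices occur in the offset of block j.\<close>

lemma blocks_less:
  assumes \<theta>: "\<theta> \<in> perms" and len: "length \<nu>s = length \<theta>" and \<nu>s: "set \<nu>s \<subseteq> perms"
    and ij: "i < length \<theta>" "j < length \<theta>" "\<theta> ! i < \<theta> ! j"
    and x: "x \<in> set (blocks \<theta> \<nu>s ! i)" and y: "y \<in> set (blocks \<theta> \<nu>s ! j)"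
  shows "x < y"
proof -
  let ?o = "\<lambda>i. \<Sum>j | j < length \<theta> \<and> \<theta> ! j < \<theta> ! i. length (\<nu>s ! j)"
  have "\<nu>s ! i \<in> perms" "\<nu>s ! j \<in> perms" using \<nu>s ij len by (auto simp: subset_iff)
  then have xy: "x \<le> ?o i + length (\<nu>s ! i)" "y \<ge> ?o j + 1"
    using x y ij set_shift_perm[of "\<nu>s ! i" "?o i"] set_shift_perm[of "\<nu>s ! j" "?o j"]
    by (auto simp: blocks_def)
  have "?o i + length (\<nu>s ! i) = (\<Sum>l\<in>insert i {l. l < length \<theta> \<and> \<theta> ! l < \<theta> ! i}. length (\<nu>s ! l))"
    by (subst sum.insert) auto
  also have "\<dots> \<le> ?o j" using ij by (intro sum_mono2) auto
  finally show ?thesis using xy by simp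
qed

lemma hd_blocks_in:
  assumes "length \<nu>s = length \<theta>" "set \<nu>s \<subseteq> perms" "i < length \<theta>"
  shows "hd (blocks \<theta> \<nu>s ! i) \<in> set (blocks \<theta> \<nu>s ! i)" "blocks \<theta> \<nu>s ! i \<noteq> []"
proof -
  have "\<nu>s ! i \<in> perms" using assms by (auto simp: subset_iff)
  then show "blocks \<theta> \<nu>s ! i \<noteq> []" using assms by (auto simp: blocks_def perms_iff)
  then show "hd (blocks \<theta> \<nu>s ! i) \<in> set (blocks \<theta> \<nu>s ! i)" by simp
qed

text \<open>With \<open>map_standardize_blocks\<close> this recovers \<open>\<theta>\<close> and the
  parts from the list of blocks, so uniqueness of an inflation reduces to uniqueness of the block
  decomposition.\<close>

lemma blocks_quotient:
  assumes \<theta>: "\<theta> \<in> perms" and len: "length \<nu>s = length \<theta>" and \<nu>s: "set \<nu>s \<subseteq> perms"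
  shows "block_quotient (blocks \<theta> \<nu>s) = \<theta>"
proof -
  let ?h = "map hd (blocks \<theta> \<nu>s)"
  have less: "?h ! i < ?h ! j" if "i < length \<theta>" "j < length \<theta>" "\<theta> ! i < \<theta> ! j" for i j
    using blocks_less[OF assms that] hd_blocks_in[OF len \<nu>s] that by simp
  have iff: "?h ! i < ?h ! j \<longleftrightarrow> \<theta> ! i < \<theta> ! j" if "i < length \<theta>" "j < length \<theta>" for i j
  proof (cases "i = j")
    case False
    then have "\<theta> ! i \<noteq> \<theta> ! j" using \<theta> that by (simp add: perms_iff nth_eq_iff_index_eq)
    then show ?thesis using less that by (meson linorder_neqE_nat order_less_asym)
  qed auto
  have "distinct ?h" unfolding distinct_conv_nth
  proof (intro allI impI)
    fix i j assume ij: "i < length ?h" "j < length ?h" "i \<noteq> j"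
    then have "\<theta> ! i \<noteq> \<theta> ! j" using \<theta> by (simp add: perms_iff nth_eq_iff_index_eq)
    then show "?h ! i \<noteq> ?h ! j" using iff ij by (metis length_blocks length_map linorder_neqE_nat order_less_irrefl)
  qed
  then have "standardize ?h = standardize \<theta>"
    using \<theta> iff by (intro standardize_eqI) (auto simp: perms_iff)
  then show ?thesis using \<theta> by (simp add: block_quotient_def standardize_perm_id)
qed

lemma map_standardize_blocks:
  assumes "length \<nu>s = length \<theta>" and \<nu>s: "set \<nu>s \<subseteq> perms"
  shows "map standardize (blocks \<theta> \<nu>s) = \<nu>s"
proof (rule nth_equalityI)
  fix i assume "i < length (map standardize (blocks \<theta> \<nu>s))"
  then have i: "i < length \<theta>" by simp
  then have "\<nu>s ! i \<in> perms" using assms by (auto simp: subset_iff)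
  then show "map standardize (blocks \<theta> \<nu>s) ! i = \<nu>s ! i"
    using i by (simp add: blocks_def standardize_shift standardize_perm_id)
qed (use assms in simp)

lemma block_decomp_blocks:
  assumes "length \<nu>s = length \<theta>" and \<nu>s: "set \<nu>s \<subseteq> perms"
  shows "block_decomp (blocks \<theta> \<nu>s) (substitution \<theta> \<nu>s)"
  unfolding block_decomp_def
proof (intro conjI ballI)
  fix xs assume "xs \<in> set (blocks \<theta> \<nu>s)"
  then obtain i where i: "i < length \<theta>" "xs = blocks \<theta> \<nu>s ! i" by (auto simp: in_set_conv_nth)
  then have p: "\<nu>s ! i \<in> perms" using assms by (auto simp: subset_iff)
  show "xs \<noteq> []" using hd_blocks_in[OF assms i(1)] i by simp
  show "nat_interval (set xs)"
    using i set_shift_perm[OF p] unfolding blocks_def nat_interval_def by auto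
qed (rule substitution_blocks)

lemma length_substitution:
  assumes "length \<nu>s = length \<theta>"
  shows "length (substitution \<theta> \<nu>s) = sum_list (map length \<nu>s)"
proof -
  have "map length (blocks \<theta> \<nu>s) = map length \<nu>s"
    by (rule nth_equalityI) (use assms in \<open>auto simp: blocks_def\<close>)
  then show ?thesis by (simp add: substitution_blocks length_concat)
qed

lemma distinct_concat_nth:
  assumes "distinct (concat xss)" "i < length xss" "j < length xss"
    "x \<in> set (xss ! i)" "x \<in> set (xss ! j)"
  shows "i = j"
  using assms
proof (induction xss arbitrary: i j)
  case (Cons xs xss)
  have x: False if "x \<in> set xs" "l < length xss" "x \<in> set (xss ! l)" for l
  proof -
    have "x \<in> set (concat xss)" using that by auto
    then show False using Cons.prems(1) that(1) by auto
  qed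
  have "distinct (concat xss)" using Cons.prems(1) by simp
  note IH = Cons.IH[OF this]
  show ?case
  proof (cases i; cases j)
    fix i' j' assume "i = Suc i'" "j = Suc j'"
    then show ?thesis using IH[of i' j'] Cons.prems by simp
  qed (use x Cons.prems in auto)
qed auto

text \<open>Distinct blocks are disjoint intervals, hence one lies entirely below the other, and the
  heads tell which.\<close>

lemma block_decomp_less_iff:
  assumes bd: "block_decomp xss \<nu>" and dist: "distinct \<nu>"
    and ij: "i < length xss" "j < length xss" "i \<noteq> j"
    and x: "x \<in> set (xss ! i)" and y: "y \<in> set (xss ! j)"
  shows "x < y \<longleftrightarrow> block_quotient xss ! i < block_quotient xss ! j"
proof -
  have iv: "nat_interval (set (xss ! l))" "xss ! l \<noteq> []" if "l < length xss" for l
    using bd that by (auto simp: block_decomp_def)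
  have d: "distinct (concat xss)" using bd dist by (simp add: block_decomp_def)
  have disj: False if "z \<in> set (xss ! i)" "z \<in> set (xss ! j)" for z
    using distinct_concat_nth[OF d ij(1,2) that] ij by simp
  obtain a b where ab: "set (xss ! i) = {a..b}" using iv[OF ij(1)] by (auto simp: nat_interval_def)
  obtain a' b' where ab': "set (xss ! j) = {a'..b'}" using iv[OF ij(2)] by (auto simp: nat_interval_def)
  have h: "hd (xss ! i) \<in> {a..b}" "hd (xss ! j) \<in> {a'..b'}"
    using iv[OF ij(1)] iv[OF ij(2)] ab ab' by (metis hd_in_set)+
  have "b < a' \<or> b' < a"
  proof (rule ccontr)
    assume "\<not> ?thesis"
    then have "max a a' \<in> {a..b}" "max a a' \<in> {a'..b'}" using h by auto
    then show False using disj ab ab' by blast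
  qed
  then have "x < y \<longleftrightarrow> hd (xss ! i) < hd (xss ! j)" using x y h ab ab' by auto
  also have "\<dots> \<longleftrightarrow> block_quotient xss ! i < block_quotient xss ! j"
    using ij by (simp add: block_quotient_def standardize_nth_less_iff)
  finally show ?thesis .
qed

lemma distinct_hds:
  assumes "block_decomp xss \<nu>" "distinct \<nu>"
  shows "distinct (map hd xss)"
  unfolding distinct_conv_nth
proof (intro allI impI)
  fix i j assume ij: "i < length (map hd xss)" "j < length (map hd xss)" "i \<noteq> j"
  have "distinct (concat xss)" using assms by (simp add: block_decomp_def)
  moreover have "hd (xss ! l) \<in> set (xss ! l)" if "l < length xss" for l
    using assms that by (auto simp: block_decomp_def)
  ultimately show "map hd xss ! i \<noteq> map hd xss ! j"
    using ij distinct_concat_nth[of xss i j "hd (xss ! i)"] by (metis length_map nth_map)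
qed

lemma quotient_perms:
  assumes "block_decomp xss \<nu>" "distinct \<nu>" "xss \<noteq> []"
  shows "block_quotient xss \<in> perms"
  unfolding block_quotient_def using assms distinct_hds by (intro standardize_perms) auto

text \<open>What has to be checked is the offset. If \<open>a\<close> is the minimum of block i, the
  blocks of smaller quotient value consist exactly of the values below \<open>a\<close>, and a
  permutation takes all of \<open>{1..<a}\<close>; so the offset is \<open>a - 1\<close>.\<close>

lemma blocks_of_block_decomp:
  assumes \<nu>: "\<nu> \<in> perms" and bd: "block_decomp xss \<nu>"
  shows "blocks (block_quotient xss) (map standardize xss) = xss"
proof (rule nth_equalityI)
  fix i assume "i < length (blocks (block_quotient xss) (map standardize xss))"
  then have i: "i < length xss" by simp
  let ?J = "{j. j < length xss \<and> block_quotient xss ! j < block_quotient xss ! i}"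
  have conc: "\<nu> = concat xss" and dist: "distinct \<nu>" using bd \<nu> by (auto simp: block_decomp_def perms_iff)
  have iv: "nat_interval (set (xss ! l))" "xss ! l \<noteq> []" if "l < length xss" for l
    using bd that by (auto simp: block_decomp_def)
  obtain a b where ab: "set (xss ! i) = {a..b}" using iv[OF i] by (auto simp: nat_interval_def)
  have "a \<le> b" using ab iv[OF i] by (metis atLeastatMost_empty_iff2 set_empty)
  then have a: "a \<in> set (xss ! i)" and m: "Min (set (xss ! i)) = a"
    unfolding ab by (auto intro!: Min_eqI)
  have "a \<in> set \<nu>" using a i conc by auto
  then have a1: "a \<ge> 1" using \<nu> by (auto simp: perms_iff)
  have "(\<Sum>j\<in>?J. length (xss ! j)) = (\<Sum>j\<in>?J. card (set (xss ! j)))"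
  proof (rule sum.cong)
    fix j assume "j \<in> ?J"
    then have "distinct (xss ! j)" using dist conc by (auto simp: distinct_concat_iff)
    then show "length (xss ! j) = card (set (xss ! j))" by (simp add: distinct_card)
  qed simp
  also have "\<dots> = card (\<Union>j\<in>?J. set (xss ! j))"
    using distinct_concat_nth[of xss] dist conc by (intro card_UN_disjoint[symmetric]) auto
  also have "(\<Union>j\<in>?J. set (xss ! j)) = {1..<a}"
  proof (intro set_eqI iffI)
    fix v assume "v \<in> (\<Union>j\<in>?J. set (xss ! j))"
    then obtain j where j: "j < length xss" "block_quotient xss ! j < block_quotient xss ! i" "v \<in> set (xss ! j)" by auto
    then have "v < a" using block_decomp_less_iff[OF bd dist j(1) i _ j(3) a] by auto
    moreover have "v \<in> set \<nu>" using j conc by auto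
    ultimately show "v \<in> {1..<a}" using \<nu> by (auto simp: perms_iff)
  next
    fix v assume v: "v \<in> {1..<a}"
    have "a \<in> set \<nu>" using a i conc by auto
    then have "v \<in> set \<nu>" using v \<nu> by (auto simp: perms_iff)
    then obtain j where j: "j < length xss" "v \<in> set (xss ! j)" using conc by (auto simp: in_set_conv_nth[of _ xss])
    have "j \<noteq> i" using v ab j by auto
    then have "block_quotient xss ! j < block_quotient xss ! i"
      using block_decomp_less_iff[OF bd dist j(1) i _ j(2) a] v by auto
    then show "v \<in> (\<Union>j\<in>?J. set (xss ! j))" using j by auto
  qed
  finally have o: "(\<Sum>j\<in>?J. length (xss ! j)) = a - 1" by simp
  have "(\<Sum>j | j < length xss \<and> block_quotient xss ! j < block_quotient xss ! i. length (map standardize xss ! j))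
      = (\<Sum>j\<in>?J. length (xss ! j))" by (intro sum.cong) auto
  then have "blocks (block_quotient xss) (map standardize xss) ! i = map (\<lambda>v. v + (a - 1)) (standardize (xss ! i))"
    using i o by (simp add: blocks_def)
  also have "\<dots> = xss ! i" using standardize_interval[OF iv[OF i]] a1 unfolding m by simp
  finally show "blocks (block_quotient xss) (map standardize xss) ! i = xss ! i" .
qed simp

lemma substitution_of_block_decomp:
  assumes "\<nu> \<in> perms" "block_decomp xss \<nu>"
  shows "substitution (block_quotient xss) (map standardize xss) = \<nu>"
  using blocks_of_block_decomp[OF assms] assms(2) by (simp add: substitution_blocks block_decomp_def)

subsection \<open>Inflations of simple permutations\<close>

lemma nth_append_segment:
  assumes "distinct (ps @ ys @ ss)" "p < length (ps @ ys @ ss)"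
  shows "(ps @ ys @ ss) ! p \<in> set ys \<longleftrightarrow> length ps \<le> p \<and> p < length ps + length ys"
proof -
  consider "p < length ps" | "length ps \<le> p" "p < length ps + length ys" | "p \<ge> length ps + length ys"
    by linarith
  then show ?thesis
  proof cases
    case 1
    then have "(ps @ ys @ ss) ! p \<in> set ps" by (simp add: nth_append)
    then show ?thesis using 1 assms(1) by auto
  next
    case 2
    then have "p - length ps < length ys" by linarith
    then show ?thesis using 2 by (simp add: nth_append)
  next
    case 3
    then have *: "\<not> p - length ps < length ys" "p - length ps - length ys < length ss"
      using assms(2) by auto
    then have "(ps @ ys @ ss) ! p = ss ! (p - length ps - length ys)"
      using 3 by (simp add: nth_append)
    then have "(ps @ ys @ ss) ! p \<in> set ss" using * by simp
    then show ?thesis using 3 assms(1) by auto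
  qed
qed

lemma concat_nth_order:
  assumes "i < j" "j < length xss" "x \<in> set (xss ! i)" "y \<in> set (xss ! j)"
  shows "\<exists>p q. p < q \<and> q < length (concat xss) \<and> concat xss ! p = x \<and> concat xss ! q = y"
proof -
  have split: "concat xss = concat (take j xss) @ concat (drop j xss)"
    by (metis append_take_drop_id concat_append)
  have "take j xss ! i \<in> set (take j xss)" using assms by (intro nth_mem) simp
  then have "xss ! i \<in> set (take j xss)" using assms by simp
  then have "x \<in> set (concat (take j xss))" using assms(3) by auto
  then obtain p where p: "p < length (concat (take j xss))" "concat (take j xss) ! p = x"
    by (auto simp only: in_set_conv_nth)
  have "y \<in> set (concat (drop j xss))"
    using assms by (auto simp: Cons_nth_drop_Suc[symmetric])
  then obtain q where q: "q < length (concat (drop j xss))" "concat (drop j xss) ! q = y"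
    by (auto simp only: in_set_conv_nth)
  show ?thesis unfolding split using p q
    by (intro exI[of _ p] exI[of _ "length (concat (take j xss)) + q"]) (simp add: nth_append)
qed

text \<open>Let \<open>T\<close> be the set of blocks that \<open>ys\<close> meets. A block strictly
  between two members of \<open>T\<close>, in position or in value, is contained in
  \<open>ys\<close>, so \<open>T\<close> and its image under the quotient are intervals. By
  simplicity \<open>T\<close> is one block or all of them; the second case would force
  \<open>ys = \<nu>\<close>, since a missed value could only lie in a block at a corner of the
  quotient.\<close>

lemma simple_block_within:
  assumes \<nu>: "\<nu> \<in> perms" and bd: "block_decomp xss \<nu>"
    and simple: "simple_perm (block_quotient xss)"
    and seg: "\<nu> = ps @ ys @ ss" "ys \<noteq> []" "nat_interval (set ys)" "ys \<noteq> \<nu>"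
  shows "\<exists>i<length xss. set ys \<subseteq> set (xss ! i)"
proof -
  let ?\<alpha> = "block_quotient xss" let ?d = "length xss"
  have dist: "distinct \<nu>" and conc: "\<nu> = concat xss" using \<nu> bd by (auto simp: perms_iff block_decomp_def)
  have d: "?d > 2" and \<alpha>: "?\<alpha> \<in> perms" and nosub: "\<And>I. nat_interval I \<Longrightarrow> I \<subseteq> {..<?d} \<Longrightarrow> 2 \<le> card I \<Longrightarrow>
      card I \<le> ?d - 1 \<Longrightarrow> \<not> nat_interval ((\<lambda>i. ?\<alpha> ! i) ` I)"
    using simple unfolding simple_perm_def by auto
  have d\<alpha>: "distinct ?\<alpha>" "set ?\<alpha> = {1..?d}" using \<alpha> by (auto simp: perms_iff)
  have ne: "xss ! l \<noteq> []" if "l < ?d" for l using bd that by (auto simp: block_decomp_def)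
  define T where "T = {i. i < ?d \<and> set (xss ! i) \<inter> set ys \<noteq> {}}"
  have pos: "r \<in> set ys" if h: "i < l" "l < j" "i \<in> T" "j \<in> T" "r \<in> set (xss ! l)" for i l j r
  proof -
    obtain x where x: "x \<in> set (xss ! i)" "x \<in> set ys" using \<open>i \<in> T\<close> unfolding T_def by blast
    obtain z where z: "z \<in> set (xss ! j)" "z \<in> set ys" and j: "j < ?d"
      using \<open>j \<in> T\<close> unfolding T_def by blast
    obtain p q where pq: "p < q" "q < length \<nu>" "\<nu> ! p = x" "\<nu> ! q = r"
      using concat_nth_order[of i l xss x r] h x j conc by auto
    obtain p' q' where pq': "p' < q'" "q' < length \<nu>" "\<nu> ! p' = r" "\<nu> ! q' = z"
      using concat_nth_order[of l j xss r z] h z j conc by auto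
    have "p' < length \<nu>" using pq' by linarith
    then have "p' = q" using pq pq' nth_eq_iff_index_eq[OF dist] by metis
    have "length ps \<le> p" using nth_append_segment[of ps ys ss p] pq x dist seg(1) by auto
    moreover have "q' < length ps + length ys" using nth_append_segment[of ps ys ss q'] pq' z dist seg(1) by auto
    ultimately show ?thesis using nth_append_segment[of ps ys ss q] pq pq' dist seg(1) \<open>p' = q\<close> by auto
  qed
  have val: "r \<in> set ys" if "?\<alpha> ! i < ?\<alpha> ! l" "?\<alpha> ! l < ?\<alpha> ! j" "i \<in> T" "j \<in> T" "l < ?d" "r \<in> set (xss ! l)" for i l j r
  proof -
    obtain x where x: "x \<in> set (xss ! i)" "x \<in> set ys" and "i < ?d" using \<open>i \<in> T\<close> unfolding T_def by blast
    moreover obtain z where z: "z \<in> set (xss ! j)" "z \<in> set ys" and "j < ?d"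
      using \<open>j \<in> T\<close> unfolding T_def by blast
    ultimately have ij: "i < ?d" "j < ?d" by auto
    have "i \<noteq> l" "l \<noteq> j" using that by auto
    then have "x < r" "r < z"
      using block_decomp_less_iff[OF bd dist ij(1) that(5) _ x(1) that(6)]
        block_decomp_less_iff[OF bd dist that(5) ij(2) _ that(6) z(1)] that(1,2) by auto
    then show ?thesis using seg(3) x z unfolding nat_interval_iff by (meson less_imp_le)
  qed
  have Td: "T \<subseteq> {..<?d}" by (auto simp: T_def)
  then have finT: "finite T" using finite_subset by blast
  have hdT: "l \<in> T" if "l < ?d" "\<And>r. r \<in> set (xss ! l) \<Longrightarrow> r \<in> set ys" for l
  proof -
    have "hd (xss ! l) \<in> set (xss ! l)" using ne that(1) by simp
    then show ?thesis using that unfolding T_def by blast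
  qed
  have "nat_interval T" unfolding nat_interval_iff
  proof (intro conjI ballI allI impI)
    fix i j l assume "i \<in> T" "j \<in> T" "i \<le> l \<and> l \<le> j"
    then show "l \<in> T" using pos[of i l j] hdT[of l] Td by (cases "l = i \<or> l = j") auto
  qed (rule finT)
  moreover have "nat_interval ((\<lambda>i. ?\<alpha> ! i) ` T)" unfolding nat_interval_iff
  proof (intro conjI ballI allI impI)
    fix x z y assume x: "x \<in> (!) ?\<alpha> ` T" and z: "z \<in> (!) ?\<alpha> ` T" and y: "x \<le> y \<and> y \<le> z"
    obtain i j where ij: "i \<in> T" "j \<in> T" "x = ?\<alpha> ! i" "z = ?\<alpha> ! j" using x z by auto
    have "x \<in> set ?\<alpha>" "z \<in> set ?\<alpha>" using ij Td by (auto intro!: nth_mem)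
    then have "y \<in> set ?\<alpha>" using y d\<alpha> by auto
    then obtain l where l: "l < ?d" "y = ?\<alpha> ! l" by (auto simp: in_set_conv_nth)
    show "y \<in> (!) ?\<alpha> ` T"
    proof (cases "y = x \<or> y = z")
      case False
      then have "?\<alpha> ! i < ?\<alpha> ! l" "?\<alpha> ! l < ?\<alpha> ! j" using y ij l by auto
      then show ?thesis using val[OF _ _ ij(1,2) l(1)] hdT[OF l(1)] l(2) by blast
    qed (use x z in auto)
  qed (use finT in simp)
  ultimately have "\<not> (2 \<le> card T \<and> card T \<le> ?d - 1)" using nosub Td by blast
  moreover have "T \<noteq> {}"
  proof -
    have "hd ys \<in> set ys" using seg(2) by simp
    moreover from this have "hd ys \<in> set \<nu>" using seg(1) by simp
    ultimately show ?thesis unfolding conc T_def by (fastforce simp: in_set_conv_nth[of _ xss])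
  qed
  then have "card T \<noteq> 0" using finT by simp
  ultimately consider "card T = 1" | "card T \<ge> ?d" by linarith
  then show ?thesis
  proof cases
    case 1
    then obtain i where i: "T = {i}" by (rule card_1_singletonE)
    have "set ys \<subseteq> set (xss ! i)"
    proof
      fix x assume x: "x \<in> set ys"
      then have "x \<in> set \<nu>" using seg(1) by simp
      then obtain l where l: "l < ?d" "x \<in> set (xss ! l)" by (auto simp: conc in_set_conv_nth[of _ xss])
      then have "l \<in> T" using x by (auto simp: T_def)
      then show "x \<in> set (xss ! i)" using i l by simp
    qed
    then show ?thesis using i Td by auto
  next
    case 2
    have T: "T = {..<?d}" using 2 Td by (intro card_seteq) auto
    have "set \<nu> \<subseteq> set ys"
    proof (rule ccontr)
      assume "\<not> ?thesis"
      then obtain r where r: "r \<in> set \<nu>" "r \<notin> set ys" by auto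
      then obtain l where l: "l < ?d" "r \<in> set (xss ! l)" by (auto simp: conc in_set_conv_nth[of _ xss])
      have l1: "l = 0 \<or> l = ?d - 1"
      proof (rule ccontr)
        assume "\<not> ?thesis"
        then have "0 < l" "l < ?d - 1" using l by auto
        moreover have "0 \<in> T" "?d - 1 \<in> T" unfolding T lessThan_iff using d by linarith+
        ultimately show False using pos[OF _ _ _ _ l(2), of 0 "?d - 1"] r by blast
      qed
      have l2: "?\<alpha> ! l = 1 \<or> ?\<alpha> ! l = ?d"
      proof (rule ccontr)
        assume c: "\<not> ?thesis"
        have "?\<alpha> ! l \<in> {1..?d}" using d\<alpha> l by (metis length_block_quotient nth_mem)
        then have c: "1 < ?\<alpha> ! l" "?\<alpha> ! l < ?d" using c by auto
        have "1 \<in> set ?\<alpha>" "?d \<in> set ?\<alpha>" using d\<alpha> d by auto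
        then obtain i j where "i < ?d" "j < ?d" "?\<alpha> ! i = 1" "?\<alpha> ! j = ?d" by (metis in_set_conv_nth length_block_quotient)
        then show False using val[OF _ _ _ _ l, of i j] r c by (auto simp: T)
      qed
      \<comment> \<open>Block \<open>l\<close> is a corner: first or last in position, smallest or
        largest in value. Without it, d - 1 positions and their values still form intervals, against
        simplicity.\<close>
      let ?I = "{..<?d} - {l}"
      have "?I = {1..?d - 1} \<or> ?I = {0..?d - 2}" using l1 d by auto
      then have "nat_interval ?I" by (elim disjE) (simp_all only: nat_interval_atLeastAtMost)
      moreover have im: "(!) ?\<alpha> ` ?I = {1..?d} - {?\<alpha> ! l}"
      proof -
        have "(!) ?\<alpha> ` ?I = set ?\<alpha> - {?\<alpha> ! l}"
          using d\<alpha>(1) l by (auto simp: in_set_conv_nth nth_eq_iff_index_eq)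
        then show ?thesis by (simp only: d\<alpha>(2))
      qed
      have "nat_interval ((!) ?\<alpha> ` ?I)"
      proof (cases "?\<alpha> ! l = 1")
        case True
        have "{1..?d} - {1} = {2..?d}" by auto
        then show ?thesis unfolding im True by (simp only: nat_interval_atLeastAtMost)
      next
        case False
        then have e: "?\<alpha> ! l = ?d" using l2 by simp
        have "{1..?d} - {?d} = {1..?d - 1}" using d by auto
        then show ?thesis unfolding im e by (simp only: nat_interval_atLeastAtMost)
      qed
      moreover have "card ?I = ?d - 1" using l by simp
      ultimately show False using nosub[of ?I] d by auto
    qed
    then have "length \<nu> \<le> length ys" using dist seg(1) by (metis card_mono distinct_append distinct_card List.finite_set)
    then have "ys = \<nu>" using seg(1) by simp
    then show ?thesis using seg(4) by simp
  qed
qed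

text \<open>A block decomposition with as few parts as possible, but at least two, has a simple quotient or
  two parts: otherwise the parts in a block of the quotient could be merged.\<close>

lemma minimal_block_decomp:
  assumes \<nu>: "\<nu> \<in> perms" and n: "length \<nu> \<ge> 2"
  shows "\<exists>xss. block_decomp xss \<nu> \<and> (length xss = 2 \<or> simple_perm (block_quotient xss))"
proof -
  let ?P = "\<lambda>xss. block_decomp xss \<nu> \<and> length xss \<ge> 2"
  have sing: "nat_interval {x}" for x by (auto simp: nat_interval_iff)
  have "?P (map (\<lambda>x. [x]) \<nu>)" using n sing by (auto simp: block_decomp_def)
  from ex_has_least_nat[of ?P, OF this, of length]
  obtain xss where bd: "block_decomp xss \<nu>" and len: "length xss \<ge> 2"
    and least: "\<And>yss. block_decomp yss \<nu> \<Longrightarrow> length yss \<ge> 2 \<Longrightarrow> length xss \<le> length yss" by blast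
  let ?\<alpha> = "block_quotient xss" let ?d = "length xss"
  have dist: "distinct \<nu>" and conc: "\<nu> = concat xss" using \<nu> bd by (auto simp: perms_iff block_decomp_def)
  have "xss \<noteq> []" using len by auto
  then have \<alpha>: "?\<alpha> \<in> perms" by (rule quotient_perms[OF bd dist])
  have "simple_perm ?\<alpha>" if d2: "?d \<noteq> 2"
  proof (rule ccontr)
    assume "\<not> simple_perm ?\<alpha>"
    then obtain I where I: "nat_interval I" "I \<subseteq> {..<?d}" "2 \<le> card I" "card I \<le> ?d - 1"
      and vI: "nat_interval ((!) ?\<alpha> ` I)" using \<alpha> d2 len unfolding simple_perm_def by auto
    obtain a b where ab: "I = {a..b}" using I(1) by (auto simp: nat_interval_def)
    have cI: "a < b" "b < ?d" "b - a + 1 \<le> ?d - 1" using I unfolding ab by (auto simp: subset_iff)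
    define mid where "mid = take (Suc b - a) (drop a xss)"
    define yss where "yss = take a xss @ [concat mid] @ drop (Suc b) xss"
    have xss: "xss = take a xss @ mid @ drop (Suc b) xss"
    proof -
      have "drop a xss = mid @ drop (Suc b) xss" unfolding mid_def
        using append_take_drop_id[of "Suc b - a" "drop a xss"] cI by simp
      then show ?thesis by (metis append_take_drop_id)
    qed
    have mid_len: "length mid = Suc b - a" using cI by (simp add: mid_def)
    have mid_nth: "mid ! m = xss ! (a + m)" if "m < Suc b - a" for m using that cI by (simp add: mid_def)
    have in_mid: "v \<in> set (concat mid) \<longleftrightarrow> (\<exists>l\<in>I. v \<in> set (xss ! l))" for v
    proof
      assume "v \<in> set (concat mid)"
      then obtain m where m: "m < length mid" "v \<in> set (mid ! m)" by (auto simp: in_set_conv_nth[of _ mid])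
      then show "\<exists>l\<in>I. v \<in> set (xss ! l)" using mid_nth mid_len ab by (intro bexI[of _ "a + m"]) auto
    next
      assume "\<exists>l\<in>I. v \<in> set (xss ! l)"
      then obtain l where l: "a \<le> l" "l \<le> b" "v \<in> set (xss ! l)" using ab by auto
      then have "mid ! (l - a) = xss ! l" "l - a < length mid" using mid_nth[of "l - a"] mid_len by auto
      then show "v \<in> set (concat mid)" using l(3) by (metis UN_iff nth_mem set_concat)
    qed
    have "nat_interval (set (concat mid))" unfolding nat_interval_iff
    proof (intro conjI ballI allI impI)
      fix x z y assume x: "x \<in> set (concat mid)" and z: "z \<in> set (concat mid)" and y: "x \<le> y \<and> y \<le> z"
      obtain i j where i: "i \<in> I" "x \<in> set (xss ! i)" and j: "j \<in> I" "z \<in> set (xss ! j)"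
        using x z in_mid by auto
      have ijd: "i < ?d" "j < ?d" using i j I by auto
      have "x \<in> set \<nu>" "z \<in> set \<nu>" using i j ijd conc by auto
      then have "y \<in> set \<nu>" using y \<nu> by (auto simp: perms_iff)
      then obtain l where l: "l < ?d" "y \<in> set (xss ! l)" by (auto simp: conc in_set_conv_nth[of _ xss])
      show "y \<in> set (concat mid)"
      proof (cases "l = i \<or> l = j")
        case False
        have "x \<noteq> y" "y \<noteq> z"
          using False distinct_concat_nth[of xss l i y] distinct_concat_nth[of xss l j y] l i j ijd dist conc by auto
        then have "?\<alpha> ! i < ?\<alpha> ! l" "?\<alpha> ! l < ?\<alpha> ! j"
          using block_decomp_less_iff[OF bd dist ijd(1) l(1) _ i(2) l(2)]
            block_decomp_less_iff[OF bd dist l(1) ijd(2) _ l(2) j(2)] y False by auto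
        then have "?\<alpha> ! l \<in> (!) ?\<alpha> ` I" using vI i(1) j(1) unfolding nat_interval_iff
          by (meson imageI less_imp_le)
        then obtain m where "m \<in> I" "?\<alpha> ! l = ?\<alpha> ! m" by auto
        then have "l \<in> I" using \<alpha> l(1) I(2) by (auto simp: perms_iff nth_eq_iff_index_eq subset_iff)
        then show ?thesis using in_mid l by blast
      qed (use in_mid i j l in auto)
    qed simp
    moreover have "concat mid \<noteq> []"
    proof -
      have "mid \<noteq> []" "set mid \<subseteq> set xss" using mid_len cI by (auto simp: mid_def dest: in_set_takeD in_set_dropD)
      then show ?thesis using bd by (cases mid) (auto simp: block_decomp_def)
    qed
    ultimately have "block_decomp yss \<nu>" using bd arg_cong[OF xss, of concat] unfolding block_decomp_def yss_def
      by (auto dest: in_set_takeD in_set_dropD)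
    \<comment> \<open>Merging removes \<open>b - a\<close> blocks, at least one; at least two remain
      because \<open>card I <= d - 1\<close>.\<close>
    moreover have "length yss = a + 1 + (?d - Suc b)" using cI by (simp add: yss_def)
    then have "length yss < ?d" "length yss \<ge> 2" using cI by linarith+
    ultimately show False using least[of yss] by linarith
  qed
  then show ?thesis using bd by blast
qed

text \<open>Two cuttings of a list that refine each other coincide: the first blocks share their
  head, so each contains the other, and induction handles the rest.\<close>

lemma concat_blocks_eq:
  assumes "concat xss = concat yss" "distinct (concat xss)" "[] \<notin> set xss" "[] \<notin> set yss"
    and "\<And>ys. ys \<in> set yss \<Longrightarrow> \<exists>xs\<in>set xss. set ys \<subseteq> set xs"
    and "\<And>xs. xs \<in> set xss \<Longrightarrow> \<exists>ys\<in>set yss. set xs \<subseteq> set ys"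
  shows "xss = yss"
  using assms
proof (induction xss arbitrary: yss)
  case Nil
  then show ?case by (cases yss) auto
next
  case (Cons x xss)
  then obtain y yss' where yss: "yss = y # yss'" by (cases yss) auto
  have eq: "x @ concat xss = y @ concat yss'" using Cons.prems(1) yss by simp
  have dx: "distinct (x @ concat xss)" using Cons.prems(2) by simp
  then have dy: "distinct (y @ concat yss')" using eq by simp
  have ne: "x \<noteq> []" "y \<noteq> []" using Cons.prems yss by auto
  then have hd: "hd x = hd y" using eq by (metis hd_append2)
  have "set y \<subseteq> set x"
  proof -
    obtain x' where x': "x' \<in> set (x # xss)" "set y \<subseteq> set x'" using Cons.prems(5) yss by auto
    have "hd y \<in> set y" "hd x \<in> set x" using ne by simp_all
    then have "hd x \<in> set x'" "hd x \<in> set x" using x' hd by auto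
    then have "x' = x" using x'(1) dx by auto
    then show ?thesis using x' by simp
  qed
  moreover have "set x \<subseteq> set y"
  proof -
    obtain y' where y': "y' \<in> set (y # yss')" "set x \<subseteq> set y'" using Cons.prems(6)[of x] yss by auto
    have "hd x \<in> set x" "hd y \<in> set y" using ne by simp_all
    then have "hd y \<in> set y'" "hd y \<in> set y" using y' hd by auto
    then have "y' = y" using y'(1) dy by auto
    then show ?thesis using y' by simp
  qed
  ultimately have "set x = set y" by simp
  then have "length x = length y" using dx dy by (metis distinct_append distinct_card)
  then have xy: "x = y" "concat xss = concat yss'" using eq by auto
  have "xss = yss'"
  proof (rule Cons.IH[OF xy(2)])
    show "\<exists>xs\<in>set xss. set ys \<subseteq> set xs" if h: "ys \<in> set yss'" for ys
    proof -
      obtain xs where xs: "xs \<in> set (x # xss)" "set ys \<subseteq> set xs" using Cons.prems(5)[of ys] yss h by auto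
      have "ys \<noteq> []" using Cons.prems(4) yss that by auto
      then have "hd ys \<in> set ys" by simp
      moreover from this have "hd ys \<notin> set y" using dy that by auto
      ultimately show ?thesis using xs xy by auto
    qed
    show "\<exists>ys\<in>set yss'. set xs \<subseteq> set ys" if h: "xs \<in> set xss" for xs
    proof -
      obtain ys where ys: "ys \<in> set (y # yss')" "set xs \<subseteq> set ys" using Cons.prems(6)[of xs] yss h by auto
      have "xs \<noteq> []" using Cons.prems(3) that by auto
      then have "hd xs \<in> set xs" by simp
      moreover from this have "hd xs \<notin> set x" using dx that by auto
      ultimately show ?thesis using ys xy by auto
    qed
    show "distinct (concat xss)" using dx by simp
  qed (use Cons.prems yss in auto)
  then show ?case using xy yss by simp
qed

text \<open>Each block of either decomposition is an interval segment other than the whole, so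
  \<open>simple_block_within\<close> yields mutual refinement.\<close>

lemma simple_block_decomp_unique:
  assumes \<nu>: "\<nu> \<in> perms" and bx: "block_decomp xss \<nu>" and by_: "block_decomp yss \<nu>"
    and sx: "simple_perm (block_quotient xss)" and sy: "simple_perm (block_quotient yss)"
  shows "xss = yss"
proof -
  have within: "\<exists>xs\<in>set xss. set ys \<subseteq> set xs"
    if bx: "block_decomp xss \<nu>" and by_: "block_decomp yss \<nu>"
    and sx: "simple_perm (block_quotient xss)" and sy: "simple_perm (block_quotient yss)"
    and ys: "ys \<in> set yss" for xss yss ys
  proof -
    obtain l r where lr: "yss = l @ ys # r" using ys by (auto simp: in_set_conv_decomp)
    have "length yss > 2" using sy by (simp add: simple_perm_def)
    then have "l \<noteq> [] \<or> r \<noteq> []" using lr by auto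
    moreover have "[] \<notin> set l" "[] \<notin> set r" using by_ lr by (auto simp: block_decomp_def)
    ultimately have "concat l \<noteq> [] \<or> concat r \<noteq> []" by (metis concat_eq_Nil_conv hd_in_set)
    then have len0: "length (concat l) + length (concat r) > 0" by blast
    have eq: "\<nu> = concat l @ ys @ concat r" using by_ lr by (simp add: block_decomp_def)
    have len1: "length \<nu> = length (concat l) + (length ys + length (concat r))"
      by (subst eq) (simp only: length_append)
    have "ys \<noteq> \<nu>"
    proof
      assume "ys = \<nu>"
      then have "length ys = length \<nu>" by simp
      then show False using len0 len1 by linarith
    qed
    moreover have "ys \<noteq> []" "nat_interval (set ys)" using by_ ys by (auto simp: block_decomp_def)
    ultimately have "\<exists>i<length xss. set ys \<subseteq> set (xss ! i)"
      using simple_block_within[OF \<nu> bx sx eq] by blast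
    then show ?thesis by auto
  qed
  show ?thesis
  proof (rule concat_blocks_eq)
    show "concat xss = concat yss" "[] \<notin> set xss" "[] \<notin> set yss" "distinct (concat xss)"
      using bx by_ \<nu> by (auto simp: block_decomp_def perms_iff)
  qed (use within[OF bx by_ sx sy] within[OF by_ bx sy sx] in blast)+
qed

subsection \<open>Consecutive occurrences under concatenation\<close>

lemma nths_segment: "nths xs {a..<a + k} = take k (drop a xs)"
proof -
  have "{a..<a + k} = (+) a ` {..<k}"
    by (simp add: lessThan_atLeast0 add.commute)
  then show ?thesis by (simp only: nths_drop[symmetric] nths_upt_eq_take)
qed

text \<open>Occurrences are recorded by their left end, and for arbitrary lists, so that they can be
  counted in blocks before standardization.\<close>

definition occ_starts :: "nat list \<Rightarrow> nat list \<Rightarrow> nat set" where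
  "occ_starts \<pi> xs = {a. a + length \<pi> \<le> length xs \<and> standardize (take (length \<pi>) (drop a xs)) = \<pi>}"

lemma occ_starts_subset: "\<pi> \<noteq> [] \<Longrightarrow> occ_starts \<pi> xs \<subseteq> {..<length xs}"
  by (auto simp: occ_starts_def length_greater_0_conv[symmetric] simp del: length_greater_0_conv)

lemma finite_occ_starts: "\<pi> \<noteq> [] \<Longrightarrow> finite (occ_starts \<pi> xs)"
  by (rule finite_subset[OF occ_starts_subset]) auto

text \<open>An interval with pattern \<open>\<pi>\<close> has \<open>length \<pi>\<close> elements,
  so its left end determines it. For the empty pattern this fails, the empty interval having no left
  end.\<close>

lemma c_occ_eq_card:
  assumes "\<pi> \<noteq> []"
  shows "c_occ \<pi> \<nu> = card (occ_starts \<pi> \<nu>)"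
proof -
  let ?k = "length \<pi>"
  have k: "?k > 0" using assms by simp
  have "{I. nat_interval I \<and> I \<subseteq> {..<length \<nu>} \<and> pat I \<nu> = \<pi>} = (\<lambda>a. {a..<a + ?k}) ` occ_starts \<pi> \<nu>"
  proof (intro set_eqI iffI)
    fix I assume "I \<in> {I. nat_interval I \<and> I \<subseteq> {..<length \<nu>} \<and> pat I \<nu> = \<pi>}"
    then have I: "nat_interval I" "I \<subseteq> {..<length \<nu>}" "pat I \<nu> = \<pi>" by auto
    obtain a b where ab: "I = {a..b}" using I(1) by (auto simp: nat_interval_def)
    have "?k = length (nths \<nu> I)" using I(3) by (auto simp: pat_def)
    also have "\<dots> = card {i. i < length \<nu> \<and> i \<in> I}" by (rule length_nths)
    also have "{i. i < length \<nu> \<and> i \<in> I} = I" using I(2) by auto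
    also have "card I = Suc b - a" using ab by simp
    finally have "?k = Suc b - a" .
    then have *: "I = {a..<a + ?k}" "a \<le> b" "b + 1 = a + ?k" using k ab by auto
    then have "b \<in> I" using ab by simp
    then have "b < length \<nu>" using I(2) by auto
    then have "a \<in> occ_starts \<pi> \<nu>" using I(3) * by (simp add: occ_starts_def pat_def nths_segment)
    then show "I \<in> (\<lambda>a. {a..<a + ?k}) ` occ_starts \<pi> \<nu>" using * by blast
  next
    fix I assume "I \<in> (\<lambda>a. {a..<a + ?k}) ` occ_starts \<pi> \<nu>"
    then obtain a where a: "a \<in> occ_starts \<pi> \<nu>" "I = {a..<a + ?k}" by auto
    obtain m where "?k = Suc m" using k gr0_conv_Suc by blast
    then have "I = {a..a + m}" unfolding a(2) by auto
    then have "nat_interval I" using nat_interval_atLeastAtMost by simp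
    then show "I \<in> {I. nat_interval I \<and> I \<subseteq> {..<length \<nu>} \<and> pat I \<nu> = \<pi>}"
      using a by (auto simp: occ_starts_def pat_def nths_segment)
  qed
  moreover have "inj_on (\<lambda>a. {a..<a + ?k}) (occ_starts \<pi> \<nu>)"
  proof (rule inj_onI)
    fix a b assume "{a..<a + ?k} = {b..<b + ?k}"
    then have "Min {a..<a + ?k} = Min {b..<b + ?k}" by simp
    moreover have "Min {c..<c + ?k} = c" for c using k by (intro Min_eqI) auto
    ultimately show "a = b" by simp
  qed
  ultimately show ?thesis by (simp add: c_occ_def card_image)
qed

lemma c_occ_le_length:
  assumes "\<pi> \<noteq> []"
  shows "c_occ \<pi> \<nu> \<le> length \<nu>"
  using card_mono[OF finite_lessThan occ_starts_subset[OF assms]] by (simp add: c_occ_eq_card[OF assms])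

lemma occ_starts_standardize: "occ_starts \<pi> (standardize xs) = occ_starts \<pi> xs"
proof -
  have "standardize (take k (drop a (standardize xs))) = standardize (take k (drop a xs))" for a k
    unfolding standardize_rank[of xs] take_map drop_map
    by (rule standardize_map_rank) (auto dest: in_set_takeD in_set_dropD)
  then show ?thesis by (simp add: occ_starts_def)
qed

text \<open>A window of the concatenation lies in \<open>xs\<close>, lies in \<open>ys\<close>, or
  straddles the cut; a straddling one starts among the last \<open>length \<pi>\<close> positions of
  \<open>xs\<close>.\<close>

lemma occ_starts_append:
  assumes "\<pi> \<noteq> []"
  shows "card (occ_starts \<pi> xs) + card (occ_starts \<pi> ys) \<le> card (occ_starts \<pi> (xs @ ys))"
    and "card (occ_starts \<pi> (xs @ ys)) \<le> card (occ_starts \<pi> xs) + card (occ_starts \<pi> ys) + length \<pi>"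
proof -
  let ?k = "length \<pi>" let ?Y = "(+) (length xs) ` occ_starts \<pi> ys"
  let ?B = "{length xs - ?k..<length xs}"
  note fin = finite_occ_starts[OF assms]
  have cY: "card ?Y = card (occ_starts \<pi> ys)" by (simp add: card_image)
  have "occ_starts \<pi> xs \<inter> ?Y = {}" using occ_starts_subset[OF assms, of xs] by auto
  then have cXY: "card (occ_starts \<pi> xs \<union> ?Y) = card (occ_starts \<pi> xs) + card (occ_starts \<pi> ys)"
    using cY fin by (subst card_Un_disjoint) auto
  have "occ_starts \<pi> xs \<union> ?Y \<subseteq> occ_starts \<pi> (xs @ ys)" by (auto simp: occ_starts_def)
  from card_mono[OF fin this] show "card (occ_starts \<pi> xs) + card (occ_starts \<pi> ys) \<le> card (occ_starts \<pi> (xs @ ys))"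
    using cXY by simp
  have "occ_starts \<pi> (xs @ ys) \<subseteq> (occ_starts \<pi> xs \<union> ?Y) \<union> ?B"
  proof
    fix a assume a: "a \<in> occ_starts \<pi> (xs @ ys)"
    consider "a + ?k \<le> length xs" | "length xs \<le> a" | "a < length xs" "length xs < a + ?k" by linarith
    then show "a \<in> (occ_starts \<pi> xs \<union> ?Y) \<union> ?B"
    proof cases
      case 1
      then show ?thesis using a by (auto simp: occ_starts_def)
    next
      case 2
      then have "a - length xs \<in> occ_starts \<pi> ys" using a by (auto simp: occ_starts_def)
      then show ?thesis using 2 by (auto intro!: image_eqI[of _ _ "a - length xs"])
    qed auto
  qed
  from card_mono[OF _ this] have "card (occ_starts \<pi> (xs @ ys)) \<le> card ((occ_starts \<pi> xs \<union> ?Y) \<union> ?B)"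
    using fin by simp
  also have "\<dots> \<le> card (occ_starts \<pi> xs \<union> ?Y) + card ?B" by (rule card_Un_le)
  also have "card ?B \<le> ?k" by simp
  finally show "card (occ_starts \<pi> (xs @ ys)) \<le> card (occ_starts \<pi> xs) + card (occ_starts \<pi> ys) + ?k"
    using cXY by simp
qed

lemma occ_starts_concat_ge:
  assumes "\<pi> \<noteq> []"
  shows "(\<Sum>xs\<leftarrow>xss. card (occ_starts \<pi> xs)) \<le> card (occ_starts \<pi> (concat xss))"
proof (induction xss)
  case (Cons xs xss)
  then show ?case using occ_starts_append(1)[OF assms, of xs "concat xss"] by simp
qed simp

text \<open>There is one cut fewer than there are blocks, and each cut costs at most
  \<open>length \<pi>\<close>. Adding \<open>length \<pi>\<close> on the left turns this into
  subadditivity of the shifted count.\<close>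

lemma occ_starts_concat_le:
  assumes "\<pi> \<noteq> []" "xss \<noteq> []"
  shows "card (occ_starts \<pi> (concat xss)) + length \<pi> \<le> (\<Sum>xs\<leftarrow>xss. card (occ_starts \<pi> xs) + length \<pi>)"
  using assms(2)
proof (induction xss rule: list_nonempty_induct)
  case (cons xs xss)
  then show ?case using occ_starts_append(2)[OF assms(1), of xs "concat xss"] by simp
qed simp

lemma c_occ_substitution:
  assumes "\<pi> \<noteq> []" "\<theta> \<noteq> []" "length \<nu>s = length \<theta>" "set \<nu>s \<subseteq> perms"
  shows "(\<Sum>\<nu>\<leftarrow>\<nu>s. c_occ \<pi> \<nu>) \<le> c_occ \<pi> (substitution \<theta> \<nu>s)"
    and "c_occ \<pi> (substitution \<theta> \<nu>s) + length \<pi> \<le> (\<Sum>\<nu>\<leftarrow>\<nu>s. c_occ \<pi> \<nu> + length \<pi>)"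
proof -
  have *: "map (\<lambda>xs. f (card (occ_starts \<pi> xs))) (blocks \<theta> \<nu>s) = map (\<lambda>\<nu>. f (c_occ \<pi> \<nu>)) \<nu>s" for f :: "nat \<Rightarrow> nat"
  proof -
    have "map (\<lambda>\<nu>. f (c_occ \<pi> \<nu>)) \<nu>s = map (\<lambda>\<nu>. f (c_occ \<pi> \<nu>)) (map standardize (blocks \<theta> \<nu>s))"
      by (simp only: map_standardize_blocks[OF assms(3,4)])
    then show ?thesis by (simp add: c_occ_eq_card[OF assms(1)] occ_starts_standardize comp_def)
  qed
  have ne: "blocks \<theta> \<nu>s \<noteq> []" using assms(2) by (metis length_blocks length_0_conv)
  show "(\<Sum>\<nu>\<leftarrow>\<nu>s. c_occ \<pi> \<nu>) \<le> c_occ \<pi> (substitution \<theta> \<nu>s)"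
    using occ_starts_concat_ge[OF assms(1), of "blocks \<theta> \<nu>s"] *[of "\<lambda>x. x"]
    by (simp add: substitution_blocks c_occ_eq_card[OF assms(1)])
  show "c_occ \<pi> (substitution \<theta> \<nu>s) + length \<pi> \<le> (\<Sum>\<nu>\<leftarrow>\<nu>s. c_occ \<pi> \<nu> + length \<pi>)"
    using occ_starts_concat_le[OF assms(1) ne] *[of "\<lambda>x. x + length \<pi>"]
    by (simp add: substitution_blocks c_occ_eq_card[OF assms(1)])
qed

subsection \<open>Decompositions in a substitution-closed class\<close>

lemma subseq_map_hd_concat: "[] \<notin> set xss \<Longrightarrow> subseq (map hd xss) (concat xss)"
proof (induction xss)
  case (Cons xs xss)
  have "subseq [hd xs] xs" using Cons.prems by (cases xs) auto
  then show ?case using list_emb_append_mono[of "(=)" "[hd xs]" xs "map hd xss" "concat xss"] Cons by simp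
qed simp

lemma subseq_concat_member: "xs \<in> set xss \<Longrightarrow> subseq xs (concat xss)"
  by (induction xss) (auto intro: list_emb_append2 simp: list_emb_prefix)

lemma length_le_sum_list: "(\<And>x. x \<in> set xs \<Longrightarrow> 1 \<le> f x) \<Longrightarrow> length xs \<le> (\<Sum>x\<leftarrow>xs. f x :: nat)"
proof (induction xs)
  case (Cons x xs)
  then have "1 \<le> f x" "length xs \<le> (\<Sum>x\<leftarrow>xs. f x)" by simp_all
  then show ?case by simp
qed simp

lemma perms_length1: "\<nu> \<in> perms \<Longrightarrow> length \<nu> = 1 \<longleftrightarrow> \<nu> = [1]"
  by (cases \<nu>; cases "tl \<nu>") (auto simp: perms_iff)

lemma perms_length2: "\<nu> \<in> perms \<Longrightarrow> length \<nu> = 2 \<Longrightarrow> \<nu> = [1, 2] \<or> \<nu> = [2, 1]"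
proof -
  assume \<nu>: "\<nu> \<in> perms" "length \<nu> = 2"
  then obtain a b where ab: "\<nu> = [a, b]" by (cases \<nu>; cases "tl \<nu>") auto
  have "set \<nu> = {1..2}" "distinct \<nu>" using \<nu> by (simp_all add: perms_iff)
  moreover have "{1..2 :: nat} = {1, 2}" by auto
  ultimately show ?thesis using ab by (auto simp: doubleton_eq_iff)
qed

text \<open>For \<open>\<theta>\<close> one of \<open>12\<close> and \<open>21\<close>, the cut of a permutation into \<open>xs\<close> and \<open>ys\<close> exhibits it as an
  inflation of \<open>\<theta>\<close>.\<close>

definition splits :: "nat list \<Rightarrow> nat list \<Rightarrow> nat list \<Rightarrow> bool" where
  "splits \<theta> xs ys \<longleftrightarrow> xs \<noteq> [] \<and> ys \<noteq> [] \<and> (\<forall>x\<in>set xs. \<forall>y\<in>set ys. x < y \<longleftrightarrow> \<theta> ! 0 < \<theta> ! 1)"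

abbreviation dirs :: "nat list set" where
  "dirs \<equiv> {[1, 2], [2, 1]}"

lemma dirs_perms: "\<theta> \<in> dirs \<Longrightarrow> \<theta> \<in> perms" "\<theta> \<in> dirs \<Longrightarrow> length \<theta> = 2"
  by (auto simp: perms_iff)

lemma splits_blocks:
  assumes "\<theta> \<in> dirs" "\<sigma> \<in> perms" "\<tau> \<in> perms"
  obtains xs ys where "blocks \<theta> [\<sigma>, \<tau>] = [xs, ys]" "splits \<theta> xs ys"
    "standardize xs = \<sigma>" "standardize ys = \<tau>" "substitution \<theta> [\<sigma>, \<tau>] = xs @ ys"
proof -
  have len: "length [\<sigma>, \<tau>] = length \<theta>" and ps: "set [\<sigma>, \<tau>] \<subseteq> perms" using assms by auto
  note \<theta> = dirs_perms[OF assms(1)]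
  have "length (blocks \<theta> [\<sigma>, \<tau>]) = Suc (Suc 0)" using \<theta>(2) by simp
  then obtain xs ys where b: "blocks \<theta> [\<sigma>, \<tau>] = [xs, ys]" by (auto simp only: length_Suc_conv length_0_conv)
  have "x < y \<longleftrightarrow> \<theta> ! 0 < \<theta> ! 1" if xy: "x \<in> set xs" "y \<in> set ys" for x y
  proof (cases "\<theta> = [1, 2]")
    case True
    then show ?thesis using blocks_less[OF \<theta>(1) len ps, of 0 1 x y] xy b by simp
  next
    case False
    then have "\<theta> = [2, 1]" using assms(1) by simp
    then show ?thesis using blocks_less[OF \<theta>(1) len ps, of 1 0 y x] xy b by simp
  qed
  moreover have "xs \<noteq> []" "ys \<noteq> []" using hd_blocks_in(2)[OF len ps, of 0] hd_blocks_in(2)[OF len ps, of 1] b \<theta> by auto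
  ultimately have "splits \<theta> xs ys" by (simp add: splits_def)
  moreover have "standardize xs = \<sigma>" "standardize ys = \<tau>" using map_standardize_blocks[OF len ps] b by auto
  ultimately show ?thesis using that[OF b] b by (simp add: substitution_blocks)
qed

text \<open>A value of one half between two values of the other would be above one and below the
  other, whereas the cut orders the halves uniformly. Hence both halves are intervals.\<close>

lemma split_substitution:
  assumes \<theta>: "\<theta> \<in> dirs" and \<nu>: "\<nu> \<in> perms" "\<nu> = xs @ ys" and s: "splits \<theta> xs ys"
  shows "block_decomp [xs, ys] \<nu>" "substitution \<theta> [standardize xs, standardize ys] = \<nu>"
proof -
  have ne: "xs \<noteq> []" "ys \<noteq> []" and less: "\<And>x y. x \<in> set xs \<Longrightarrow> y \<in> set ys \<Longrightarrow> x < y \<longleftrightarrow> \<theta> ! 0 < \<theta> ! 1"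
    using s by (auto simp: splits_def)
  have p: "distinct (xs @ ys)" "set xs \<union> set ys = {1..length \<nu>}" using \<nu> by (auto simp: perms_iff)
  have btw: "y \<in> set xs \<union> set ys" if "x \<in> set xs \<union> set ys" "z \<in> set xs \<union> set ys" "x \<le> y" "y \<le> z" for x y z
    using that p by auto
  have "nat_interval (set xs)" unfolding nat_interval_iff
  proof (intro conjI ballI allI impI)
    fix x z y assume h: "x \<in> set xs" "z \<in> set xs" "x \<le> y \<and> y \<le> z"
    show "y \<in> set xs"
    proof (rule ccontr)
      assume "y \<notin> set xs"
      then have "y \<in> set ys" "y \<noteq> x" "y \<noteq> z" using btw[of x z y] h by auto
      then show False using less[OF h(1), of y] less[OF h(2), of y] h(3) by auto
    qed
  qed simp
  moreover have "nat_interval (set ys)" unfolding nat_interval_iff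
  proof (intro conjI ballI allI impI)
    fix x z y assume h: "x \<in> set ys" "z \<in> set ys" "x \<le> y \<and> y \<le> z"
    show "y \<in> set ys"
    proof (rule ccontr)
      assume "y \<notin> set ys"
      then have "y \<in> set xs" "y \<noteq> x" "y \<noteq> z" using btw[of x z y] h by auto
      then show False using less[OF _ h(1), of y] less[OF _ h(2), of y] h(3) by auto
    qed
  qed simp
  ultimately show bd: "block_decomp [xs, ys] \<nu>" using ne \<nu> by (simp add: block_decomp_def)
  have "hd xs \<in> set xs" "hd ys \<in> set ys" using ne by auto
  then have h: "hd xs < hd ys \<longleftrightarrow> \<theta> ! 0 < \<theta> ! 1" "hd xs \<noteq> hd ys" using less p(1) by auto
  have "block_quotient [xs, ys] = standardize \<theta>" unfolding block_quotient_def
    using h \<theta> by (intro standardize_eqI) (auto simp: less_Suc_eq numeral_2_eq_2)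
  then have "block_quotient [xs, ys] = \<theta>" using dirs_perms[OF \<theta>] by (simp add: standardize_perm_id)
  then show "substitution \<theta> [standardize xs, standardize ys] = \<nu>"
    using substitution_of_block_decomp[OF \<nu>(1) bd] by simp
qed

section \<open>Unique decompositions within the class\<close>

locale subst_class =
  fixes C :: "nat list set"
  assumes pclass: "permutation_class C" and closed: "substitution_closed C"
    and id2: "[1, 2] \<in> C" and swap2: "[2, 1] \<in> C"
begin

lemma C_perms: "\<nu> \<in> C \<Longrightarrow> \<nu> \<in> perms"
  using pclass by (auto simp: permutation_class_def)

lemma C_distinct: "\<nu> \<in> C \<Longrightarrow> distinct \<nu>"
  using C_perms by (simp add: perms_iff)

lemma C_length: "\<nu> \<in> C \<Longrightarrow> length \<nu> \<ge> 1"
  using C_perms by (auto simp: perms_iff Suc_le_eq)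

lemma standardize_in_C: "\<nu> \<in> C \<Longrightarrow> subseq ys \<nu> \<Longrightarrow> ys \<noteq> [] \<Longrightarrow> standardize ys \<in> C"
  using pclass is_pattern_subseq by (auto simp: permutation_class_def)

lemma substitution_in_C: "\<theta> \<in> C \<Longrightarrow> length \<nu>s = length \<theta> \<Longrightarrow> set \<nu>s \<subseteq> C \<Longrightarrow> substitution \<theta> \<nu>s \<in> C"
  using closed by (auto simp: substitution_closed_def)

lemma one_in_C: "[1] \<in> C"
proof -
  have "subseq [1] [1, 2 :: nat]" by simp
  from standardize_in_C[OF id2 this] have "standardize [1] \<in> C" by simp
  moreover have "[1] \<in> perms" by (auto simp: perms_iff)
  ultimately show ?thesis by (simp only: standardize_perm_id)
qed

lemma dirs_in_C: "\<theta> \<in> dirs \<Longrightarrow> \<theta> \<in> C"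
  using id2 swap2 by auto

definition inflations :: "nat list \<Rightarrow> nat list set" where
  "inflations \<theta> = {substitution \<theta> [\<sigma>, \<tau>] | \<sigma> \<tau>. \<sigma> \<in> C \<and> \<tau> \<in> C}"

text \<open>The first part must not be an inflation of \<open>\<theta>\<close> again, since
  \<open>12[12[a, b], c] = 12[a, 12[b, c]]\<close>. The constant \<open>\<theta>\<close> is kept so
  that these pairs have the type of \<open>simple_pairs\<close>.\<close>

definition binary_pairs :: "nat list \<Rightarrow> (nat list \<times> nat list list) set" where
  "binary_pairs \<theta> = {(\<theta>, [\<sigma>, \<tau>]) | \<sigma> \<tau>. \<sigma> \<in> C - inflations \<theta> \<and> \<tau> \<in> C}"

definition simple_pairs :: "(nat list \<times> nat list list) set" where
  "simple_pairs = {(\<alpha>, \<nu>s). \<alpha> \<in> simples C \<and> length \<nu>s = length \<alpha> \<and> set \<nu>s \<subseteq> C}"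

text \<open>By \<open>bij_simple_pairs\<close> these are \<open>[1]\<close> and the inflations of
  simple permutations.\<close>

definition remaining :: "nat list set" where
  "remaining = C - inflations [1, 2] - inflations [2, 1]"

lemma inflations_iff:
  assumes \<theta>: "\<theta> \<in> dirs" and \<nu>: "\<nu> \<in> C"
  shows "\<nu> \<in> inflations \<theta> \<longleftrightarrow> (\<exists>xs ys. \<nu> = xs @ ys \<and> splits \<theta> xs ys)"
proof
  assume "\<nu> \<in> inflations \<theta>"
  then obtain \<sigma> \<tau> where st: "\<nu> = substitution \<theta> [\<sigma>, \<tau>]" "\<sigma> \<in> C" "\<tau> \<in> C" by (auto simp: inflations_def)
  obtain xs ys where "splits \<theta> xs ys" "substitution \<theta> [\<sigma>, \<tau>] = xs @ ys"
    using splits_blocks[OF \<theta> C_perms[OF st(2)] C_perms[OF st(3)]] .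
  then show "\<exists>xs ys. \<nu> = xs @ ys \<and> splits \<theta> xs ys" using st(1) by (intro exI conjI) simp_all
next
  assume "\<exists>xs ys. \<nu> = xs @ ys \<and> splits \<theta> xs ys"
  then obtain xs ys where s: "\<nu> = xs @ ys" "splits \<theta> xs ys" by auto
  have "standardize xs \<in> C" "standardize ys \<in> C"
    using s by (auto intro!: standardize_in_C[OF \<nu>] simp: splits_def)
  then show "\<nu> \<in> inflations \<theta>"
    unfolding inflations_def by (auto simp: split_substitution(2)[OF \<theta> C_perms[OF \<nu>] s])
      (metis split_substitution(2)[OF \<theta> C_perms[OF \<nu>] s])
qed

lemma inflations_subset_C: "\<theta> \<in> dirs \<Longrightarrow> inflations \<theta> \<subseteq> C"
  using dirs_in_C by (auto simp: inflations_def intro!: substitution_in_C)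

text \<open>The first entry lies in the left half of any cut and the last entry in the right half;
  comparing the two decides between 12 and 21.\<close>

lemma inflations_disjoint: "inflations [1, 2] \<inter> inflations [2, 1] = {}"
proof (rule ccontr)
  assume "\<not> ?thesis"
  then obtain \<nu> where \<nu>: "\<nu> \<in> inflations [1, 2]" "\<nu> \<in> inflations [2, 1]" by auto
  then have C: "\<nu> \<in> C" using inflations_subset_C[of "[1, 2]"] by auto
  obtain xs ys where s: "\<nu> = xs @ ys" "splits [1, 2] xs ys" using inflations_iff[OF _ C, of "[1, 2]"] \<nu> by auto
  obtain xs' ys' where s': "\<nu> = xs' @ ys'" "splits [2, 1] xs' ys'" using inflations_iff[OF _ C, of "[2, 1]"] \<nu> by auto
  have ends: "hd (as @ bs) \<in> set as" "last (as @ bs) \<in> set bs" if "splits \<theta> as bs" for \<theta> as bs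
    using that by (auto simp: splits_def)
  have "hd \<nu> \<in> set xs" "last \<nu> \<in> set ys" "hd \<nu> \<in> set xs'" "last \<nu> \<in> set ys'"
    using ends[OF s(2)] ends[OF s'(2)] s(1) s'(1) by metis+
  then show False using s(2) s'(2) by (auto simp: splits_def)
qed

lemma standardize_append_inflation:
  assumes \<theta>: "\<theta> \<in> dirs" and C: "standardize (xs @ zs) \<in> C"
  shows "splits \<theta> xs zs \<Longrightarrow> standardize (xs @ zs) \<in> inflations \<theta>"
proof -
  assume s: "splits \<theta> xs zs"
  let ?r = "rank_in (set (xs @ zs))"
  have "standardize (xs @ zs) = map ?r xs @ map ?r zs" by (simp add: standardize_rank)
  moreover have "splits \<theta> (map ?r xs) (map ?r zs)"
    using s by (auto simp: splits_def rank_in_less_iff)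
  ultimately show ?thesis using inflations_iff[OF \<theta> C] by blast
qed

lemma bij_binary_pairs:
  assumes \<theta>: "\<theta> \<in> dirs"
  shows "bij_betw (\<lambda>(\<theta>, \<nu>s). substitution \<theta> \<nu>s) (binary_pairs \<theta>) (inflations \<theta>)"
  unfolding bij_betw_def
proof
  \<comment> \<open>A longer splitting prefix is itself split by a shorter one, so it is not
    indecomposable. Two pairs with the same image therefore cut at the same place.\<close>
  have shorter: "\<not> length xs < length xs'"
    if h: "xs @ ys = xs' @ ys'" "splits \<theta> xs ys" "standardize xs' \<in> C - inflations \<theta>" for xs ys xs' ys'
  proof
    assume l: "length xs < length xs'"
    then obtain zs where zs: "xs' = xs @ zs" "ys = zs @ ys'"
      using h(1) by (auto simp: append_eq_append_conv2)
    then have "splits \<theta> xs zs" using h(2) l by (auto simp: splits_def)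
    then show False using standardize_append_inflation[OF \<theta>, of xs zs] h(3) zs by auto
  qed
  show "inj_on (\<lambda>(\<theta>, \<nu>s). substitution \<theta> \<nu>s) (binary_pairs \<theta>)"
  proof (rule inj_onI)
    fix p p' assume p: "p \<in> binary_pairs \<theta>" and p': "p' \<in> binary_pairs \<theta>"
      and eq: "(case p of (\<theta>, \<nu>s) \<Rightarrow> substitution \<theta> \<nu>s) = (case p' of (\<theta>, \<nu>s) \<Rightarrow> substitution \<theta> \<nu>s)"
    obtain \<sigma> \<tau> where st: "p = (\<theta>, [\<sigma>, \<tau>])" "\<sigma> \<in> C - inflations \<theta>" "\<tau> \<in> C" using p by (auto simp: binary_pairs_def)
    obtain \<sigma>' \<tau>' where st': "p' = (\<theta>, [\<sigma>', \<tau>'])" "\<sigma>' \<in> C - inflations \<theta>" "\<tau>' \<in> C" using p' by (auto simp: binary_pairs_def)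
    obtain xs ys where xy: "splits \<theta> xs ys" "standardize xs = \<sigma>" "standardize ys = \<tau>" "substitution \<theta> [\<sigma>, \<tau>] = xs @ ys"
      using splits_blocks[OF \<theta>, of \<sigma> \<tau>] C_perms[of \<sigma>] C_perms[of \<tau>] st(2,3) by blast
    obtain xs' ys' where xy': "splits \<theta> xs' ys'" "standardize xs' = \<sigma>'" "standardize ys' = \<tau>'" "substitution \<theta> [\<sigma>', \<tau>'] = xs' @ ys'"
      using splits_blocks[OF \<theta>, of \<sigma>' \<tau>'] C_perms[of \<sigma>'] C_perms[of \<tau>'] st'(2,3) by blast
    have e: "xs @ ys = xs' @ ys'" using eq st st' xy xy' by simp
    have "length xs = length xs'"
      using shorter[OF e xy(1)] shorter[OF e[symmetric] xy'(1)] st st' xy xy' by auto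
    then show "p = p'" using e st st' xy xy' by auto
  qed
  show "(\<lambda>(\<theta>, \<nu>s). substitution \<theta> \<nu>s) ` binary_pairs \<theta> = inflations \<theta>"
  proof
    show "(\<lambda>(\<theta>, \<nu>s). substitution \<theta> \<nu>s) ` binary_pairs \<theta> \<subseteq> inflations \<theta>"
      by (auto simp: binary_pairs_def inflations_def)
    show "inflations \<theta> \<subseteq> (\<lambda>(\<theta>, \<nu>s). substitution \<theta> \<nu>s) ` binary_pairs \<theta>"
    proof
      fix \<nu> assume \<nu>: "\<nu> \<in> inflations \<theta>"
      then have C: "\<nu> \<in> C" using inflations_subset_C[OF \<theta>] by auto
      \<comment> \<open>The shortest splitting prefix is indecomposable: a cut of its
        standardization would give an earlier cut of \<open>\<nu>\<close>.\<close>
      let ?P = "\<lambda>xs. \<exists>ys. \<nu> = xs @ ys \<and> splits \<theta> xs ys"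
      obtain xs0 where "?P xs0" using inflations_iff[OF \<theta> C] \<nu> by auto
      from ex_has_least_nat[of ?P, OF this, of length]
      obtain xs ys where s: "\<nu> = xs @ ys" "splits \<theta> xs ys" and least: "\<And>xs'. ?P xs' \<Longrightarrow> length xs \<le> length xs'" by blast
      have cs: "standardize xs \<in> C" "standardize ys \<in> C"
        using s by (auto intro!: standardize_in_C[OF C] simp: splits_def)
      have "standardize xs \<notin> inflations \<theta>"
      proof
        assume "standardize xs \<in> inflations \<theta>"
        then obtain as bs where ab: "standardize xs = as @ bs" "splits \<theta> as bs" using inflations_iff[OF \<theta> cs(1)] by auto
        let ?r = "rank_in (set xs)" let ?a = "take (length as) xs" let ?b = "drop (length as) xs"
        have "map ?r ?a = take (length as) (standardize xs)" "map ?r ?b = drop (length as) (standardize xs)"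
          by (simp_all add: standardize_rank take_map drop_map)
        then have r: "as = map ?r ?a" "bs = map ?r ?b" using ab by auto
        have in_xs: "set ?a \<subseteq> set xs" "set ?b \<subseteq> set xs" by (auto dest: in_set_takeD in_set_dropD)
        have "splits \<theta> ?a ?b" unfolding splits_def
        proof (intro conjI ballI)
          show "?a \<noteq> []" "?b \<noteq> []" using ab(2) r by (auto simp: splits_def)
          fix x y assume xy: "x \<in> set ?a" "y \<in> set ?b"
          then have "?r x \<in> set as" "?r y \<in> set bs" using r by (metis image_eqI list.set_map)+
          then have "?r x < ?r y \<longleftrightarrow> \<theta> ! 0 < \<theta> ! 1" using ab(2) unfolding splits_def by blast
          then show "x < y \<longleftrightarrow> \<theta> ! 0 < \<theta> ! 1" using rank_in_less_iff[of "set xs" x y] xy in_xs by auto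
        qed
        moreover have "set ?a \<subseteq> set xs" by (rule in_xs)
        ultimately have "splits \<theta> ?a (?b @ ys)" using s(2) by (auto simp: splits_def)
        moreover have "\<nu> = ?a @ (?b @ ys)" using s by simp
        ultimately have "length xs \<le> length ?a" using least by blast
        then have "?b = []" by simp
        then show False using r ab(2) by (auto simp: splits_def)
      qed
      then have "(\<theta>, [standardize xs, standardize ys]) \<in> binary_pairs \<theta>" using cs by (simp add: binary_pairs_def)
      then show "\<nu> \<in> (\<lambda>(\<theta>, \<nu>s). substitution \<theta> \<nu>s) ` binary_pairs \<theta>"
        using split_substitution(2)[OF \<theta> C_perms[OF C] s] by force
    qed
  qed
qed

lemma bij_simple_pairs:
  "bij_betw (\<lambda>(\<theta>, \<nu>s). substitution \<theta> \<nu>s) simple_pairs (remaining - {[1]})"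
  unfolding bij_betw_def
proof
  have bd: "block_decomp (blocks \<alpha> \<nu>s) (substitution \<alpha> \<nu>s)" "block_quotient (blocks \<alpha> \<nu>s) = \<alpha>"
    "map standardize (blocks \<alpha> \<nu>s) = \<nu>s" "simple_perm \<alpha>" "substitution \<alpha> \<nu>s \<in> C"
    if "(\<alpha>, \<nu>s) \<in> simple_pairs" for \<alpha> \<nu>s
    using that C_perms by (auto simp: simple_pairs_def simples_def subset_iff intro!: block_decomp_blocks
        blocks_quotient map_standardize_blocks substitution_in_C)
  show "inj_on (\<lambda>(\<theta>, \<nu>s). substitution \<theta> \<nu>s) simple_pairs"
  proof (rule inj_onI)
    fix p p' assume p: "p \<in> simple_pairs" and p': "p' \<in> simple_pairs"
      and eq: "(case p of (\<theta>, \<nu>s) \<Rightarrow> substitution \<theta> \<nu>s) = (case p' of (\<theta>, \<nu>s) \<Rightarrow> substitution \<theta> \<nu>s)"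
    obtain \<alpha> \<nu>s where a: "p = (\<alpha>, \<nu>s)" by (cases p)
    obtain \<alpha>' \<nu>s' where a': "p' = (\<alpha>', \<nu>s')" by (cases p')
    note b = bd[OF p[unfolded a]] and b' = bd[OF p'[unfolded a']]
    have e: "substitution \<alpha>' \<nu>s' = substitution \<alpha> \<nu>s" using eq a a' by simp
    have "blocks \<alpha> \<nu>s = blocks \<alpha>' \<nu>s'"
      by (rule simple_block_decomp_unique[OF C_perms[OF b(5)] b(1) b'(1)[unfolded e]]) (use b b' in auto)
    then have "\<alpha> = \<alpha>'" "\<nu>s = \<nu>s'" using b(2,3) b'(2,3) by metis+
    then show "p = p'" using a a' by simp
  qed
  show "(\<lambda>(\<theta>, \<nu>s). substitution \<theta> \<nu>s) ` simple_pairs = remaining - {[1]}"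
  proof (intro subset_antisym subsetI)
    fix \<nu> assume "\<nu> \<in> (\<lambda>(\<theta>, \<nu>s). substitution \<theta> \<nu>s) ` simple_pairs"
    then obtain \<alpha> \<nu>s where a: "(\<alpha>, \<nu>s) \<in> simple_pairs" "\<nu> = substitution \<alpha> \<nu>s" by auto
    note b = bd[OF a(1)]
    let ?xss = "blocks \<alpha> \<nu>s"
    have d: "length ?xss > 2" using b(4) by (simp add: simple_perm_def)
    have C: "\<nu> \<in> C" using b a by simp
    have ne: "xs \<noteq> []" if "xs \<in> set ?xss" for xs using b(1) that by (auto simp: block_decomp_def)
    \<comment> \<open>Each half of a cut would lie inside a single block, but there are at least
      three blocks.\<close>
    have "\<nu> \<notin> inflations \<theta>" if \<theta>: "\<theta> \<in> dirs" for \<theta>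
    proof
      assume "\<nu> \<in> inflations \<theta>"
      then obtain xs ys where s: "\<nu> = xs @ ys" "splits \<theta> xs ys" using inflations_iff[OF \<theta> C] by auto
      have bd2: "block_decomp [xs, ys] \<nu>" by (rule split_substitution(1)[OF \<theta> C_perms[OF C] s])
      have iv: "nat_interval (set xs)" "nat_interval (set ys)" "xs \<noteq> []" "ys \<noteq> []" using bd2 by (auto simp: block_decomp_def)
      note w = simple_block_within[OF C_perms[OF C], of ?xss]
      have "\<exists>i<length ?xss. set xs \<subseteq> set (?xss ! i)"
        using w[of "[]" xs ys] b a s iv by auto
      then obtain i where i: "i < length ?xss" "set xs \<subseteq> set (?xss ! i)" by blast
      have "\<exists>i<length ?xss. set ys \<subseteq> set (?xss ! i)"
        using w[of xs ys "[]"] b a s iv by auto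
      then obtain j where j: "j < length ?xss" "set ys \<subseteq> set (?xss ! j)" by blast
      have "\<exists>l<length ?xss. l \<noteq> i \<and> l \<noteq> j"
      proof (rule ccontr)
        assume "\<not> ?thesis"
        then have "{..<length ?xss} \<subseteq> {i, j}" by auto
        from card_mono[OF _ this] have "length ?xss \<le> card {i, j}" by simp
        also have "\<dots> \<le> 2" by (simp add: card_insert_if)
        finally show False using d by simp
      qed
      then obtain l where l: "l < length ?xss" "l \<noteq> i" "l \<noteq> j" by auto
      have h: "hd (?xss ! l) \<in> set (?xss ! l)" using ne l by simp
      have conc: "\<nu> = concat ?xss" using a by (simp add: substitution_blocks)
      have "hd (?xss ! l) \<in> set \<nu>" using h l conc by auto
      then have "hd (?xss ! l) \<in> set (?xss ! i) \<or> hd (?xss ! l) \<in> set (?xss ! j)" using s i j by auto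
      then show False using distinct_concat_nth[of ?xss l i] distinct_concat_nth[of ?xss l j] h l i j conc C_distinct[OF C] by auto
    qed
    then have "\<nu> \<in> remaining" using C by (simp add: remaining_def)
    moreover have "length \<nu> > 1"
    proof -
      have "length \<nu> = (\<Sum>xs\<leftarrow>?xss. length xs)" using a by (simp add: substitution_blocks length_concat)
      moreover have "length ?xss \<le> (\<Sum>xs\<leftarrow>?xss. length xs)" using ne by (intro length_le_sum_list) (auto simp: Suc_le_eq)
      ultimately show ?thesis using d by linarith
    qed
    ultimately show "\<nu> \<in> remaining - {[1]}" by auto
  next
    fix \<nu> assume \<nu>: "\<nu> \<in> remaining - {[1]}"
    then have C: "\<nu> \<in> C" by (simp add: remaining_def)
    have p: "\<nu> \<in> perms" by (rule C_perms[OF C])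
    have "length \<nu> \<ge> 2" using \<nu> perms_length1[OF p] C_length[OF C] by auto
    from minimal_block_decomp[OF p this]
    obtain xss where x: "block_decomp xss \<nu>" "length xss = 2 \<or> simple_perm (block_quotient xss)" by auto
    have "xss \<noteq> []" using x(2) by (auto simp: simple_perm_def)
    have ne: "[] \<notin> set xss" and conc: "\<nu> = concat xss" using x(1) by (auto simp: block_decomp_def)
    have q: "block_quotient xss \<in> C" unfolding block_quotient_def
      using subseq_map_hd_concat[OF ne] conc \<open>xss \<noteq> []\<close> by (intro standardize_in_C[OF C]) auto
    have parts: "set (map standardize xss) \<subseteq> C"
      using subseq_concat_member conc ne by (auto intro!: standardize_in_C[OF C])
    have sub: "substitution (block_quotient xss) (map standardize xss) = \<nu>"
      by (rule substitution_of_block_decomp[OF p x(1)])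
    \<comment> \<open>With only two blocks the quotient would be 12 or 21, and \<open>\<nu>\<close>
      would be decomposable.\<close>
    have "simple_perm (block_quotient xss)"
    proof (rule ccontr)
      assume "\<not> ?thesis"
      then have l2: "length xss = 2" using x(2) by simp
      then obtain xs ys where xy: "xss = [xs, ys]" by (cases xss; cases "tl xss") auto
      have "block_quotient xss \<in> dirs" using perms_length2[OF C_perms[OF q]] l2 by auto
      moreover have "\<nu> \<in> inflations (block_quotient xss)" unfolding inflations_def
        using sub parts xy by auto
      ultimately show False using \<nu> by (auto simp: remaining_def)
    qed
    then have "(block_quotient xss, map standardize xss) \<in> simple_pairs"
      using q parts by (simp add: simple_pairs_def simples_def)
    then show "\<nu> \<in> (\<lambda>(\<theta>, \<nu>s). substitution \<theta> \<nu>s) ` simple_pairs" using sub by force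
  qed
qed

end

subsection \<open>The Marcus--Tardos theorem\<close>

text \<open>Containment of 0-1 matrices, given by their sets of ones: \<open>f\<close> selects rows
  and \<open>g\<close> columns. Further ones of \<open>E\<close> in the selected rows and columns
  are allowed.\<close>

definition embeds :: "nat \<Rightarrow> (nat \<times> nat) set \<Rightarrow> (nat \<times> nat) set \<Rightarrow> bool" where
  "embeds k P E \<longleftrightarrow> (\<exists>f g. strict_mono_on {..<k} f \<and> strict_mono_on {..<k} g \<and> (\<forall>(i, v)\<in>P. (f i, g v) \<in> E))"

definition perm_matrix :: "nat \<Rightarrow> (nat \<times> nat) set \<Rightarrow> bool" where
  "perm_matrix k P \<longleftrightarrow> (\<exists>p. bij_betw p {..<k} {..<k} \<and> P = (\<lambda>i. (i, p i)) ` {..<k})"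

text \<open>The block matrix of the Marcus-Tardos argument: squares of side \<open>b\<close>, marked
  when nonempty.\<close>

definition contract :: "nat \<Rightarrow> (nat \<times> nat) set \<Rightarrow> (nat \<times> nat) set" where
  "contract b E = (\<lambda>(x, y). (x div b, y div b)) ` E"

lemma embeds_converse: "embeds k (P\<inverse>) (E\<inverse>) \<longleftrightarrow> embeds k P E"
proof -
  have "embeds k (P\<inverse>) (E\<inverse>)" if emb: "embeds k P E" for P E
  proof -
    obtain f g where "strict_mono_on {..<k} f" "strict_mono_on {..<k} g" "\<forall>(i, v)\<in>P. (f i, g v) \<in> E"
      using emb unfolding embeds_def by auto
    then show ?thesis unfolding embeds_def by (intro exI[of _ g] exI[of _ f]) auto
  qed
  from this[of P E] this[of "P\<inverse>" "E\<inverse>"] show ?thesis by auto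
qed

lemma perm_matrix_converse: "perm_matrix k P \<Longrightarrow> perm_matrix k (P\<inverse>)"
proof -
  assume "perm_matrix k P"
  then obtain p where p: "bij_betw p {..<k} {..<k}" "P = (\<lambda>i. (i, p i)) ` {..<k}" by (auto simp: perm_matrix_def)
  let ?q = "inv_into {..<k} p"
  have q: "bij_betw ?q {..<k} {..<k}" by (rule bij_betw_inv_into[OF p(1)])
  have "P\<inverse> = (\<lambda>i. (p i, i)) ` {..<k}" unfolding p(2) by auto
  also have "\<dots> = (\<lambda>i. (p i, ?q (p i))) ` {..<k}"
    using p(1) by (intro image_cong) (auto simp: bij_betw_inv_into_left)
  also have "\<dots> = (\<lambda>v. (v, ?q v)) ` p ` {..<k}" by (simp add: image_image)
  also have "p ` {..<k} = {..<k}" using p(1) by (simp add: bij_betw_def)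
  finally show ?thesis using q unfolding perm_matrix_def by blast
qed

lemma less_of_div_less: "x div b < y div b \<Longrightarrow> x < (y :: nat)"
  by (meson div_le_mono not_le)

text \<open>\<open>P\<close> has a single one in each row and column. So one entry of
  \<open>E\<close> from each selected square suffices, and entries of squares in different block
  rows or block columns are ordered like the squares.\<close>

lemma embeds_contract:
  assumes P: "perm_matrix k P" and emb: "embeds k P (contract b E)"
  shows "embeds k P E"
proof -
  obtain p where p: "bij_betw p {..<k} {..<k}" "P = (\<lambda>i. (i, p i)) ` {..<k}" using P by (auto simp: perm_matrix_def)
  obtain f g where fg: "strict_mono_on {..<k} f" "strict_mono_on {..<k} g" "\<forall>(i, v)\<in>P. (f i, g v) \<in> contract b E"
    using emb unfolding embeds_def by auto
  have "\<forall>i\<in>{..<k}. \<exists>e. e \<in> E \<and> fst e div b = f i \<and> snd e div b = g (p i)"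
  proof
    fix i assume "i \<in> {..<k}"
    then have "(f i, g (p i)) \<in> contract b E" using fg(3) p(2) by auto
    then show "\<exists>e. e \<in> E \<and> fst e div b = f i \<and> snd e div b = g (p i)" unfolding contract_def by force
  qed
  from bchoice[OF this] obtain e where e: "\<forall>i\<in>{..<k}. e i \<in> E \<and> fst (e i) div b = f i \<and> snd (e i) div b = g (p i)"
    by (rule exE)
  let ?q = "inv_into {..<k} p"
  have q: "?q v \<in> {..<k}" "p (?q v) = v" if "v \<in> {..<k}" for v
    using bij_betw_inv_into_right[OF p(1) that] bij_betwE[OF bij_betw_inv_into[OF p(1)]] that by auto
  have "strict_mono_on {..<k} (\<lambda>i. fst (e i))"
  proof (rule strict_mono_onI)
    fix i j assume ij: "i \<in> {..<k}" "j \<in> {..<k}" "i < j"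
    then have "f i < f j" using fg(1) by (auto simp: strict_mono_on_def)
    then show "fst (e i) < fst (e j)" using e ij by - (rule less_of_div_less[of _ b], simp)
  qed
  moreover have "strict_mono_on {..<k} (\<lambda>v. snd (e (?q v)))"
  proof (rule strict_mono_onI)
    fix v w assume vw: "v \<in> {..<k}" "w \<in> {..<k}" "v < w"
    then have "g v < g w" using fg(2) by (auto simp: strict_mono_on_def)
    then show "snd (e (?q v)) < snd (e (?q w))" using e q[OF vw(1)] q[OF vw(2)] by - (rule less_of_div_less[of _ b], simp)
  qed
  moreover have "\<forall>(i, v)\<in>P. (fst (e i), snd (e (?q v))) \<in> E"
    using p e by (auto simp: bij_betw_inv_into_left)
  ultimately show ?thesis unfolding embeds_def by blast
qed

lemma pigeonhole_fibre:
  assumes "finite W" "finite Q" "h ` W \<subseteq> Q" "card W > k * card Q"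
  shows "\<exists>q\<in>Q. card {i \<in> W. h i = q} \<ge> k"
proof (rule ccontr)
  assume "\<not> ?thesis"
  then have "card {i \<in> W. h i = q} \<le> k" if "q \<in> Q" for q using that by force
  then have "(\<Sum>q\<in>Q. card {i \<in> W. h i = q}) \<le> card Q * k" using sum_bounded_above[of Q "\<lambda>q. card {i \<in> W. h i = q}" k] by simp
  moreover have "W = (\<Union>q\<in>Q. {i \<in> W. h i = q})" using assms(3) by auto
  then have "card W \<le> (\<Sum>q\<in>Q. card {i \<in> W. h i = q})" using card_UN_le[OF assms(2), of "\<lambda>q. {i \<in> W. h i = q}"] by simp
  ultimately show False using assms(4) by (simp add: mult.commute)
qed

lemma strict_mono_enumeration:
  assumes "finite A" "card A \<ge> k"
  obtains s :: "nat \<Rightarrow> nat" where "strict_mono_on {..<k} s" "\<And>i. i < k \<Longrightarrow> s i \<in> A"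
proof
  let ?l = "sorted_list_of_set A"
  have l: "length ?l \<ge> k" using assms by simp
  show "strict_mono_on {..<k} ((!) ?l)"
    using l by (auto simp: strict_mono_on_def intro!: sorted_wrt_nth_less[OF strict_sorted_list_of_set])
  show "?l ! i \<in> A" if "i < k" for i using l that assms(1) nth_mem[of i ?l] by simp
qed

text \<open>A block is wide when it has at least \<open>k\<close> nonempty columns; tall blocks are
  the wide blocks of the converse relation.\<close>

definition block_cols :: "nat \<Rightarrow> (nat \<times> nat) set \<Rightarrow> nat \<Rightarrow> nat \<Rightarrow> nat set" where
  "block_cols b E i j = {y. \<exists>x. (x, y) \<in> E \<and> x div b = i \<and> y div b = j}"

lemma block_cols_subset: "b > 0 \<Longrightarrow> block_cols b E i j \<subseteq> {j * b..<j * b + b}"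
  using dividend_less_div_times[of b]
  by (auto simp: block_cols_def div_times_less_eq_dividend add.commute)

text \<open>Many wide blocks above each other contain \<open>k\<close> that meet the same set of at least \<open>k\<close> columns,
  and these blocks embed every permutation matrix of size \<open>k\<close>.\<close>

lemma wide_blocks_bound:
  assumes P: "perm_matrix k P" and k: "k > 0" and E: "finite E" and b: "b > 0" and av: "\<not> embeds k P E"
  shows "finite {i. card (block_cols b E i j) \<ge> k}" "card {i. card (block_cols b E i j) \<ge> k} \<le> k * 2 ^ b"
proof -
  let ?W = "{i. card (block_cols b E i j) \<ge> k}"
  have "?W \<subseteq> (\<lambda>(x, y). x div b) ` E"
  proof
    fix i assume "i \<in> ?W"
    then have "block_cols b E i j \<noteq> {}" using k by (auto intro: ccontr)
    then show "i \<in> (\<lambda>(x, y). x div b) ` E" by (force simp: block_cols_def)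
  qed
  then show fin: "finite ?W" using E by (meson finite_imageI finite_subset)
  show "card ?W \<le> k * 2 ^ b"
  proof (rule ccontr)
    assume "\<not> ?thesis"
    then have gt: "card ?W > k * card (Pow {j * b..<j * b + b})" by (simp add: card_Pow)
    have "(\<lambda>i. block_cols b E i j) ` ?W \<subseteq> Pow {j * b..<j * b + b}" using block_cols_subset[OF b] by auto
    from pigeonhole_fibre[OF fin _ this gt] obtain Y where Y: "Y \<subseteq> {j * b..<j * b + b}"
      "card {i \<in> ?W. block_cols b E i j = Y} \<ge> k" by auto
    let ?R = "{i \<in> ?W. block_cols b E i j = Y}"
    have "?R \<noteq> {}" using Y(2) k by (auto simp only: card.empty)
    then have cY: "card Y \<ge> k" by auto
    obtain p where p: "bij_betw p {..<k} {..<k}" "P = (\<lambda>i. (i, p i)) ` {..<k}" using P by (auto simp: perm_matrix_def)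
    obtain r where r: "strict_mono_on {..<k} r" "\<And>i. i < k \<Longrightarrow> r i \<in> ?R"
      using strict_mono_enumeration[of ?R k] fin Y(2) by auto
    have "finite Y" using Y(1) finite_subset by blast
    then obtain s where s: "strict_mono_on {..<k} s" "\<And>i. i < k \<Longrightarrow> s i \<in> Y"
      using strict_mono_enumeration[of Y k] cY by auto
    have pk: "p i < k" if "i < k" for i using bij_betwE[OF p(1)] that by auto
    have "\<forall>i\<in>{..<k}. \<exists>x. (x, s (p i)) \<in> E \<and> x div b = r i"
    proof
      fix i assume "i \<in> {..<k}"
      then have "s (p i) \<in> block_cols b E (r i) j" using r(2)[of i] s(2)[of "p i"] pk by simp
      then show "\<exists>x. (x, s (p i)) \<in> E \<and> x div b = r i" by (auto simp: block_cols_def)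
    qed
    from bchoice[OF this] obtain x where x: "\<forall>i\<in>{..<k}. (x i, s (p i)) \<in> E \<and> x i div b = r i" by (rule exE)
    have "strict_mono_on {..<k} x"
    proof (rule strict_mono_onI)
      fix i j assume ij: "i \<in> {..<k}" "j \<in> {..<k}" "i < j"
      then have "r i < r j" using r(1) by (auto simp: strict_mono_on_def)
      then show "x i < x j" using x ij by - (rule less_of_div_less[of _ b], simp)
    qed
    moreover have "\<forall>(i, v)\<in>P. (x i, s v) \<in> E" using x p(2) by auto
    ultimately have "embeds k P E" using s(1) unfolding embeds_def by blast
    then show False using av by simp
  qed
qed

lemma contract_bound:
  assumes E: "E \<subseteq> {..<n} \<times> {..<n}" and b: "b > 0"
  shows "contract b E \<subseteq> {..<n div b + 1} \<times> {..<n div b + 1}"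
proof -
  have "x div b < n div b + 1" if "x < n" for x using div_le_mono[of x n b] that by simp
  then show ?thesis using E by (auto simp: contract_def)
qed

text \<open>A block neither wide nor tall has its entries in a product of at most \<open>k\<close>
  rows and at most \<open>k\<close> columns. The wide ones number at most \<open>k * 2 ^ b\<close>
  per block column, the tall ones as many per block row, and each holds at most \<open>b^2\<close>
  entries.\<close>

lemma card_contract_step:
  assumes P: "perm_matrix k P" and k: "k > 0" and E: "E \<subseteq> {..<n} \<times> {..<n}" and b: "b > 0" and av: "\<not> embeds k P E"
  shows "card E \<le> k\<^sup>2 * card (contract b E) + 2 * b\<^sup>2 * k * 2 ^ b * (n div b + 1)"
proof -
  let ?m = "n div b + 1"
  have fin: "finite E" using E finite_subset by blast
  have av': "\<not> embeds k (P\<inverse>) (E\<inverse>)" using av embeds_converse by simp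
  let ?B = "\<lambda>ij. {e \<in> E. (fst e div b, snd e div b) = ij}"
  let ?Y = "\<lambda>i j. block_cols b E i j" and ?X = "\<lambda>i j. block_cols b (E\<inverse>) j i"
  define W where "W = (\<Union>j<?m. {i. card (?Y i j) \<ge> k} \<times> {j})"
  define V where "V = (\<Union>i<?m. {i} \<times> {j. card (?X i j) \<ge> k})"
  note w1 = wide_blocks_bound[OF P k fin b av] and w2 = wide_blocks_bound[OF perm_matrix_converse[OF P] k finite_converse[THEN iffD2, OF fin] b av']
  have finWV: "finite W" "finite V" unfolding W_def V_def using w1 w2 by auto
  have "card W \<le> (\<Sum>j<?m. card ({i. card (?Y i j) \<ge> k} \<times> {j}))" unfolding W_def by (rule card_UN_le) simp
  also have "\<dots> \<le> (\<Sum>j<?m. k * 2 ^ b)" using w1(2) by (intro sum_mono) (simp add: card_cartesian_product)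
  finally have cW: "card W \<le> k * 2 ^ b * ?m" by (simp add: algebra_simps)
  have "card V \<le> (\<Sum>i<?m. card ({i} \<times> {j. card (?X i j) \<ge> k}))" unfolding V_def by (rule card_UN_le) simp
  also have "\<dots> \<le> (\<Sum>i<?m. k * 2 ^ b)" using w2(2) by (intro sum_mono) (simp add: card_cartesian_product)
  finally have cV: "card V \<le> k * 2 ^ b * ?m" by (simp add: algebra_simps)
  have sub: "?B (i, j) \<subseteq> ?X i j \<times> ?Y i j" for i j by (auto simp: block_cols_def)
  have finXY: "finite (?X i j)" "finite (?Y i j)" "card (?X i j) \<le> b" "card (?Y i j) \<le> b" for i j
    using block_cols_subset[OF b, of E i j] block_cols_subset[OF b, of "E\<inverse>" j i]
    by (auto intro: finite_subset dest: card_mono[rotated])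
  have Bij: "card (?B (i, j)) \<le> card (?X i j) * card (?Y i j)" for i j
    using card_mono[OF _ sub[of i j]] finXY[where i = i and j = j] by (simp add: card_cartesian_product)
  have big: "card (?B ij) \<le> b\<^sup>2" for ij
  proof (cases ij)
    case (Pair i j)
    have "card (?X i j) * card (?Y i j) \<le> b * b" using finXY(3,4) by (intro mult_le_mono) auto
    then show ?thesis using Bij[of i j] Pair by (simp add: power2_eq_square)
  qed
  have small: "card (?B ij) \<le> k\<^sup>2" if ij: "ij \<in> contract b E - (W \<union> V)" for ij
  proof (cases ij)
    case (Pair i j)
    have "i < ?m" "j < ?m" using contract_bound[OF E b] ij Pair by auto
    then have "card (?Y i j) \<le> k" "card (?X i j) \<le> k" using ij Pair by (auto simp: W_def V_def)
    then have "card (?X i j) * card (?Y i j) \<le> k * k" by (intro mult_le_mono)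
    then show ?thesis using Bij[of i j] Pair by (simp add: power2_eq_square)
  qed
  have fc: "finite (contract b E)" using fin by (simp add: contract_def)
  have "E \<subseteq> (\<Union>ij\<in>contract b E. ?B ij)" by (force simp: contract_def)
  then have "E \<subseteq> (\<Union>ij\<in>contract b E - (W \<union> V). ?B ij) \<union> (\<Union>ij\<in>W \<union> V. ?B ij)" by blast
  from card_mono[OF _ this] have "card E \<le> card ((\<Union>ij\<in>contract b E - (W \<union> V). ?B ij) \<union> (\<Union>ij\<in>W \<union> V. ?B ij))"
    using fc fin finWV by simp
  also have "\<dots> \<le> card (\<Union>ij\<in>contract b E - (W \<union> V). ?B ij) + card (\<Union>ij\<in>W \<union> V. ?B ij)" by (rule card_Un_le)
  also have "card (\<Union>ij\<in>contract b E - (W \<union> V). ?B ij) \<le> (\<Sum>ij\<in>contract b E - (W \<union> V). card (?B ij))"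
    using fc by (intro card_UN_le) simp
  also have "\<dots> \<le> (\<Sum>ij\<in>contract b E - (W \<union> V). k\<^sup>2)" by (rule sum_mono[OF small])
  also have "\<dots> = k\<^sup>2 * card (contract b E - (W \<union> V))" by simp
  also have "\<dots> \<le> k\<^sup>2 * card (contract b E)" using fc by (intro mult_le_mono2 card_mono) auto
  also have "card (\<Union>ij\<in>W \<union> V. ?B ij) \<le> (\<Sum>ij\<in>W \<union> V. card (?B ij))" using finWV by (intro card_UN_le) simp
  also have "\<dots> \<le> (\<Sum>ij\<in>W \<union> V. b\<^sup>2)" by (rule sum_mono[OF big])
  also have "\<dots> = b\<^sup>2 * card (W \<union> V)" by simp
  also have "\<dots> \<le> b\<^sup>2 * (card W + card V)" by (intro mult_le_mono2 card_Un_le)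
  also have "\<dots> \<le> b\<^sup>2 * (k * 2 ^ b * ?m + k * 2 ^ b * ?m)" using cW cV by (intro mult_le_mono2 add_mono)
  also have "\<dots> = 2 * b\<^sup>2 * k * 2 ^ b * ?m" by (simp add: algebra_simps)
  finally show ?thesis by simp
qed

theorem marcus_tardos:
  assumes P: "perm_matrix k P" and k: "k > 0"
  shows "\<exists>c. \<forall>n E. E \<subseteq> {..<n} \<times> {..<n} \<longrightarrow> \<not> embeds k P E \<longrightarrow> card E \<le> c * n"
proof -
  \<comment> \<open>With this \<open>b\<close>, the main term of \<open>card_contract_step\<close>
    is at most \<open>c * (n / 2 + k^2) <= 3/4 * c * n\<close> once \<open>n >= 4 * k^2\<close>. In
    \<open>c\<close>, the summand \<open>4 * D\<close> absorbs the other term into the last quarter,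
    and \<open>4 * k^2\<close> covers smaller \<open>n\<close>, where \<open>n * n\<close> is the
    trivial bound.\<close>
  define b where "b = 2 * k\<^sup>2"
  define D where "D = 2 * b\<^sup>2 * k * 2 ^ b"
  define c where "c = 4 * k\<^sup>2 + 4 * D"
  have k2: "k\<^sup>2 \<ge> 1" using k by simp
  then have b: "b \<ge> 2" by (simp add: b_def)
  have "card E \<le> c * n" if "E \<subseteq> {..<n} \<times> {..<n}" "\<not> embeds k P E" for n E
    using that
  proof (induction n arbitrary: E rule: less_induct)
    case (less n)
    show ?case
    proof (cases "n < 4 * k\<^sup>2")
      case True
      have "card E \<le> card ({..<n} \<times> {..<n})" using less.prems(1) by (intro card_mono) auto
      also have "\<dots> = n * n" by (simp add: card_cartesian_product)
      also have "\<dots> \<le> c * n" using True by (intro mult_le_mono1) (simp add: c_def)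
      finally show ?thesis .
    next
      case False
      let ?m = "n div b + 1"
      have n4: "n \<ge> 4 * k\<^sup>2" "n \<ge> 4" using False k2 by linarith+
      have "n div b \<le> n div 2" using b by (rule div_le_mono2[OF _ , rotated]) simp
      then have m: "?m < n" using n4 by linarith
      have "b * (n div b) \<le> n" by simp
      then have m2: "4 * (k\<^sup>2 * ?m) \<le> 3 * n" using n4 unfolding b_def by (simp add: algebra_simps)
      have "\<not> embeds k P (contract b E)" using embeds_contract[OF P] less.prems(2) by blast
      from less.IH[OF m contract_bound[OF less.prems(1)] this] b
      have "card (contract b E) \<le> c * ?m" by simp
      then have "k\<^sup>2 * card (contract b E) \<le> c * (k\<^sup>2 * ?m)" by (metis mult.left_commute mult_le_mono2)
      then have "4 * (k\<^sup>2 * card (contract b E)) \<le> 4 * (c * (k\<^sup>2 * ?m))" by (rule mult_le_mono2)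
      also have "\<dots> = c * (4 * (k\<^sup>2 * ?m))" by (simp only: mult.left_commute)
      also have "\<dots> \<le> c * (3 * n)" using m2 by (rule mult_le_mono2)
      finally have 1: "4 * (k\<^sup>2 * card (contract b E)) \<le> c * (3 * n)" .
      have "4 * (D * ?m) \<le> 4 * (D * n)" using m by (intro mult_le_mono2) simp
      also have "\<dots> \<le> c * n" by (simp add: c_def algebra_simps)
      finally have 2: "4 * (D * ?m) \<le> c * n" .
      have "card E \<le> k\<^sup>2 * card (contract b E) + D * ?m"
        using card_contract_step[OF P k less.prems(1) _ less.prems(2), of b] b by (simp add: D_def)
      then have "4 * card E \<le> 4 * (c * n)" using 1 2 by simp
      then show ?thesis by simp
    qed
  qed
  then show ?thesis by blast
qed

subsection \<open>The Stanley--Wilf bound\<close>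

definition avoiders :: "nat \<Rightarrow> (nat \<times> nat) set \<Rightarrow> nat \<Rightarrow> (nat \<times> nat) set set" where
  "avoiders k P n = {E. E \<subseteq> {..<n} \<times> {..<n} \<and> \<not> embeds k P E}"

lemma finite_avoiders: "finite (avoiders k P n)"
  by (rule finite_subset[of _ "Pow ({..<n} \<times> {..<n})"]) (auto simp: avoiders_def)

lemma card_le_fibres:
  assumes "finite B" "h ` A \<subseteq> B" "finite A" "\<And>y. y \<in> B \<Longrightarrow> card {x \<in> A. h x = y} \<le> r"
  shows "card A \<le> card B * r"
proof -
  have "A = (\<Union>y\<in>B. {x \<in> A. h x = y})" using assms(2) by auto
  then have "card A \<le> (\<Sum>y\<in>B. card {x \<in> A. h x = y})" using card_UN_le[OF assms(1), of "\<lambda>y. {x \<in> A. h x = y}"] by simp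
  also have "\<dots> \<le> (\<Sum>y\<in>B. r)" by (rule sum_mono[OF assms(4)])
  finally show ?thesis by simp
qed

text \<open>An avoiding matrix of side 2m contracts to an avoiding matrix \<open>F\<close> of side
  m, and is then a subset of the \<open>4 * card F\<close> cells below \<open>F\<close>; the linear
  bound \<open>c\<close> applies to \<open>F\<close>.\<close>

lemma card_avoiders_double:
  assumes P: "perm_matrix k P" and c: "\<And>n E. E \<in> avoiders k P n \<Longrightarrow> card E \<le> c * n"
  shows "card (avoiders k P (2 * m)) \<le> card (avoiders k P m) * 2 ^ (4 * (c * m))"
proof (rule card_le_fibres[where h = "contract 2"])
  show "contract 2 ` avoiders k P (2 * m) \<subseteq> avoiders k P m"
  proof
    fix F assume "F \<in> contract 2 ` avoiders k P (2 * m)"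
    then obtain E where E: "F = contract 2 E" "E \<subseteq> {..<2*m} \<times> {..<2*m}" "\<not> embeds k P E" by (auto simp: avoiders_def)
    have "\<not> embeds k P F" using embeds_contract[OF P, of 2 E] E by blast
    moreover have "F \<subseteq> {..<m} \<times> {..<m}" using E by (auto simp: contract_def)
    ultimately show "F \<in> avoiders k P m" by (simp add: avoiders_def)
  qed
  fix F assume F: "F \<in> avoiders k P m"
  have finF: "finite F" using F finite_subset[of F "{..<m} \<times> {..<m}"] by (auto simp: avoiders_def)
  let ?G = "(\<lambda>((i, j), (s, t)). (2 * i + s, 2 * j + t)) ` (F \<times> ({0,1} \<times> {0,1 :: nat}))"
  have finG: "finite ?G" using finF by simp
  have cG: "card ?G \<le> 4 * (c * m)"
  proof -
    have "card ?G \<le> card (F \<times> ({0,1 :: nat} \<times> {0,1 :: nat}))" using finF by (intro card_image_le) simp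
    also have "\<dots> = card F * 4" by (simp add: card_cartesian_product)
    also have "\<dots> \<le> 4 * (c * m)" using c[OF F] by simp
    finally show ?thesis .
  qed
  have "{E \<in> avoiders k P (2 * m). contract 2 E = F} \<subseteq> Pow ?G"
  proof
    fix E assume "E \<in> {E \<in> avoiders k P (2 * m). contract 2 E = F}"
    then have E: "contract 2 E = F" by simp
    have "(x, y) \<in> ?G" if "(x, y) \<in> E" for x y
    proof -
      have "(x div 2, y div 2) \<in> F" using that E by (force simp: contract_def)
      then have "((x div 2, y div 2), (x mod 2, y mod 2)) \<in> F \<times> ({0,1} \<times> {0,1})" by auto
      from imageI[OF this, of "\<lambda>((i, j), (s, t)). (2 * i + s, 2 * j + t)"] show ?thesis by simp
    qed
    then show "E \<in> Pow ?G" by auto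
  qed
  from card_mono[OF _ this] have "card {E \<in> avoiders k P (2 * m). contract 2 E = F} \<le> 2 ^ card ?G"
    using finG by (simp add: card_Pow)
  also have "\<dots> \<le> 2 ^ (4 * (c * m))" using cG by (intro power_increasing) auto
  finally show "card {E \<in> avoiders k P (2 * m). contract 2 E = F} \<le> 2 ^ (4 * (c * m))" .
qed (rule finite_avoiders)+

lemma card_avoiders_bound:
  assumes P: "perm_matrix k P" and k: "k > 0"
  shows "\<exists>K. \<forall>n. card (avoiders k P n) \<le> K ^ n"
proof -
  obtain c where c: "\<And>n E. E \<in> avoiders k P n \<Longrightarrow> card E \<le> c * n"
    using marcus_tardos[OF P k] by (auto simp: avoiders_def)
  have pow2: "card (avoiders k P (2 ^ j)) \<le> 2 ^ (1 + 4 * c * 2 ^ j)" for j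
  proof -
    \<comment> \<open>The exponents of successive doublings add up to
      \<open>4 * c * (2 ^ j - 1)\<close>; the extra factor \<open>2 ^ (4 * c)\<close> completes this
      geometric sum.\<close>
    have "card (avoiders k P (2 ^ j)) * 2 ^ (4 * c) \<le> 2 ^ (1 + 4 * c * 2 ^ j)"
    proof (induction j)
      case 0
      have "{..<1 :: nat} = {0}" by auto
      then have "avoiders k P 1 \<subseteq> Pow {(0, 0)}" by (auto simp: avoiders_def)
      from card_mono[OF _ this] have "card (avoiders k P 1) \<le> 2" by (simp add: card_Pow)
      then show ?case by simp
    next
      case (Suc j)
      have "card (avoiders k P (2 ^ Suc j)) * 2 ^ (4 * c) \<le> (card (avoiders k P (2 ^ j)) * 2 ^ (4 * (c * 2 ^ j))) * 2 ^ (4 * c)"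
        using card_avoiders_double[OF P c, of "2 ^ j"] by (simp add: mult_le_mono1)
      also have "\<dots> = (card (avoiders k P (2 ^ j)) * 2 ^ (4 * c)) * 2 ^ (4 * (c * 2 ^ j))" by (simp add: mult_ac)
      also have "\<dots> \<le> 2 ^ (1 + 4 * c * 2 ^ j) * 2 ^ (4 * (c * 2 ^ j))" using Suc.IH by (rule mult_le_mono1)
      also have "\<dots> = 2 ^ (1 + 4 * c * 2 ^ Suc j)" by (simp add: power_add[symmetric] algebra_simps)
      finally show ?case .
    qed
    moreover have "card (avoiders k P (2 ^ j)) \<le> card (avoiders k P (2 ^ j)) * 2 ^ (4 * c)" by simp
    ultimately show ?thesis by (rule order_trans[rotated])
  qed
  have "card (avoiders k P n) \<le> (2 ^ (1 + 8 * c)) ^ n" for n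
  proof (cases "n = 0")
    case True
    have "avoiders k P 0 \<subseteq> {{}}" by (auto simp: avoiders_def)
    from card_mono[OF _ this] show ?thesis using True by simp
  next
    case False
    \<comment> \<open>Rounding n up to a power of two at most doubles it, which turns
      \<open>4 * c\<close> into \<open>8 * c\<close>.\<close>
    have "\<exists>j. n \<le> 2 ^ j \<and> 2 ^ j \<le> 2 * n" using False
    proof (induction n)
      case (Suc n)
      show ?case
      proof (cases "n = 0")
        case False
        then obtain j where j: "n \<le> 2 ^ j" "2 ^ j \<le> 2 * n" using Suc by auto
        show ?thesis
        proof (cases "Suc n \<le> 2 ^ j")
          case True
          then show ?thesis using j by (intro exI[of _ j]) simp
        next
          case False
          then have "n = 2 ^ j" using j by simp
          then show ?thesis by (intro exI[of _ "Suc j"]) (use \<open>n \<noteq> 0\<close> in simp)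
        qed
      qed (auto intro!: exI[of _ 0])
    qed simp
    then obtain j where j: "n \<le> 2 ^ j" "2 ^ j \<le> 2 * n" by blast
    have "avoiders k P n \<subseteq> avoiders k P (2 ^ j)" using j(1) by (force simp: avoiders_def)
    then have "card (avoiders k P n) \<le> card (avoiders k P (2 ^ j))" by (intro card_mono finite_avoiders)
    also have "\<dots> \<le> 2 ^ (1 + 4 * c * 2 ^ j)" by (rule pow2)
    also have "\<dots> \<le> 2 ^ ((1 + 8 * c) * n)"
    proof (intro power_increasing)
      have "4 * c * 2 ^ j \<le> 4 * c * (2 * n)" using j(2) by (rule mult_le_mono2)
      moreover have "(1 + 8 * c) * n = n + 4 * c * (2 * n)" by (simp add: distrib_right)
      ultimately show "1 + 4 * c * 2 ^ j \<le> (1 + 8 * c) * n" using False by linarith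
    qed simp
    finally show ?thesis by (simp only: power_mult)
  qed
  then show ?thesis by blast
qed

lemma nths_eq_map_filter: "nths xs I = map ((!) xs) (filter (\<lambda>i. i \<in> I) [0..<length xs])"
proof -
  have "zip xs [0..<length xs] = map (\<lambda>i. (xs ! i, i)) [0..<length xs]"
    by (rule nth_equalityI) auto
  then show ?thesis by (simp add: nths_def filter_map comp_def)
qed

text \<open>A permutation is determined by its matrix, and an embedding of the matrix of
  \<open>\<pi>\<close> exhibits \<open>\<pi>\<close> as a pattern. So the members of size n inject
  into the avoiding matrices. Subtracting 1 passes from values to indices from 0.\<close>

lemma stanley_wilf_bound:
  assumes cl: "permutation_class C" and \<pi>: "\<pi> \<in> perms" "\<pi> \<notin> C"
  shows "\<exists>K. \<forall>n. card {\<nu> \<in> C. length \<nu> = n} \<le> K ^ n"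
proof -
  let ?k = "length \<pi>" let ?P = "(\<lambda>i. (i, \<pi> ! i - 1)) ` {..<?k}"
  let ?E = "\<lambda>\<nu> :: nat list. (\<lambda>i. (i, \<nu> ! i - 1)) ` {..<length \<nu>}"
  have k: "?k > 0" and dpi: "distinct \<pi>" "set \<pi> = {1..?k}" using \<pi> by (auto simp: perms_iff)
  have range: "1 \<le> \<nu> ! i \<and> \<nu> ! i \<le> length \<nu>" if "\<nu> \<in> perms" "i < length \<nu>" for \<nu> i
    using that nth_mem[of i \<nu>] by (simp add: perms_iff)
  have "inj_on (\<lambda>i. \<pi> ! i - 1) {..<?k}"
  proof (rule inj_onI)
    fix i j assume ij: "i \<in> {..<?k}" "j \<in> {..<?k}" "\<pi> ! i - 1 = \<pi> ! j - 1"
    then have "\<pi> ! i = \<pi> ! j" using range[OF \<pi>(1), of i] range[OF \<pi>(1), of j] by auto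
    then show "i = j" using ij dpi by (simp add: nth_eq_iff_index_eq)
  qed
  moreover have "(\<lambda>i. \<pi> ! i - 1) ` {..<?k} \<subseteq> {..<?k}"
  proof
    fix v assume "v \<in> (\<lambda>i. \<pi> ! i - 1) ` {..<?k}"
    then obtain i where i: "i < ?k" "v = \<pi> ! i - 1" by auto
    then show "v \<in> {..<?k}" using range[OF \<pi>(1) i(1)] by simp linarith
  qed
  ultimately have "bij_betw (\<lambda>i. \<pi> ! i - 1) {..<?k} {..<?k}"
    by (simp add: bij_betw_def endo_inj_surj)
  then have P: "perm_matrix ?k ?P" unfolding perm_matrix_def by blast
  obtain K where K: "\<And>n. card (avoiders ?k ?P n) \<le> K ^ n" using card_avoiders_bound[OF P k] by auto
  have "card {\<nu> \<in> C. length \<nu> = n} \<le> K ^ n" for n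
  proof -
    have Cp: "\<nu> \<in> perms" if "\<nu> \<in> C" for \<nu> using cl that by (auto simp: permutation_class_def)
    have "inj_on ?E {\<nu> \<in> C. length \<nu> = n}"
    proof (rule inj_onI)
      fix \<nu> \<nu>' assume h: "\<nu> \<in> {\<nu> \<in> C. length \<nu> = n}" "\<nu>' \<in> {\<nu> \<in> C. length \<nu> = n}" "?E \<nu> = ?E \<nu>'"
      show "\<nu> = \<nu>'"
      proof (rule nth_equalityI)
        fix i assume i: "i < length \<nu>"
        then have "(i, \<nu> ! i - 1) \<in> ?E \<nu>'" using h(3) by blast
        then have "\<nu> ! i - 1 = \<nu>' ! i - 1" by auto
        then show "\<nu> ! i = \<nu>' ! i" using range[of \<nu> i] range[of \<nu>' i] h Cp i by simp linarith
      qed (use h in simp)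
    qed
    moreover have "?E ` {\<nu> \<in> C. length \<nu> = n} \<subseteq> avoiders ?k ?P n"
    proof
      fix E assume "E \<in> ?E ` {\<nu> \<in> C. length \<nu> = n}"
      then obtain \<nu> where \<nu>: "\<nu> \<in> C" "length \<nu> = n" "E = ?E \<nu>" by auto
      have sub: "E \<subseteq> {..<n} \<times> {..<n}"
      proof
        fix e assume "e \<in> E"
        then obtain i where i: "i < n" "e = (i, \<nu> ! i - 1)" using \<nu> by auto
        then show "e \<in> {..<n} \<times> {..<n}" using range[OF Cp[OF \<nu>(1)], of i] \<nu>(2) by simp linarith
      qed
      have "\<not> embeds ?k ?P E"
      proof
        assume "embeds ?k ?P E"
        then obtain f g where fg: "strict_mono_on {..<?k} f" "strict_mono_on {..<?k} g" "\<forall>(i, v)\<in>?P. (f i, g v) \<in> E"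
          unfolding embeds_def by auto
        have fi: "f i < n \<and> \<nu> ! f i = g (\<pi> ! i - 1) + 1" if "i < ?k" for i
        proof -
          have "(f i, g (\<pi> ! i - 1)) \<in> E" using fg(3) that by auto
          then have "f i < n" "g (\<pi> ! i - 1) = \<nu> ! f i - 1" using \<nu> by auto
          then show ?thesis using range[OF Cp[OF \<nu>(1)], of "f i"] \<nu>(2) by simp
        qed
        \<comment> \<open>The entries at the selected positions arise from \<open>\<pi>\<close> by
          an increasing map, so they standardize to \<open>\<pi>\<close>; as \<open>f\<close>
          increases, they form a subsequence of \<open>\<nu>\<close>.\<close>
        define ys where "ys = map (\<lambda>i. \<nu> ! f i) [0..<?k]"
        have "ys = map (\<lambda>v. g (v - 1) + 1) \<pi>"
          by (rule nth_equalityI) (use fi in \<open>auto simp: ys_def\<close>)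
        moreover have "strict_mono_on (set \<pi>) (\<lambda>v. g (v - 1) + 1)"
        proof (rule strict_mono_onI)
          fix v w assume "v \<in> set \<pi>" "w \<in> set \<pi>" "v < w"
          then have "v - 1 \<in> {..<?k}" "w - 1 \<in> {..<?k}" "v - 1 < w - 1" using dpi(2) by auto
          then show "g (v - 1) + 1 < g (w - 1) + 1" using fg(2) by (auto simp: strict_mono_on_def)
        qed
        ultimately have "standardize ys = standardize \<pi>" by (simp only: standardize_map)
        then have st: "standardize ys = \<pi>" using \<pi> by (simp add: standardize_perm_id)
        have "sorted_wrt (<) (map f [0..<?k])" unfolding sorted_wrt_iff_nth_less
          using fg(1) by (auto simp: strict_mono_on_def)
        then have srt: "sorted (map f [0..<?k])" "distinct (map f [0..<?k])" by (simp_all only: strict_sorted_iff)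
        have "filter (\<lambda>i. i \<in> f ` {..<?k}) [0..<length \<nu>] = map f [0..<?k]"
        proof (rule sorted_distinct_set_unique)
          show "set (filter (\<lambda>i. i \<in> f ` {..<?k}) [0..<length \<nu>]) = set (map f [0..<?k])"
            using fi \<nu>(2) by auto
        qed (use srt in \<open>simp_all add: sorted_wrt_filter\<close>)
        then have "nths \<nu> (f ` {..<?k}) = ys" by (simp add: nths_eq_map_filter ys_def)
        then have "subseq ys \<nu>" by (metis subseq_conv_nths)
        moreover have "ys \<noteq> []" using k by (simp add: ys_def)
        ultimately have "is_pattern \<pi> \<nu>" using is_pattern_subseq st by metis
        then have "\<pi> \<in> C" using cl \<nu>(1) by (auto simp: permutation_class_def)
        then show False using \<pi>(2) by simp
      qed
      then show "E \<in> avoiders ?k ?P n" using sub by (simp add: avoiders_def)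
    qed
    ultimately have "card {\<nu> \<in> C. length \<nu> = n} \<le> card (avoiders ?k ?P n)" by (rule card_inj_on_le) (rule finite_avoiders)
    then show ?thesis using K[of n] by (rule order_trans)
  qed
  then show ?thesis by blast
qed

subsection \<open>Weighted partial sums\<close>

context subst_class
begin

text \<open>Truncating by size keeps every sum finite, whatever the growth of
  \<open>g\<close>.\<close>

definition psum :: "(nat list \<Rightarrow> real) \<Rightarrow> nat list set \<Rightarrow> nat \<Rightarrow> real" where
  "psum g X N = (\<Sum>\<nu> | \<nu> \<in> X \<and> length \<nu> \<le> N. g \<nu>)"

definition total_length :: "nat list \<times> nat list list \<Rightarrow> nat" where
  "total_length p = sum_list (map length (snd p))"

definition qsum :: "(nat list \<times> nat list list \<Rightarrow> real) \<Rightarrow> (nat list \<times> nat list list) set \<Rightarrow> nat \<Rightarrow> real" where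
  "qsum h K N = (\<Sum>p | p \<in> K \<and> total_length p \<le> N. h p)"

text \<open>The quotient \<open>fst p\<close> carries weight 1, as in \<open>S(u)\<close>, where a
  simple permutation of size d contributes \<open>u^d\<close>.\<close>

definition parts_weight :: "(nat list \<Rightarrow> real) \<Rightarrow> nat list \<times> nat list list \<Rightarrow> real" where
  "parts_weight g p = prod_list (map g (snd p))"

abbreviation inflate :: "nat list \<times> nat list list \<Rightarrow> nat list" where
  "inflate \<equiv> \<lambda>(\<theta>, \<nu>s). substitution \<theta> \<nu>s"

abbreviation decomps :: "(nat list \<times> nat list list) set" where
  "decomps \<equiv> simple_pairs \<union> binary_pairs [1, 2] \<union> binary_pairs [2, 1]"

lemma decomps_props:
  assumes "p \<in> decomps"
  shows "fst p \<in> C" "length (snd p) = length (fst p)" "set (snd p) \<subseteq> C" "length (fst p) \<ge> 2"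
  using assms id2 swap2 by (auto simp: simple_pairs_def binary_pairs_def simples_def simple_perm_def)

lemma length_inflate:
  assumes "p \<in> decomps"
  shows "length (inflate p) = total_length p"
  using decomps_props(2)[OF assms] by (simp add: total_length_def length_substitution split_def)

text \<open>Makes induction on the size possible: a decomposition of total size at most N + 1 has
  only parts of size at most N.\<close>

lemma length_part_less:
  assumes p: "p \<in> decomps" and \<nu>: "\<nu> \<in> set (snd p)"
  shows "length \<nu> < total_length p"
proof -
  obtain l r where lr: "snd p = l @ \<nu> # r" using \<nu> by (auto simp: in_set_conv_decomp)
  have "length (l @ r) \<le> (\<Sum>\<nu>\<leftarrow>l @ r. length \<nu>)"
    using decomps_props(3)[OF p] lr C_length by (intro length_le_sum_list) auto
  moreover have "length (l @ r) \<ge> 1" using decomps_props(2,4)[OF p] lr by simp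
  ultimately have "1 \<le> (\<Sum>\<nu>\<leftarrow>l @ r. length \<nu>)" by linarith
  moreover have "total_length p = length \<nu> + (\<Sum>\<nu>\<leftarrow>l @ r. length \<nu>)" by (simp add: total_length_def lr)
  ultimately show ?thesis by linarith
qed

lemma length_fst_le:
  assumes p: "p \<in> decomps"
  shows "length (fst p) \<le> total_length p"
proof -
  have "length (snd p) \<le> (\<Sum>\<nu>\<leftarrow>snd p. length \<nu>)"
    using decomps_props(3)[OF p] C_length by (intro length_le_sum_list) auto
  then show ?thesis using decomps_props(2)[OF p] by (simp add: total_length_def)
qed

lemma finite_upto: "finite {\<nu> \<in> C. length \<nu> \<le> N}"
proof (rule finite_subset)
  show "{\<nu> \<in> C. length \<nu> \<le> N} \<subseteq> {xs. set xs \<subseteq> {..N} \<and> length xs \<le> N}"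
    using C_perms by (fastforce simp: perms_iff)
  show "finite {xs. set xs \<subseteq> {..N} \<and> length xs \<le> N}" by (rule finite_lists_length_le) simp
qed

lemma finite_upto_subset: "X \<subseteq> C \<Longrightarrow> finite {\<nu>. \<nu> \<in> X \<and> length \<nu> \<le> N}"
  by (rule finite_subset[OF _ finite_upto[of N]]) auto

lemma inj_on_inflate:
  "inj_on inflate simple_pairs" "\<theta> \<in> dirs \<Longrightarrow> inj_on inflate (binary_pairs \<theta>)"
  using bij_simple_pairs bij_binary_pairs by (auto simp: bij_betw_def)

lemma inflate_in_C: "p \<in> decomps \<Longrightarrow> inflate p \<in> C"
  using decomps_props[of p] by (auto simp: split_def intro!: substitution_in_C)

lemma finite_decomps_upto:
  assumes K: "K \<subseteq> decomps" "inj_on inflate K"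
  shows "finite {p. p \<in> K \<and> total_length p \<le> N}"
proof (rule finite_imageD)
  show "finite (inflate ` {p. p \<in> K \<and> total_length p \<le> N})"
    by (rule finite_subset[OF _ finite_upto[of N]]) (use K(1) inflate_in_C length_inflate in fastforce)
  show "inj_on inflate {p. p \<in> K \<and> total_length p \<le> N}" using K(2) by (rule inj_on_subset) auto
qed

lemma decomps_cases:
  assumes "K = simple_pairs \<or> (\<exists>\<theta>\<in>dirs. K = binary_pairs \<theta>)"
  shows "K \<subseteq> decomps" "inj_on inflate K" "finite {p. p \<in> K \<and> total_length p \<le> N}"
proof -
  show "K \<subseteq> decomps" "inj_on inflate K" using assms inj_on_inflate by auto
  then show "finite {p. p \<in> K \<and> total_length p \<le> N}" by (rule finite_decomps_upto)
qed

lemma psum_inflate: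
  assumes K: "K \<subseteq> decomps" and bij: "bij_betw inflate K X"
  shows "psum g X N = qsum (\<lambda>p. g (inflate p)) K N"
proof -
  have "bij_betw inflate {p. p \<in> K \<and> total_length p \<le> N} {\<nu>. \<nu> \<in> X \<and> length \<nu> \<le> N}"
    using bij K length_inflate by (fastforce simp: bij_betw_def inj_on_def)
  then show ?thesis unfolding psum_def qsum_def by (rule sum.reindex_bij_betw[symmetric])
qed

text \<open>Only sizes in \<open>(M, N]\<close> are estimated by \<open>h\<close>; the sizes up to
  \<open>M\<close> drop out on both sides. This is how the correction terms of
  \<open>supersolution\<close> arise.\<close>

lemma psum_diff_le_qsum_diff:
  assumes K: "K \<subseteq> decomps" and bij: "bij_betw inflate K X" and MN: "M \<le> N"
    and le: "\<And>p. p \<in> K \<Longrightarrow> g (inflate p) \<le> h p"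
  shows "psum g X N - psum g X M \<le> qsum h K N - qsum h K M"
proof -
  have fin: "finite {p. p \<in> K \<and> total_length p \<le> N}" for N
    using K bij by (intro finite_decomps_upto) (auto simp: bij_betw_def)
  have split: "qsum f K N = qsum f K M + (\<Sum>p | p \<in> K \<and> M < total_length p \<and> total_length p \<le> N. f p)" for f
  proof -
    have "{p. p \<in> K \<and> total_length p \<le> N} = {p. p \<in> K \<and> total_length p \<le> M} \<union>
        {p. p \<in> K \<and> M < total_length p \<and> total_length p \<le> N}" using MN by auto
    moreover have "finite {p. p \<in> K \<and> M < total_length p \<and> total_length p \<le> N}"
      by (rule finite_subset[OF _ fin[of N]]) auto
    ultimately show ?thesis unfolding qsum_def using fin[of M]
      by (simp add: sum.union_disjoint disjoint_iff not_less[symmetric])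
  qed
  have "(\<Sum>p | p \<in> K \<and> M < total_length p \<and> total_length p \<le> N. g (inflate p))
      \<le> (\<Sum>p | p \<in> K \<and> M < total_length p \<and> total_length p \<le> N. h p)"
    by (intro sum_mono le) auto
  then show ?thesis
    unfolding psum_inflate[OF K bij] split[of "\<lambda>p. g (inflate p)"] split[of h] by linarith
qed

lemma psum_mono:
  assumes "X \<subseteq> C" "M \<le> N" "\<And>\<nu>. \<nu> \<in> X \<Longrightarrow> 0 \<le> g \<nu>"
  shows "psum g X M \<le> psum g X N"
  unfolding psum_def using assms finite_upto_subset[OF assms(1)] by (intro sum_mono2) auto

lemma psum_nonneg: "X \<subseteq> C \<Longrightarrow> (\<And>\<nu>. \<nu> \<in> C \<Longrightarrow> 0 \<le> g \<nu>) \<Longrightarrow> 0 \<le> psum g X N"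
  unfolding psum_def by (intro sum_nonneg) auto

lemma psum_Un_disjoint:
  assumes "X \<subseteq> C" "Y \<subseteq> C" "X \<inter> Y = {}"
  shows "psum g (X \<union> Y) N = psum g X N + psum g Y N"
proof -
  have "{\<nu>. \<nu> \<in> X \<union> Y \<and> length \<nu> \<le> N} = {\<nu>. \<nu> \<in> X \<and> length \<nu> \<le> N} \<union> {\<nu>. \<nu> \<in> Y \<and> length \<nu> \<le> N}" by auto
  then show ?thesis unfolding psum_def using assms finite_upto_subset
    by (simp add: sum.union_disjoint disjoint_iff)
qed

lemma inflations_in_C: "inflations [1, 2] \<subseteq> C" "inflations [2, 1] \<subseteq> C" "remaining \<subseteq> C"
  using inflations_subset_C by (auto simp: remaining_def)

lemma psum_C: "psum g C N = psum g remaining N + psum g (inflations [1, 2]) N + psum g (inflations [2, 1]) N"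
proof -
  have "C = (remaining \<union> inflations [1, 2]) \<union> inflations [2, 1]"
    using inflations_in_C by (auto simp: remaining_def)
  then have "psum g C N = psum g ((remaining \<union> inflations [1, 2]) \<union> inflations [2, 1]) N" by simp
  also have "\<dots> = psum g (remaining \<union> inflations [1, 2]) N + psum g (inflations [2, 1]) N"
    using inflations_in_C inflations_disjoint by (intro psum_Un_disjoint) (auto simp: remaining_def)
  also have "psum g (remaining \<union> inflations [1, 2]) N = psum g remaining N + psum g (inflations [1, 2]) N"
    using inflations_in_C by (intro psum_Un_disjoint) (auto simp: remaining_def)
  finally show ?thesis .
qed

lemma length_inflation: "\<theta> \<in> dirs \<Longrightarrow> \<nu> \<in> inflations \<theta> \<Longrightarrow> length \<nu> \<ge> 2"
proof -
  assume \<theta>: "\<theta> \<in> dirs" and "\<nu> \<in> inflations \<theta>"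
  then have "\<nu> \<in> inflate ` binary_pairs \<theta>"
    using bij_betw_imp_surj_on[OF bij_binary_pairs[OF \<theta>]] by simp
  then obtain p where p: "p \<in> binary_pairs \<theta>" "\<nu> = inflate p" by blast
  then have "p \<in> decomps" using \<theta> by auto
  then show ?thesis using p(2) length_inflate[of p] length_fst_le[of p] decomps_props(4)[of p] by simp
qed

lemma one_in_remaining: "[1] \<in> remaining"
  using one_in_C length_inflation[of _ "[1]"] by (auto simp: remaining_def)

lemma psum_remaining:
  assumes "N \<ge> 1"
  shows "psum g remaining N = g [1] + psum g (remaining - {[1]}) N"
proof -
  have "{\<nu>. \<nu> \<in> remaining \<and> length \<nu> \<le> N} = insert [1] {\<nu>. \<nu> \<in> remaining - {[1]} \<and> length \<nu> \<le> N}"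
    using one_in_remaining assms by auto
  then show ?thesis unfolding psum_def using finite_upto_subset[of "remaining - {[1]}" N] inflations_in_C(3)
    by (simp add: subset_iff)
qed

lemma psum_indecomposable:
  assumes "\<theta> \<in> dirs"
  shows "psum g C N = psum g (C - inflations \<theta>) N + psum g (inflations \<theta>) N"
proof -
  have "C = (C - inflations \<theta>) \<union> inflations \<theta>" using inflations_subset_C[OF assms] by auto
  then have "psum g C N = psum g ((C - inflations \<theta>) \<union> inflations \<theta>) N" by simp
  also have "\<dots> = psum g (C - inflations \<theta>) N + psum g (inflations \<theta>) N"
    using inflations_subset_C[OF assms] by (intro psum_Un_disjoint) auto
  finally show ?thesis .
qed

section \<open>Truncated sums over decompositions as powers and products\<close>

lemma sum_prod_lists:
  assumes "finite F"
  shows "(\<Sum>xs | set xs \<subseteq> F \<and> length xs = d. prod_list (map g xs)) = (\<Sum>x\<in>F. g x :: real) ^ d"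
proof (induction d)
  case 0
  have "{xs. set xs \<subseteq> F \<and> length xs = 0} = {[]}" by auto
  then show ?case by simp
next
  case (Suc d)
  have "{xs. set xs \<subseteq> F \<and> length xs = Suc d} = (\<lambda>(x, xs). x # xs) ` (F \<times> {xs. set xs \<subseteq> F \<and> length xs = d})"
    by (auto simp: length_Suc_conv image_iff)
  then have "(\<Sum>xs | set xs \<subseteq> F \<and> length xs = Suc d. prod_list (map g xs))
      = (\<Sum>(x, xs)\<in>F \<times> {xs. set xs \<subseteq> F \<and> length xs = d}. g x * prod_list (map g xs))"
    by (simp add: sum.reindex inj_on_def split_def)
  also have "\<dots> = (\<Sum>x\<in>F. g x) * (\<Sum>xs | set xs \<subseteq> F \<and> length xs = d. prod_list (map g xs))"
    by (simp add: sum_product sum.cartesian_product)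
  finally show ?case using Suc by simp
qed

lemma prod_list_map_nonneg: "(\<And>x. x \<in> set xs \<Longrightarrow> 0 \<le> g x) \<Longrightarrow> 0 \<le> prod_list (map g xs :: real list)"
  by (induction xs) auto

lemma parts_weight_nonneg:
  "p \<in> decomps \<Longrightarrow> (\<And>\<nu>. \<nu> \<in> C \<Longrightarrow> 0 \<le> g \<nu>) \<Longrightarrow> 0 \<le> parts_weight g p"
  using decomps_props(3)[of p] unfolding parts_weight_def by (intro prod_list_map_nonneg) auto

lemma sum_simple_product:
  assumes "finite A" "finite F"
  shows "(\<Sum>p\<in>(SIGMA \<alpha>:A. {xs. set xs \<subseteq> F \<and> length xs = length \<alpha>}). f (length (fst p)) * prod_list (map g (snd p)))
    = (\<Sum>\<alpha>\<in>A. f (length \<alpha>) * (\<Sum>x\<in>F. g x :: real) ^ length \<alpha>)"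
proof -
  have "(\<Sum>p\<in>(SIGMA \<alpha>:A. {xs. set xs \<subseteq> F \<and> length xs = length \<alpha>}). f (length (fst p)) * prod_list (map g (snd p)))
    = (\<Sum>\<alpha>\<in>A. \<Sum>xs | set xs \<subseteq> F \<and> length xs = length \<alpha>. f (length \<alpha>) * prod_list (map g xs))"
    using assms by (subst sum.Sigma) (auto simp: finite_lists_length_eq split_def)
  also have "\<dots> = (\<Sum>\<alpha>\<in>A. f (length \<alpha>) * (\<Sum>x\<in>F. g x) ^ length \<alpha>)"
    using assms(2) by (simp add: sum_distrib_left[symmetric] sum_prod_lists)
  finally show ?thesis .
qed

text \<open>By \<open>length_part_less\<close> all parts have size at most N; dropping the condition
  on the total size leaves independent choices of the parts, hence powers.\<close>

lemma qsum_simple_le: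
  assumes g: "\<And>\<nu>. \<nu> \<in> C \<Longrightarrow> 0 \<le> g \<nu>"
  shows "qsum (parts_weight g) simple_pairs (Suc N)
    \<le> (\<Sum>\<alpha> | \<alpha> \<in> simples C \<and> length \<alpha> \<le> Suc N. psum g C N ^ length \<alpha>)"
proof -
  let ?A = "{\<alpha>. \<alpha> \<in> simples C \<and> length \<alpha> \<le> Suc N}" and ?F = "{\<nu>. \<nu> \<in> C \<and> length \<nu> \<le> N}"
  have fin: "finite ?A" "finite ?F" using finite_upto_subset[of "simples C"] finite_upto by (auto simp: simples_def)
  let ?S = "SIGMA \<alpha>:?A. {xs. set xs \<subseteq> ?F \<and> length xs = length \<alpha>}"
  have "{p. p \<in> simple_pairs \<and> total_length p \<le> Suc N} \<subseteq> ?S"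
  proof
    fix p assume p: "p \<in> {p. p \<in> simple_pairs \<and> total_length p \<le> Suc N}"
    then have d: "p \<in> decomps" by simp
    show "p \<in> ?S"
    proof (cases p)
      case (Pair \<alpha> \<nu>s)
      then show ?thesis using p length_part_less[OF d] length_fst_le[OF d] by (fastforce simp: simple_pairs_def)
    qed
  qed
  then have "qsum (parts_weight g) simple_pairs (Suc N) \<le> (\<Sum>p\<in>?S. parts_weight g p)"
    unfolding qsum_def
  proof (rule sum_mono2[rotated])
    show "finite ?S" using fin by (auto intro!: finite_SigmaI finite_lists_length_eq)
    show "0 \<le> parts_weight g p" if "p \<in> ?S - {p. p \<in> simple_pairs \<and> total_length p \<le> Suc N}" for p
      unfolding parts_weight_def using that g by (intro prod_list_map_nonneg) auto
  qed
  also have "\<dots> = (\<Sum>\<alpha>\<in>?A. psum g C N ^ length \<alpha>)"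
    using sum_simple_product[OF fin, of "\<lambda>_. 1" g] by (simp add: parts_weight_def psum_def)
  finally show ?thesis .
qed

text \<open>Converse of \<open>qsum_simple_le\<close> at a larger cutoff: at most m parts of size at
  most m have total size at most \<open>m * m\<close>. Later \<open>f\<close> is constant 1 or the
  number of parts.\<close>

lemma qsum_simple_ge:
  assumes g: "\<And>\<nu>. \<nu> \<in> C \<Longrightarrow> 0 \<le> g \<nu>" and f: "\<And>d. 0 \<le> f d"
  shows "(\<Sum>\<alpha> | \<alpha> \<in> simples C \<and> length \<alpha> \<le> m. f (length \<alpha>) * psum g C m ^ length \<alpha>)
    \<le> qsum (\<lambda>p. f (length (fst p)) * parts_weight g p) simple_pairs (m * m)"
proof -
  let ?A = "{\<alpha>. \<alpha> \<in> simples C \<and> length \<alpha> \<le> m}" and ?F = "{\<nu>. \<nu> \<in> C \<and> length \<nu> \<le> m}"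
  have fin: "finite ?A" "finite ?F" using finite_upto_subset[of "simples C"] finite_upto by (auto simp: simples_def)
  let ?S = "SIGMA \<alpha>:?A. {xs. set xs \<subseteq> ?F \<and> length xs = length \<alpha>}"
  have "?S \<subseteq> {p. p \<in> simple_pairs \<and> total_length p \<le> m * m}"
  proof
    fix p assume p: "p \<in> ?S"
    obtain \<alpha> \<nu>s where ap: "p = (\<alpha>, \<nu>s)" by (cases p)
    have "sum_list (map length \<nu>s) \<le> sum_list (map (\<lambda>_. m) \<nu>s)"
      using p ap by (intro sum_list_mono) auto
    also have "\<dots> = length \<nu>s * m" by (simp add: sum_list_triv)
    also have "\<dots> \<le> m * m" using p ap by (intro mult_le_mono1) auto
    finally show "p \<in> {p. p \<in> simple_pairs \<and> total_length p \<le> m * m}"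
      using p ap by (auto simp: simple_pairs_def total_length_def)
  qed
  then have "(\<Sum>p\<in>?S. f (length (fst p)) * parts_weight g p) \<le> qsum (\<lambda>p. f (length (fst p)) * parts_weight g p) simple_pairs (m * m)"
    unfolding qsum_def using decomps_cases(3)[of simple_pairs] f
    by (intro sum_mono2) (auto intro!: mult_nonneg_nonneg parts_weight_nonneg g)
  then show ?thesis using sum_simple_product[OF fin, of f g] by (simp add: parts_weight_def psum_def)
qed

lemma qsum_binary_eq:
  assumes \<theta>: "\<theta> \<in> dirs"
  shows "qsum (parts_weight g) (binary_pairs \<theta>) N
    = (\<Sum>(\<sigma>, \<tau>) | \<sigma> \<in> C - inflations \<theta> \<and> \<tau> \<in> C \<and> length \<sigma> + length \<tau> \<le> N. g \<sigma> * g \<tau>)"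
proof -
  let ?e = "\<lambda>(\<sigma>, \<tau>). (\<theta>, [\<sigma>, \<tau>])" let ?T = "{(\<sigma>, \<tau>). \<sigma> \<in> C - inflations \<theta> \<and> \<tau> \<in> C \<and> length \<sigma> + length \<tau> \<le> N}"
  have "{p. p \<in> binary_pairs \<theta> \<and> total_length p \<le> N} = ?e ` ?T"
    by (auto simp: binary_pairs_def total_length_def)
  moreover have "inj_on ?e ?T" by (auto simp: inj_on_def)
  ultimately show ?thesis by (simp add: qsum_def sum.reindex parts_weight_def split_def)
qed

lemma qsum_binary_le:
  assumes \<theta>: "\<theta> \<in> dirs" and g: "\<And>\<nu>. \<nu> \<in> C \<Longrightarrow> 0 \<le> g \<nu>"
  shows "qsum (parts_weight g) (binary_pairs \<theta>) (Suc N) \<le> psum g (C - inflations \<theta>) N * psum g C N"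
proof -
  have "(\<Sum>(\<sigma>, \<tau>) | \<sigma> \<in> C - inflations \<theta> \<and> \<tau> \<in> C \<and> length \<sigma> + length \<tau> \<le> Suc N. g \<sigma> * g \<tau>)
    \<le> (\<Sum>(\<sigma>, \<tau>) \<in> {\<nu>. \<nu> \<in> C - inflations \<theta> \<and> length \<nu> \<le> N} \<times> {\<nu>. \<nu> \<in> C \<and> length \<nu> \<le> N}. g \<sigma> * g \<tau>)"
  proof (rule sum_mono2)
    show "finite ({\<nu>. \<nu> \<in> C - inflations \<theta> \<and> length \<nu> \<le> N} \<times> {\<nu>. \<nu> \<in> C \<and> length \<nu> \<le> N})"
      using finite_upto_subset[of "C - inflations \<theta>"] finite_upto by auto
    show "{(\<sigma>, \<tau>). \<sigma> \<in> C - inflations \<theta> \<and> \<tau> \<in> C \<and> length \<sigma> + length \<tau> \<le> Suc N}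
      \<subseteq> {\<nu>. \<nu> \<in> C - inflations \<theta> \<and> length \<nu> \<le> N} \<times> {\<nu>. \<nu> \<in> C \<and> length \<nu> \<le> N}"
      using C_length by fastforce
  qed (auto intro!: mult_nonneg_nonneg g)
  then show ?thesis unfolding qsum_binary_eq[OF \<theta>] psum_def by (simp add: sum_product sum.cartesian_product)
qed

lemma qsum_binary_ge:
  assumes \<theta>: "\<theta> \<in> dirs" and g: "\<And>\<nu>. \<nu> \<in> C \<Longrightarrow> 0 \<le> g \<nu>"
  shows "psum g (C - inflations \<theta>) m * psum g C m \<le> qsum (parts_weight g) (binary_pairs \<theta>) (2 * m)"
proof -
  have "(\<Sum>(\<sigma>, \<tau>) \<in> {\<nu>. \<nu> \<in> C - inflations \<theta> \<and> length \<nu> \<le> m} \<times> {\<nu>. \<nu> \<in> C \<and> length \<nu> \<le> m}. g \<sigma> * g \<tau>)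
   \<le> (\<Sum>(\<sigma>, \<tau>) | \<sigma> \<in> C - inflations \<theta> \<and> \<tau> \<in> C \<and> length \<sigma> + length \<tau> \<le> 2 * m. g \<sigma> * g \<tau>)"
  proof (rule sum_mono2)
    show "finite {(\<sigma>, \<tau>). \<sigma> \<in> C - inflations \<theta> \<and> \<tau> \<in> C \<and> length \<sigma> + length \<tau> \<le> 2 * m}"
      by (rule finite_subset[of _ "{\<nu>. \<nu> \<in> C \<and> length \<nu> \<le> 2 * m} \<times> {\<nu>. \<nu> \<in> C \<and> length \<nu> \<le> 2 * m}"])
        (use finite_upto in auto)
  qed (auto intro!: mult_nonneg_nonneg g)
  then show ?thesis unfolding qsum_binary_eq[OF \<theta>] psum_def by (simp add: sum_product sum.cartesian_product)
qed

text \<open>The numbers \<open>u\<close>, \<open>v1\<close>, \<open>v2\<close> measure by how much \<open>g\<close> fails to be multiplicative on the objects of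
  size at most \<open>M\<close>. The system satisfied by the partial sums is solved with \<open>\<tau>\<close> as an upper bound for
  the total weight as soon as the corrected equation \<open>u = G(\<tau>)\<close> holds as an inequality.\<close>

lemma supersolution:
  assumes g: "\<And>\<nu>. \<nu> \<in> C \<Longrightarrow> 0 \<le> g \<nu>"
    and sub: "\<And>p. p \<in> decomps \<Longrightarrow> g (inflate p) \<le> parts_weight g p"
    and M: "M \<ge> 1"
    and u: "u = psum g remaining M - qsum (parts_weight g) simple_pairs M"
    and v1: "v1 = psum g (inflations [1, 2]) M - qsum (parts_weight g) (binary_pairs [1, 2]) M"
    and v2: "v2 = psum g (inflations [2, 1]) M - qsum (parts_weight g) (binary_pairs [2, 1]) M"
    and \<tau>: "\<tau> \<ge> 0" and \<sigma>: "\<And>n. (\<Sum>\<alpha> | \<alpha> \<in> simples C \<and> length \<alpha> \<le> n. \<tau> ^ length \<alpha>) \<le> \<sigma>"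
    and H: "u + (v1 + v2) / (1 + \<tau>) + \<sigma> + 2 * \<tau>\<^sup>2 / (1 + \<tau>) \<le> \<tau>"
    and base: "psum g C M \<le> \<tau>" "psum g (C - inflations [1, 2]) M \<le> (\<tau> - v1) / (1 + \<tau>)"
      "psum g (C - inflations [2, 1]) M \<le> (\<tau> - v2) / (1 + \<tau>)"
  shows "psum g C N \<le> \<tau>"
proof -
  let ?D1 = "inflations [1, 2]" and ?D2 = "inflations [2, 1]"
  have main: "psum g C N \<le> \<tau> \<and> psum g (C - ?D1) N \<le> (\<tau> - v1) / (1 + \<tau>) \<and> psum g (C - ?D2) N \<le> (\<tau> - v2) / (1 + \<tau>)"
    if "N \<ge> M" for N
    using that
  proof (induction N rule: dec_induct)
    case base
    then show ?case using assms by simp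
  next
    case (step N)
    define a1 where "a1 = (\<tau> - v1) / (1 + \<tau>)"
    define a2 where "a2 = (\<tau> - v2) / (1 + \<tau>)"
    have IH: "psum g C N \<le> \<tau>" "psum g (C - ?D1) N \<le> a1" "psum g (C - ?D2) N \<le> a2"
      using step.IH by (auto simp: a1_def a2_def)
    have nonneg: "0 \<le> psum g X N" if "X \<subseteq> C" for X by (rule psum_nonneg[OF that g])
    have r: "psum g remaining (Suc N) \<le> u + \<sigma>"
    proof -
      have "psum g (remaining - {[1]}) (Suc N) - psum g (remaining - {[1]}) M
        \<le> qsum (parts_weight g) simple_pairs (Suc N) - qsum (parts_weight g) simple_pairs M"
        using step.hyps sub by (intro psum_diff_le_qsum_diff bij_simple_pairs) auto
      moreover have "qsum (parts_weight g) simple_pairs (Suc N)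
        \<le> (\<Sum>\<alpha> | \<alpha> \<in> simples C \<and> length \<alpha> \<le> Suc N. psum g C N ^ length \<alpha>)"
        by (rule qsum_simple_le[OF g])
      moreover have "\<dots> \<le> (\<Sum>\<alpha> | \<alpha> \<in> simples C \<and> length \<alpha> \<le> Suc N. \<tau> ^ length \<alpha>)"
        using IH(1) nonneg[of C] by (intro sum_mono power_mono) auto
      moreover note \<sigma>[of "Suc N"] psum_remaining[of "Suc N" g] psum_remaining[OF M, of g]
      ultimately show ?thesis using u by linarith
    qed
    have d: "psum g (inflations \<theta>) (Suc N) \<le> v + a * \<tau>"
      if \<theta>: "\<theta> \<in> dirs" and v: "v = psum g (inflations \<theta>) M - qsum (parts_weight g) (binary_pairs \<theta>) M"
        and a: "psum g (C - inflations \<theta>) N \<le> a" for \<theta> v a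
    proof -
      have "psum g (inflations \<theta>) (Suc N) - psum g (inflations \<theta>) M
        \<le> qsum (parts_weight g) (binary_pairs \<theta>) (Suc N) - qsum (parts_weight g) (binary_pairs \<theta>) M"
        using \<theta> step.hyps sub by (intro psum_diff_le_qsum_diff bij_binary_pairs) auto
      moreover have "qsum (parts_weight g) (binary_pairs \<theta>) (Suc N) \<le> psum g (C - inflations \<theta>) N * psum g C N"
        by (rule qsum_binary_le[OF \<theta> g])
      moreover have "\<dots> \<le> a * \<tau>"
        using a IH(1) nonneg by (intro mult_mono) (auto intro: order_trans[OF _ a])
      ultimately show ?thesis using v by simp
    qed
    note d1 = d[OF _ v1 IH(2)] and d2 = d[OF _ v2 IH(3)]
    have n1: "1 + \<tau> > 0" using \<tau> by simp
    \<comment> \<open>The value \<open>(\<tau>^2 + v) / (1 + \<tau>)\<close> solves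
      \<open>D = v + A * \<tau>\<close> and \<open>A + D = \<tau>\<close> for the decomposables
      \<open>D\<close>; \<open>a1\<close> and \<open>a2\<close> are the corresponding values of
      \<open>A\<close>.\<close>
    have e1: "v1 + a1 * \<tau> = (\<tau>\<^sup>2 + v1) / (1 + \<tau>)" "v2 + a2 * \<tau> = (\<tau>\<^sup>2 + v2) / (1 + \<tau>)"
      using n1 by (simp_all add: a1_def a2_def field_simps power2_eq_square)
    have e2: "(\<tau>\<^sup>2 + v1) / (1 + \<tau>) + (\<tau>\<^sup>2 + v2) / (1 + \<tau>) = (v1 + v2) / (1 + \<tau>) + 2 * \<tau>\<^sup>2 / (1 + \<tau>)"
      by (simp add: add_divide_distrib)
    have e3: "\<tau> - (\<tau>\<^sup>2 + v1) / (1 + \<tau>) = a1" "\<tau> - (\<tau>\<^sup>2 + v2) / (1 + \<tau>) = a2"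
      using n1 by (simp_all add: a1_def a2_def field_simps power2_eq_square)
    have C: "psum g C (Suc N) = psum g remaining (Suc N) + psum g ?D1 (Suc N) + psum g ?D2 (Suc N)" by (rule psum_C)
    \<comment> \<open>Subtracting upper bounds would not bound this difference. It equals the
      remaining objects plus the inflations of the other direction, and \<open>H\<close> bounds that
      sum by \<open>a1\<close>.\<close>
    have A1: "psum g (C - ?D1) (Suc N) = psum g C (Suc N) - psum g ?D1 (Suc N)"
      and A2: "psum g (C - ?D2) (Suc N) = psum g C (Suc N) - psum g ?D2 (Suc N)"
      using psum_indecomposable[of "[1, 2]" g "Suc N"] psum_indecomposable[of "[2, 1]" g "Suc N"] by simp_all
    show ?case using r d1 d2 e1 e2 e3 H C A1 A2 unfolding a1_def[symmetric] a2_def[symmetric] by simp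
  qed
  have "psum g C N \<le> psum g C (max N M)" using g by (intro psum_mono) auto
  also have "\<dots> \<le> \<tau>" using main[of "max N M"] by simp
  finally show ?thesis .
qed

subsection \<open>The growth rate\<close>

definition cnt :: "nat \<Rightarrow> nat" where
  "cnt n = card {\<nu> \<in> C. length \<nu> = n}"

definition zw :: "real \<Rightarrow> nat list \<Rightarrow> real" where
  "zw z \<nu> = z ^ length \<nu>"

lemma finite_size: "finite {\<nu> \<in> C. length \<nu> = n}"
  by (rule finite_subset[OF _ finite_upto[of n]]) auto

text \<open>The direct sum of two members is in the class, and both summands can be read off once
  the size of the first is fixed.\<close>

lemma cnt_supermult:
  assumes "m \<ge> 1" "n \<ge> 1"
  shows "cnt m * cnt n \<le> cnt (m + n)"
proof -
  let ?f = "\<lambda>(\<sigma>, \<tau>). substitution [1, 2] [\<sigma>, \<tau>]"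
  let ?A = "{\<nu> \<in> C. length \<nu> = m}" and ?B = "{\<nu> \<in> C. length \<nu> = n}"
  have "inj_on ?f (?A \<times> ?B)"
  proof (rule inj_onI)
    fix p q assume p: "p \<in> ?A \<times> ?B" and q: "q \<in> ?A \<times> ?B" and eq: "?f p = ?f q"
    obtain \<sigma> \<tau> where st: "p = (\<sigma>, \<tau>)" "\<sigma> \<in> C" "\<tau> \<in> C" "length \<sigma> = m" using p by auto
    obtain \<sigma>' \<tau>' where st': "q = (\<sigma>', \<tau>')" "\<sigma>' \<in> C" "\<tau>' \<in> C" "length \<sigma>' = m" using q by auto
    obtain xs ys where xy: "standardize xs = \<sigma>" "standardize ys = \<tau>" "substitution [1, 2] [\<sigma>, \<tau>] = xs @ ys"
      using splits_blocks[of "[1, 2]" \<sigma> \<tau>] C_perms[OF st(2)] C_perms[OF st(3)] by blast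
    obtain xs' ys' where xy': "standardize xs' = \<sigma>'" "standardize ys' = \<tau>'" "substitution [1, 2] [\<sigma>', \<tau>'] = xs' @ ys'"
      using splits_blocks[of "[1, 2]" \<sigma>' \<tau>'] C_perms[OF st'(2)] C_perms[OF st'(3)] by blast
    have "length xs = length xs'" using st(4) st'(4) xy(1) xy'(1) length_standardize by metis
    moreover have "xs @ ys = xs' @ ys'" using eq st st' xy xy' by simp
    ultimately show "p = q" using st st' xy xy' by simp
  qed
  moreover have "?f ` (?A \<times> ?B) \<subseteq> {\<nu> \<in> C. length \<nu> = m + n}"
    using id2 by (auto simp: length_substitution intro!: substitution_in_C)
  ultimately have "card (?A \<times> ?B) \<le> card {\<nu> \<in> C. length \<nu> = m + n}"
    by (rule card_inj_on_le) (rule finite_size)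
  then show ?thesis by (simp add: cnt_def card_cartesian_product)
qed

lemma cnt_pos: "n \<ge> 1 \<Longrightarrow> cnt n \<ge> 1"
proof (induction n rule: dec_induct)
  case base
  have "{\<nu> \<in> C. length \<nu> = 1} \<noteq> {}" using one_in_C by auto
  then show ?case using finite_size[of 1] by (simp add: cnt_def Suc_le_eq card_gt_0_iff)
next
  case (step n)
  have "1 \<le> cnt 1 * cnt n"
  proof -
    have "{\<nu> \<in> C. length \<nu> = 1} \<noteq> {}" using one_in_C by auto
    then have "1 \<le> cnt 1" using finite_size[of 1] by (simp add: cnt_def Suc_le_eq card_gt_0_iff)
    then show ?thesis using step.IH by (metis mult_le_mono mult_1)
  qed
  also have "\<dots> \<le> cnt (1 + n)" using step by (intro cnt_supermult) auto
  finally show ?case by simp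
qed

lemma psum_zw: "psum (zw z) C N = (\<Sum>n\<le>N. real (cnt n) * z ^ n)"
proof -
  have "psum (zw z) C N = (\<Sum>n\<le>N. \<Sum>\<nu> | \<nu> \<in> {\<nu> \<in> C. length \<nu> \<le> N} \<and> length \<nu> = n. zw z \<nu>)"
    unfolding psum_def by (rule sum.group[symmetric]) (use finite_upto in auto)
  also have "\<dots> = (\<Sum>n\<le>N. real (cnt n) * z ^ n)"
  proof (rule sum.cong)
    fix n assume n: "n \<in> {..N}"
    have "(\<Sum>\<nu> | \<nu> \<in> {\<nu> \<in> C. length \<nu> \<le> N} \<and> length \<nu> = n. zw z \<nu>) = (\<Sum>\<nu>\<in>{\<nu> \<in> C. length \<nu> = n}. z ^ n)"
      using n by (intro sum.cong) (auto simp: zw_def)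
    then show "(\<Sum>\<nu> | \<nu> \<in> {\<nu> \<in> C. length \<nu> \<le> N} \<and> length \<nu> = n. zw z \<nu>) = real (cnt n) * z ^ n"
      by (simp add: cnt_def)
  qed simp
  finally show ?thesis .
qed

lemma cnt_power_mult: "m \<ge> 1 \<Longrightarrow> r \<ge> 1 \<Longrightarrow> cnt m ^ q \<le> cnt (q * m + r)"
proof (induction q)
  case (Suc q)
  have "cnt m ^ Suc q \<le> cnt m * cnt (q * m + r)" using Suc by simp
  also have "\<dots> \<le> cnt (m + (q * m + r))" using Suc.prems by (intro cnt_supermult) auto
  finally show ?case by (simp add: add.assoc)
qed (use cnt_pos in simp)

text \<open>Fekete's lemma; \<open>R\<close> is the radius of convergence of the generating function of the class.\<close>

lemma growth_rate:
  assumes K: "\<And>n. cnt n \<le> K ^ n"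
  obtains R :: real where "0 < R" "\<And>n. n \<ge> 1 \<Longrightarrow> real (cnt n) * R ^ n \<le> 1"
    "\<And>\<epsilon>. \<epsilon> > 0 \<Longrightarrow> \<exists>\<kappa>>0. \<forall>n\<ge>1. real (cnt n) * R ^ n \<ge> \<kappa> * exp (- \<epsilon> * real n)"
proof -
  define rt where "rt n = root n (real (cnt n))" for n
  define L where "L = (SUP n\<in>{1..}. rt n)"
  have le_K: "rt n \<le> real K" if "n \<in> {1..}" for n
  proof -
    have "real (cnt n) \<le> real K ^ n" using K[of n] by (metis of_nat_le_iff of_nat_power)
    then have "root n (real (cnt n)) \<le> root n (real K ^ n)" using that by simp
    then show ?thesis using that by (simp add: rt_def real_root_power_cancel)
  qed
  have bdd: "bdd_above (rt ` {1..})" using le_K by (intro bdd_aboveI2[where M = "real K"])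
  have le_L: "rt n \<le> L" if "n \<ge> 1" for n unfolding L_def using that by (intro cSUP_upper bdd) auto
  have "rt 1 \<ge> 1" using cnt_pos[of 1] by (simp add: rt_def)
  then have L1: "L \<ge> 1" using le_L[of 1] by simp
  have rt_power: "rt n ^ n = real (cnt n)" if "n \<ge> 1" for n
    using that by (simp add: rt_def)
  have rt_nonneg: "rt n \<ge> 0" for n by (simp add: rt_def real_root_pos_pos_le)
  have cnt_L: "real (cnt n) \<le> L ^ n" if "n \<ge> 1" for n
    using power_mono[OF le_L[OF that] rt_nonneg, of n] rt_power[OF that] by simp
  show ?thesis
  proof (rule that[of "1 / L"])
    show "0 < 1 / L" using L1 by simp
    show "real (cnt n) * (1 / L) ^ n \<le> 1" if "n \<ge> 1" for n
      using cnt_L[OF that] L1 by (simp add: power_divide divide_le_eq)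
    fix \<epsilon> :: real assume \<epsilon>: "\<epsilon> > 0"
    \<comment> \<open>Some \<open>rt m\<close> exceeds \<open>l\<close>, as \<open>l\<close> is
      below the supremum. Cutting n into pieces of size \<open>m\<close> then gives
      \<open>cnt n >= l ^ n\<close> up to the constant factor \<open>L ^ m\<close>.\<close>
    define l where "l = L * exp (- \<epsilon>)"
    have l: "0 < l" "l < L" using L1 \<epsilon> by (auto simp: l_def)
    then obtain m where m: "m \<ge> 1" "rt m > l" using less_cSUP_iff[OF _ bdd, of l] unfolding L_def by auto
    have "real (cnt n) * (1 / L) ^ n \<ge> (1 / L ^ m) * exp (- \<epsilon> * real n)" if n: "n \<ge> 1" for n
    proof -
      define q where "q = (n - 1) div m"
      \<comment> \<open>The remainder is taken in \<open>{1..m}\<close>: the class has no member of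
        size 0, so supermultiplicativity needs positive sizes.\<close>
      define r where "r = (n - 1) mod m + 1"
      have nq: "n = q * m + r" using n by (simp add: q_def r_def)
      have r: "r \<ge> 1" "r \<le> m" using m(1) by (auto simp: r_def Suc_le_eq)
      have "l ^ n = (l ^ m) ^ q * l ^ r" by (simp add: nq power_add power_mult[symmetric] mult.commute)
      also have "\<dots> \<le> (rt m ^ m) ^ q * L ^ m"
      proof (rule mult_mono)
        show "(l ^ m) ^ q \<le> (rt m ^ m) ^ q" using l m by (intro power_mono) auto
        have "l ^ r \<le> L ^ r" using l by (intro power_mono) auto
        also have "\<dots> \<le> L ^ m" using r L1 by (intro power_increasing)
        finally show "l ^ r \<le> L ^ m" .
      qed (use l rt_nonneg in auto)
      also have "(rt m ^ m) ^ q = real (cnt m ^ q)" using rt_power[OF m(1)] by simp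
      also have "real (cnt m ^ q) \<le> real (cnt n)" using cnt_power_mult[OF m(1) r(1), of q] nq by simp
      finally have "l ^ n \<le> real (cnt n) * L ^ m" using L1 by (simp add: mult_right_mono)
      then have "(L * exp (- \<epsilon>)) ^ n / (L ^ m * L ^ n) \<le> real (cnt n) * L ^ m / (L ^ m * L ^ n)"
        unfolding l_def using L1 by (intro divide_right_mono) auto
      moreover have "(L * exp (- \<epsilon>)) ^ n / (L ^ m * L ^ n) = (1 / L ^ m) * exp (- \<epsilon> * real n)"
        using L1 by (simp add: power_mult_distrib exp_of_nat_mult[symmetric] mult.commute)
      moreover have "real (cnt n) * L ^ m / (L ^ m * L ^ n) = real (cnt n) * (1 / L) ^ n"
        using L1 by (simp add: power_divide)
      ultimately show ?thesis by simp
    qed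
    then show "\<exists>\<kappa>>0. \<forall>n\<ge>1. real (cnt n) * (1 / L) ^ n \<ge> \<kappa> * exp (- \<epsilon> * real n)"
      using L1 by (intro exI[of _ "1 / L ^ m"]) auto
  qed
qed

section \<open>Exact weights and their totals at a point of convergence\<close>

lemma parts_weight_exp:
  "parts_weight (\<lambda>\<nu>. z ^ length \<nu> * exp (t * y \<nu>)) p = z ^ total_length p * exp (t * (\<Sum>\<nu>\<leftarrow>snd p. y \<nu>))"
proof -
  have "prod_list (map (\<lambda>\<nu>. z ^ length \<nu> * exp (t * y \<nu>)) xs) = z ^ sum_list (map length xs) * exp (t * (\<Sum>\<nu>\<leftarrow>xs. y \<nu>))" for xs
    by (induction xs) (simp_all add: power_add distrib_left exp_add mult_ac)
  then show ?thesis by (simp add: parts_weight_def total_length_def)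
qed

lemma parts_weight_zw: "parts_weight (zw z) p = z ^ total_length p"
  using parts_weight_exp[of z 0 "\<lambda>_. 0" p] by (simp add: zw_def[abs_def])

lemma zw_inflate: "p \<in> decomps \<Longrightarrow> zw z (inflate p) = parts_weight (zw z) p"
  by (simp add: parts_weight_zw zw_def length_inflate)

lemma zw_nonneg: "z \<ge> 0 \<Longrightarrow> 0 \<le> zw z \<nu>"
  by (simp add: zw_def)

lemma qsum_zw_inflate:
  assumes "K \<subseteq> decomps"
  shows "qsum (\<lambda>p. zw z (inflate p)) K N = qsum (parts_weight (zw z)) K N"
  unfolding qsum_def by (intro sum.cong zw_inflate) (use assms in auto)

lemma psum_zw_inflations:
  assumes "\<theta> \<in> dirs"
  shows "psum (zw z) (inflations \<theta>) N = qsum (parts_weight (zw z)) (binary_pairs \<theta>) N"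
proof -
  have "binary_pairs \<theta> \<subseteq> decomps" using assms by auto
  from psum_inflate[OF this bij_binary_pairs[OF assms]] qsum_zw_inflate[OF this] show ?thesis by simp
qed

lemma psum_zw_remaining:
  assumes "N \<ge> 1"
  shows "psum (zw z) remaining N = z + qsum (parts_weight (zw z)) simple_pairs N"
proof -
  have "simple_pairs \<subseteq> decomps" by auto
  from psum_inflate[OF this bij_simple_pairs] qsum_zw_inflate[OF this]
  show ?thesis by (simp add: psum_remaining[OF assms] zw_def[of z "[Suc 0]"])
qed

text \<open>A supremum of reals, meaningful when the partial sums are bounded; the context below
  assumes this.\<close>

definition tot :: "real \<Rightarrow> nat list set \<Rightarrow> real" where
  "tot z X = (SUP N. psum (zw z) X N)"

context
  fixes z B :: real
  assumes z: "z > 0" and bounded: "\<And>N. psum (zw z) C N \<le> B"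
begin

lemma psum_subset_le: "X \<subseteq> C \<Longrightarrow> psum (zw z) X N \<le> psum (zw z) C N"
  unfolding psum_def using z finite_upto by (intro sum_mono2) (auto simp: zw_nonneg)

lemma bdd_psum: "X \<subseteq> C \<Longrightarrow> bdd_above (range (psum (zw z) X))"
  using psum_subset_le bounded by (intro bdd_aboveI2[where M = B]) (meson order_trans)

lemma psum_le_tot: "X \<subseteq> C \<Longrightarrow> psum (zw z) X N \<le> tot z X"
  unfolding tot_def by (intro cSUP_upper bdd_psum) auto

lemma psum_tendsto_tot: "X \<subseteq> C \<Longrightarrow> psum (zw z) X \<longlonglongrightarrow> tot z X"
  unfolding tot_def using z
  by (intro LIMSEQ_incseq_SUP bdd_psum) (auto simp: incseq_def zw_nonneg intro!: psum_mono)

lemma tot_C: "tot z C = tot z remaining + tot z (inflations [1, 2]) + tot z (inflations [2, 1])"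
proof (rule LIMSEQ_unique[OF psum_tendsto_tot])
  have "(\<lambda>N. psum (zw z) remaining N + psum (zw z) (inflations [1, 2]) N + psum (zw z) (inflations [2, 1]) N)
    \<longlonglongrightarrow> tot z remaining + tot z (inflations [1, 2]) + tot z (inflations [2, 1])"
    using inflations_in_C by (intro tendsto_add psum_tendsto_tot)
  then show "psum (zw z) C \<longlonglongrightarrow> tot z remaining + tot z (inflations [1, 2]) + tot z (inflations [2, 1])"
    by (simp add: psum_C[abs_def])
qed simp

lemma tot_indecomposable:
  assumes \<theta>: "\<theta> \<in> dirs"
  shows "tot z C = tot z (C - inflations \<theta>) + tot z (inflations \<theta>)"
proof (rule LIMSEQ_unique[OF psum_tendsto_tot])
  have "(\<lambda>N. psum (zw z) (C - inflations \<theta>) N + psum (zw z) (inflations \<theta>) N)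
    \<longlonglongrightarrow> tot z (C - inflations \<theta>) + tot z (inflations \<theta>)"
    using inflations_subset_C[OF \<theta>] by (intro tendsto_add psum_tendsto_tot) auto
  then show "psum (zw z) C \<longlonglongrightarrow> tot z (C - inflations \<theta>) + tot z (inflations \<theta>)"
    by (simp add: psum_indecomposable[OF \<theta>, abs_def])
qed simp

lemma tot_ge_z: "tot z remaining \<ge> z" "tot z C \<ge> z"
proof -
  have "psum (zw z) remaining 1 \<ge> z" using psum_zw_remaining[of 1 z] z
    unfolding qsum_def parts_weight_zw by (simp add: sum_nonneg)
  then show "tot z remaining \<ge> z" using psum_le_tot[OF inflations_in_C(3), of 1] by simp
  moreover have "tot z remaining \<le> tot z C"
    using psum_subset_le[OF inflations_in_C(3)] inflations_in_C
    by (intro LIMSEQ_le[OF psum_tendsto_tot psum_tendsto_tot]) auto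
  ultimately show "tot z C \<ge> z" by simp
qed

text \<open>A product of two sums truncated at m is dominated by the sum over pairs truncated at
  2m.\<close>

lemma tot_inflations_ge:
  assumes \<theta>: "\<theta> \<in> dirs"
  shows "tot z (C - inflations \<theta>) * tot z C \<le> tot z (inflations \<theta>)"
proof (rule LIMSEQ_le_const2)
  show "(\<lambda>m. psum (zw z) (C - inflations \<theta>) m * psum (zw z) C m) \<longlonglongrightarrow> tot z (C - inflations \<theta>) * tot z C"
    by (intro tendsto_mult psum_tendsto_tot) auto
  have "psum (zw z) (C - inflations \<theta>) m * psum (zw z) C m \<le> tot z (inflations \<theta>)" for m
    using qsum_binary_ge[OF \<theta>, of "zw z" m] psum_le_tot[OF inflations_subset_C[OF \<theta>], of "2 * m"]
      psum_zw_inflations[OF \<theta>, of z "2 * m"] z by (simp add: zw_nonneg)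
  then show "\<exists>N. \<forall>m\<ge>N. psum (zw z) (C - inflations \<theta>) m * psum (zw z) C m \<le> tot z (inflations \<theta>)" by blast
qed

lemma tot_indecomposable_le: "\<theta> \<in> dirs \<Longrightarrow> tot z (C - inflations \<theta>) * (1 + tot z C) \<le> tot z C"
  using tot_inflations_ge[of \<theta>] tot_indecomposable[of \<theta>] by (simp add: distrib_left)

text \<open>From \<open>A * u <= D\<close> and \<open>A + D = u\<close> follows
  \<open>A <= u / (1 + u)\<close>, and \<open>D = u - A\<close> gives the bound.\<close>

lemma tot_inflations_ge_square:
  assumes "\<theta> \<in> dirs"
  shows "(tot z C)\<^sup>2 / (1 + tot z C) \<le> tot z (inflations \<theta>)"
proof -
  have pos: "1 + tot z C > 0" using tot_ge_z z by simp
  then have "tot z (C - inflations \<theta>) \<le> tot z C / (1 + tot z C)"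
    using tot_indecomposable_le[OF assms] by (simp add: le_divide_eq)
  moreover have "tot z C - tot z C / (1 + tot z C) = (tot z C)\<^sup>2 / (1 + tot z C)"
    using pos by (simp add: field_simps power2_eq_square)
  ultimately show ?thesis using tot_indecomposable[OF assms] by linarith
qed

lemma tot_equation: "tot z remaining + 2 * (tot z C)\<^sup>2 / (1 + tot z C) \<le> tot z C"
  using tot_inflations_ge_square[of "[1, 2]"] tot_inflations_ge_square[of "[2, 1]"] tot_C by simp

lemma tot_simple: "(\<Sum>\<alpha> | \<alpha> \<in> simples C \<and> length \<alpha> \<le> m. tot z C ^ length \<alpha>) \<le> tot z remaining - z"
proof (rule LIMSEQ_le_const2)
  show "(\<lambda>n. \<Sum>\<alpha> | \<alpha> \<in> simples C \<and> length \<alpha> \<le> m. psum (zw z) C n ^ length \<alpha>) \<longlonglongrightarrow>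
    (\<Sum>\<alpha> | \<alpha> \<in> simples C \<and> length \<alpha> \<le> m. tot z C ^ length \<alpha>)"
    by (intro tendsto_sum tendsto_power psum_tendsto_tot) auto
  have "(\<Sum>\<alpha> | \<alpha> \<in> simples C \<and> length \<alpha> \<le> m. psum (zw z) C n ^ length \<alpha>) \<le> tot z remaining - z" if n: "n \<ge> m" "n \<ge> 1" for n
  proof -
    have nn: "0 \<le> psum (zw z) C n" using z by (intro psum_nonneg) (auto simp: zw_nonneg)
    have "(\<Sum>\<alpha> | \<alpha> \<in> simples C \<and> length \<alpha> \<le> m. psum (zw z) C n ^ length \<alpha>)
      \<le> (\<Sum>\<alpha> | \<alpha> \<in> simples C \<and> length \<alpha> \<le> n. psum (zw z) C n ^ length \<alpha>)"
      using n nn finite_upto_subset[of "simples C"] by (intro sum_mono2) (auto simp: simples_def)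
    also have "\<dots> \<le> qsum (parts_weight (zw z)) simple_pairs (n * n)"
      using qsum_simple_ge[of "zw z" "\<lambda>_. 1" n] z by (simp add: zw_nonneg)
    also have "\<dots> = psum (zw z) remaining (n * n) - z" using psum_zw_remaining[of "n * n" z] n by simp
    also have "\<dots> \<le> tot z remaining - z" using psum_le_tot[OF inflations_in_C(3)] by simp
    finally show ?thesis .
  qed
  then show "\<exists>N. \<forall>n\<ge>N. (\<Sum>\<alpha> | \<alpha> \<in> simples C \<and> length \<alpha> \<le> m. psum (zw z) C n ^ length \<alpha>) \<le> tot z remaining - z"
    by (intro exI[of _ "max m 1"]) auto
qed

text \<open>As \<open>[1]\<close> contributes z > 0 to the remaining objects,
  \<open>tot_equation\<close> gives \<open>2 * u^2 / (1 + u) < u\<close>. The bound is uniform in z,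
  which is what carries finiteness over to \<open>R\<close> in \<open>psum_R\<close>.\<close>

lemma tot_C_less_1: "tot z C < 1"
proof -
  define c where "c = tot z C"
  have c: "c > 0" "2 * c\<^sup>2 / (1 + c) < c" using tot_equation tot_ge_z z by (auto simp: c_def)
  then have "2 * c\<^sup>2 < c * (1 + c)" by (simp add: divide_less_eq)
  then have "c * c < c * 1" by (simp add: power2_eq_square distrib_left)
  then show ?thesis using c(1) by (simp add: c_def)
qed

end

end

subsection \<open>Criticality\<close>

lemma summable_of_bounded_sums:
  fixes f :: "nat \<Rightarrow> real"
  assumes "\<And>n. 0 \<le> f n" "\<And>N. (\<Sum>n<N. f n) \<le> B"
  shows "summable f" "suminf f \<le> B"
proof -
  show s: "summable f" by (intro bounded_imp_summable[of f B]) (use assms in \<open>simp_all only: lessThan_Suc_atMost[symmetric]\<close>)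
  show "suminf f \<le> B" using assms(2) by (intro suminf_le_const s)
qed

locale growth_class = subst_class +
  fixes R :: real
  assumes R_pos: "0 < R" and cnt_le: "\<And>n. n \<ge> 1 \<Longrightarrow> real (cnt n) * R ^ n \<le> 1"
    and cnt_ge: "\<And>\<epsilon>. \<epsilon> > 0 \<Longrightarrow> \<exists>\<kappa>>0. \<forall>n\<ge>1. real (cnt n) * R ^ n \<ge> \<kappa> * exp (- \<epsilon> * real n)"
begin

lemma cnt_0: "cnt 0 = 0"
  using C_length by (force simp: cnt_def card_eq_0_iff)

text \<open>The bound blows up as z approaches \<open>R\<close>; its purpose is to make
  \<open>tot z C\<close> available for z < R.\<close>

lemma psum_bounded:
  assumes z: "0 < z" "z < R"
  shows "psum (zw z) C N \<le> 1 / (1 - z / R)"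
proof -
  have q: "0 < z / R" "z / R < 1" using z R_pos by auto
  have "psum (zw z) C N \<le> (\<Sum>n\<le>N. (z / R) ^ n)" unfolding psum_zw
  proof (rule sum_mono)
    fix n
    show "real (cnt n) * z ^ n \<le> (z / R) ^ n"
    proof (cases "n = 0")
      case False
      then have "real (cnt n) * R ^ n * (z / R) ^ n \<le> 1 * (z / R) ^ n" using cnt_le[of n] q by (intro mult_right_mono) auto
      then show ?thesis using R_pos by (simp add: power_divide)
    qed (simp add: cnt_0)
  qed
  also have "\<dots> \<le> (\<Sum>n. (z / R) ^ n)" using q by (intro sum_le_suminf summable_geometric) auto
  also have "\<dots> = 1 / (1 - z / R)" using q by (intro suminf_geometric) auto
  finally show ?thesis .
qed

lemma psum_R: "psum (zw R) C N \<le> 1"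
proof (rule LIMSEQ_le_const2)
  \<comment> \<open>These points tend to \<open>R\<close> from below; the double successor keeps the
    first one positive.\<close>
  let ?z = "\<lambda>j. R * (1 - 1 / real (Suc (Suc j)))"
  have "(\<lambda>j. 1 / real (Suc (Suc j))) \<longlonglongrightarrow> 0"
    using LIMSEQ_Suc[OF lim_1_over_n[where 'a = real]] by (intro LIMSEQ_Suc[where f = "\<lambda>j. 1 / real (Suc j)"]) simp
  then have "?z \<longlonglongrightarrow> R * (1 - 0)" by (intro tendsto_intros)
  then show "(\<lambda>j. psum (zw (?z j)) C N) \<longlonglongrightarrow> psum (zw R) C N"
    unfolding psum_zw by (intro tendsto_intros) simp
  have "psum (zw (?z j)) C N \<le> 1" for j
  proof -
    have "0 < 1 / real (Suc (Suc j))" "1 / real (Suc (Suc j)) < 1" by simp_all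
    then have z: "0 < ?z j" "?z j < R" using R_pos mult_strict_left_mono[of "1 - 1 / real (Suc (Suc j))" 1 R] by simp_all
    have "psum (zw (?z j)) C N \<le> tot (?z j) C" by (rule psum_le_tot[OF z(1) psum_bounded[OF z]]) simp
    also have "\<dots> < 1" by (rule tot_C_less_1[OF z(1) psum_bounded[OF z]])
    finally show ?thesis by simp
  qed
  then show "\<exists>n0. \<forall>j\<ge>n0. psum (zw (?z j)) C N \<le> 1" by blast
qed

lemma psum_unbounded:
  assumes z: "z > R"
  shows "\<exists>N. psum (zw z) C N > y"
proof (rule ccontr)
  assume "\<not> ?thesis"
  then have le: "psum (zw z) C N \<le> y" for N by (simp add: not_less)
  \<comment> \<open>Half of the exponential gain of z over \<open>R\<close> pays for the
    subexponential loss in \<open>cnt_ge\<close>; the other half makes the terms unbounded.\<close>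
  define \<epsilon> where "\<epsilon> = ln (z / R) / 2"
  have \<epsilon>: "\<epsilon> > 0" and e2: "exp (2 * \<epsilon>) = z / R" using z R_pos by (auto simp: \<epsilon>_def)
  obtain \<kappa> where \<kappa>: "\<kappa> > 0" "\<And>n. n \<ge> 1 \<Longrightarrow> real (cnt n) * R ^ n \<ge> \<kappa> * exp (- \<epsilon> * real n)"
    using cnt_ge[OF \<epsilon>] by auto
  have "\<kappa> * (1 + \<epsilon> * real n) \<le> y" if n: "n \<ge> 1" for n
  proof -
    have "1 + \<epsilon> * real n \<le> exp (\<epsilon> * real n)" by (rule exp_ge_add_one_self)
    then have "\<kappa> * (1 + \<epsilon> * real n) \<le> \<kappa> * exp (\<epsilon> * real n)" using \<kappa>(1) by simp
    also have "\<dots> = (\<kappa> * exp (- \<epsilon> * real n)) * exp (2 * \<epsilon>) ^ n"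
      by (simp add: exp_of_nat_mult[symmetric] exp_add[symmetric] algebra_simps)
    also have "\<dots> \<le> (real (cnt n) * R ^ n) * exp (2 * \<epsilon>) ^ n" using \<kappa>(2)[OF n] by (intro mult_right_mono) auto
    also have "\<dots> = real (cnt n) * z ^ n" unfolding e2 using R_pos by (simp add: power_divide)
    also have "\<dots> \<le> psum (zw z) C n" unfolding psum_zw
      using z R_pos by (intro member_le_sum[of n "{..n}" "\<lambda>n. real (cnt n) * z ^ n"]) auto
    also have "\<dots> \<le> y" by (rule le)
    finally show ?thesis .
  qed
  moreover obtain n :: nat where "n > max 1 (y / (\<kappa> * \<epsilon>))" using reals_Archimedean2 by blast
  ultimately have "n \<ge> 1" "y < real n * (\<kappa> * \<epsilon>)" "\<kappa> * (1 + \<epsilon> * real n) \<le> y"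
    using \<kappa>(1) \<epsilon> by (auto simp: pos_divide_less_eq)
  then show False using \<kappa>(1) by (simp add: algebra_simps)
qed

definition \<tau> :: real where
  "\<tau> = tot R C"

lemmas tot_R_facts = R_pos psum_R

lemma tau_pos: "\<tau> > 0"
  using tot_ge_z(2)[OF tot_R_facts] R_pos by (simp add: \<tau>_def)

lemma simple_sum: "(\<Sum>\<alpha> | \<alpha> \<in> simples C \<and> length \<alpha> \<le> m. \<tau> ^ length \<alpha>) \<le> tot R remaining - R"
  unfolding \<tau>_def by (rule tot_simple[OF tot_R_facts])

definition scnt :: "nat \<Rightarrow> real" where
  "scnt n = real (card {\<alpha> \<in> simples C. length \<alpha> = n})"

lemma sum_simples: "(\<Sum>\<alpha> | \<alpha> \<in> simples C \<and> length \<alpha> \<le> N. f (length \<alpha>)) = (\<Sum>n\<le>N. scnt n * f n)"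
proof -
  have fin: "finite {\<alpha>. \<alpha> \<in> simples C \<and> length \<alpha> \<le> N}" using finite_upto_subset[of "simples C"] by (auto simp: simples_def)
  have "(\<Sum>\<alpha> | \<alpha> \<in> simples C \<and> length \<alpha> \<le> N. f (length \<alpha>))
    = (\<Sum>n\<le>N. \<Sum>\<alpha> | \<alpha> \<in> {\<alpha>. \<alpha> \<in> simples C \<and> length \<alpha> \<le> N} \<and> length \<alpha> = n. f (length \<alpha>))"
    by (rule sum.group[symmetric]) (use fin in auto)
  also have "\<dots> = (\<Sum>n\<le>N. scnt n * f n)"
  proof (rule sum.cong)
    fix n assume n: "n \<in> {..N}"
    have "(\<Sum>\<alpha> | \<alpha> \<in> {\<alpha>. \<alpha> \<in> simples C \<and> length \<alpha> \<le> N} \<and> length \<alpha> = n. f (length \<alpha>)) = (\<Sum>\<alpha>\<in>{\<alpha> \<in> simples C. length \<alpha> = n}. f n)"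
      using n by (intro sum.cong) auto
    then show "(\<Sum>\<alpha> | \<alpha> \<in> {\<alpha>. \<alpha> \<in> simples C \<and> length \<alpha> \<le> N} \<and> length \<alpha> = n. f (length \<alpha>)) = scnt n * f n"
      by (simp add: scnt_def)
  qed simp
  finally show ?thesis .
qed

lemma scnt_nonneg: "scnt n \<ge> 0"
  by (simp add: scnt_def)

abbreviation S_fps :: "real fps" where
  "S_fps \<equiv> gen_fun (simples C)"

lemma nth_S_fps: "fps_nth S_fps n = scnt n"
  by (simp add: gen_fun_def scnt_def)

lemma psum_zw_1: "psum (zw z) remaining 1 = z" "psum (zw z) C 1 = z"
  "\<theta> \<in> dirs \<Longrightarrow> psum (zw z) (inflations \<theta>) 1 = 0"
proof -
  have no: "qsum h K 1 = 0" if "K \<subseteq> decomps" for h K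
  proof -
    have "{p. p \<in> K \<and> total_length p \<le> 1} = {}"
      using length_fst_le decomps_props(4) that by fastforce
    then show ?thesis by (simp only: qsum_def sum.empty)
  qed
  show D: "psum (zw z) (inflations \<theta>) 1 = 0" if "\<theta> \<in> dirs" for \<theta>
    using psum_zw_inflations[OF that] no[of "binary_pairs \<theta>"] that by auto
  show r: "psum (zw z) remaining 1 = z" using psum_zw_remaining[of 1 z] no[of simple_pairs] by auto
  show "psum (zw z) C 1 = z" using psum_C[of "zw z" 1] D[of "[1, 2]"] D[of "[2, 1]"] r by auto
qed

text \<open>The instance \<open>M = 1\<close> for exactly multiplicative weights, where
  \<open>u = z\<close> and both corrections vanish. It shows that the series still converges at z as
  soon as \<open>z <= G(y)\<close> for some y.\<close>

lemma supersolution_zw: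
  assumes z: "z > 0" and y: "y \<ge> 0" and \<sigma>: "\<And>n. (\<Sum>\<alpha> | \<alpha> \<in> simples C \<and> length \<alpha> \<le> n. y ^ length \<alpha>) \<le> \<sigma>"
    and H: "z + \<sigma> + 2 * y\<^sup>2 / (1 + y) \<le> y"
  shows "psum (zw z) C N \<le> y"
proof (rule supersolution[where M = 1 and g = "zw z" and u = z and ?v1.0 = 0 and ?v2.0 = 0 and \<sigma> = \<sigma>])
  have no: "psum (zw z) (inflations \<theta>) 1 - qsum (parts_weight (zw z)) (binary_pairs \<theta>) 1 = 0" if "\<theta> \<in> dirs" for \<theta>
    using psum_zw_inflations[OF that] by simp
  show "0 = psum (zw z) (inflations [1, 2]) 1 - qsum (parts_weight (zw z)) (binary_pairs [1, 2]) 1"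
    "0 = psum (zw z) (inflations [2, 1]) 1 - qsum (parts_weight (zw z)) (binary_pairs [2, 1]) 1"
    using no by simp_all
  show "z = psum (zw z) remaining 1 - qsum (parts_weight (zw z)) simple_pairs 1"
    using psum_zw_remaining[of 1 z] by simp
  have \<sigma>0: "\<sigma> \<ge> 0" using \<sigma>[of 0] y by (meson order_trans sum_nonneg zero_le_power)
  have q: "2 * y\<^sup>2 / (1 + y) = 2 * (y\<^sup>2 / (1 + y))" "y\<^sup>2 / (1 + y) \<ge> 0" "y - y\<^sup>2 / (1 + y) = y / (1 + y)"
    using y by (auto simp: field_simps power2_eq_square)
  show "psum (zw z) C 1 \<le> y" using psum_zw_1(2)[of z] H \<sigma>0 q by linarith
  have "z \<le> y - y\<^sup>2 / (1 + y)" using H[unfolded q(1)] \<sigma>0 q(2) by linarith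
  then have le: "z \<le> (y - 0) / (1 + y)" using q(3) by simp
  have "psum (zw z) (C - inflations \<theta>) 1 = z" if "\<theta> \<in> dirs" for \<theta>
    using psum_indecomposable[OF that, of "zw z" 1] psum_zw_1(2)[of z] psum_zw_1(3)[OF that, of z] by linarith
  then show "psum (zw z) (C - inflations [1, 2]) 1 \<le> (y - 0) / (1 + y)" "psum (zw z) (C - inflations [2, 1]) 1 \<le> (y - 0) / (1 + y)"
    using le by simp_all
qed (use z y \<sigma> H in \<open>auto simp: zw_inflate zw_nonneg\<close>)

text \<open>If the claim failed, \<open>G\<close> would be increasing at \<open>\<tau>\<close>, and \<open>psum\<close> would be bounded at some point
  beyond \<open>R\<close>. The hypothesis is needed only if \<open>\<tau>\<close> is the radius of convergence of \<open>S\<close>.\<close>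

lemma critical:
  assumes hyp: "deriv_at_radius S_fps \<ge> 2 / (1 + fps_conv_radius S_fps)\<^sup>2 - 1" and \<epsilon>: "\<epsilon> > 0"
  shows "\<exists>m. (\<Sum>\<alpha> | \<alpha> \<in> simples C \<and> length \<alpha> \<le> m. real (length \<alpha>) * \<tau> ^ length \<alpha>) \<ge> \<tau> * (2 / (1 + \<tau>)\<^sup>2 - 1) - \<epsilon>"
proof (rule ccontr)
  define B where "B = \<tau> * (2 / (1 + \<tau>)\<^sup>2 - 1) - \<epsilon>"
  define \<sigma> where "\<sigma> = tot R remaining - R"
  assume "\<not> ?thesis"
  then have lt: "(\<Sum>\<alpha> | \<alpha> \<in> simples C \<and> length \<alpha> \<le> m. real (length \<alpha>) * \<tau> ^ length \<alpha>) \<le> B" for m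
    by (auto simp: B_def not_le intro: less_imp_le)
  let ?d = "\<lambda>x n. real (Suc n) * scnt (Suc n) * x ^ n"
  have d_eq: "fps_nth (fps_deriv S_fps) n * x ^ n = ?d x n" for x n by (simp add: nth_S_fps)
  have d_nn: "0 \<le> ?d x n" if "x \<ge> 0" for x n using that scnt_nonneg by simp
  \<comment> \<open>Divided by \<open>\<tau>\<close>, the negated claim bounds the partial sums of
    \<open>S'(\<tau>)\<close>.\<close>
  have part: "(\<Sum>n<N. ?d \<tau> n) \<le> B / \<tau>" for N
  proof -
    have "\<tau> * (\<Sum>n<N. ?d \<tau> n) = (\<Sum>n<N. scnt (Suc n) * (real (Suc n) * \<tau> ^ Suc n))"
      by (simp add: sum_distrib_left mult_ac)
    also have "\<dots> = (\<Sum>n\<le>N. scnt n * (real n * \<tau> ^ n))" by (simp add: sum.atMost_shift)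
    also have "\<dots> \<le> B" using lt[of N] sum_simples[of "\<lambda>n. real n * \<tau> ^ n" N] by simp
    finally show ?thesis using tau_pos by (simp add: le_divide_eq mult.commute)
  qed
  note dsum = summable_of_bounded_sums[OF d_nn part, OF less_imp_le[OF tau_pos]]
  have d_mono: "summable (?d y)" "suminf (?d x) \<le> suminf (?d y)" "suminf (?d y) \<le> B / \<tau>"
    if xy: "0 \<le> x" "x \<le> y" "y \<le> \<tau>" for x y
  proof -
    have le: "?d x n \<le> ?d y n" if "0 \<le> x" "x \<le> y" for x y n
      using that scnt_nonneg by (intro mult_left_mono power_mono) auto
    have sm: "summable (?d y)" if "0 \<le> y" "y \<le> \<tau>" for y
      by (rule summable_comparison_test[OF _ dsum(1)]) (use le[OF that] d_nn that in auto)
    show "summable (?d y)" using sm xy by auto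
    show "suminf (?d x) \<le> suminf (?d y)" using le sm xy by (intro suminf_le) auto
    have "suminf (?d y) \<le> suminf (?d \<tau>)" using le sm xy by (intro suminf_le) auto
    then show "suminf (?d y) \<le> B / \<tau>" using dsum(2) by simp
  qed
  have d_le: "suminf (?d y) \<le> B / \<tau>" if "0 \<le> y" "y \<le> \<tau>" for y
    by (rule d_mono(3)[OF that(1) order_refl that(2)])
  have e_eq: "eval_fps (fps_deriv S_fps) x = suminf (?d x)" for x by (simp only: eval_fps_def d_eq)
  have spart: "(\<Sum>n<N. scnt n * \<tau> ^ n) \<le> \<sigma>" for N
  proof -
    have "(\<Sum>n<N. scnt n * \<tau> ^ n) \<le> (\<Sum>n\<le>N. scnt n * \<tau> ^ n)"
      using scnt_nonneg tau_pos by (intro sum_mono2) auto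
    also have "\<dots> \<le> \<sigma>" using simple_sum[of N] sum_simples[of "\<lambda>n. \<tau> ^ n" N] by (simp add: \<sigma>_def)
    finally show ?thesis .
  qed
  have snn: "0 \<le> scnt n * y ^ n" if "y \<ge> 0" for n y using that scnt_nonneg by simp
  note ssum = summable_of_bounded_sums[OF snn spart, OF less_imp_le[OF tau_pos]]
  have rad: "fps_conv_radius S_fps \<ge> ereal \<tau>"
    using conv_radius_geI[of "fps_nth S_fps" \<tau>] ssum(1) tau_pos by (simp add: fps_conv_radius_def nth_S_fps)
  have eq\<tau>: "R + \<sigma> + 2 * \<tau>\<^sup>2 / (1 + \<tau>) \<le> \<tau>"
    using tot_equation[OF tot_R_facts] by (simp add: \<sigma>_def \<tau>_def)
  show False
  proof (cases "ereal \<tau> < fps_conv_radius S_fps")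
    case True
    define G where "G y = y - eval_fps S_fps y - 2 * y\<^sup>2 / (1 + y)" for y
    \<comment> \<open>This is \<open>G'(\<tau>)\<close>; the negated claim makes it at least
      \<open>\<epsilon> / \<tau>\<close>.\<close>
    define D where "D = 1 - eval_fps (fps_deriv S_fps) \<tau> - (2 - 2 / (1 + \<tau>)\<^sup>2)"
    have ev: "(eval_fps S_fps has_real_derivative eval_fps (fps_deriv S_fps) \<tau>) (at \<tau>)"
      using True tau_pos by (intro has_field_derivative_eval_fps) auto
    have "((\<lambda>y. 2 * y\<^sup>2 / (1 + y)) has_real_derivative (2 * (2 * \<tau>) * (1 + \<tau>) - 2 * \<tau>\<^sup>2) / ((1 + \<tau>) * (1 + \<tau>))) (at \<tau>)"
      using tau_pos by (auto intro!: derivative_eq_intros)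
    moreover have "(2 * (2 * \<tau>) * (1 + \<tau>) - 2 * \<tau>\<^sup>2) / ((1 + \<tau>) * (1 + \<tau>)) = 2 - 2 / (1 + \<tau>)\<^sup>2"
      using tau_pos by (simp add: divide_simps) (simp add: power2_eq_square algebra_simps)
    ultimately have "((\<lambda>y. 2 * y\<^sup>2 / (1 + y)) has_real_derivative (2 - 2 / (1 + \<tau>)\<^sup>2)) (at \<tau>)" by simp
    then have DG: "(G has_real_derivative D) (at \<tau>)"
      unfolding G_def[abs_def] D_def by (intro DERIV_diff DERIV_ident ev)
    have "eval_fps (fps_deriv S_fps) \<tau> \<le> B / \<tau>" unfolding e_eq using tau_pos by (intro d_le) simp_all
    also have "B / \<tau> = (2 / (1 + \<tau>)\<^sup>2 - 1) - \<epsilon> / \<tau>" using tau_pos by (simp add: B_def diff_divide_distrib)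
    finally have "D > 0" using \<epsilon> tau_pos by (simp add: D_def) (smt (verit) divide_pos_pos)
    from DERIV_pos_inc_right[OF DG this] obtain d where d: "d > 0" "\<And>h. 0 < h \<Longrightarrow> h < d \<Longrightarrow> G \<tau> < G (\<tau> + h)" by auto
    obtain r where r: "ereal \<tau> < ereal r" "ereal r < fps_conv_radius S_fps" using ereal_dense2[OF True] by auto
    \<comment> \<open>A point beyond \<open>\<tau>\<close> where \<open>G\<close> has increased and
      which is still inside the disc of convergence of \<open>S\<close>.\<close>
    define y where "y = \<tau> + min (d / 2) (r - \<tau>)"
    have y: "y > \<tau>" "y \<le> r" "G \<tau> < G y" using d r by (auto simp: y_def min_def)
    then have yr: "ereal y < fps_conv_radius S_fps" using r(2) by (meson ereal_less_eq(3) le_less_trans)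
    have y0: "y > 0" using y tau_pos by simp
    have "eval_fps S_fps \<tau> \<le> \<sigma>" using ssum(2) by (simp add: eval_fps_def nth_S_fps)
    then have "G \<tau> \<ge> R" using eq\<tau> by (simp add: G_def)
    then have Gy: "G y > R" using y by simp
    have "(\<Sum>\<alpha> | \<alpha> \<in> simples C \<and> length \<alpha> \<le> n. y ^ length \<alpha>) \<le> eval_fps S_fps y" for n
    proof -
      have "summable (\<lambda>n. scnt n * y ^ n)" using summable_fps[of y S_fps] yr y0 by (simp add: nth_S_fps)
      then have "(\<Sum>n\<le>n. scnt n * y ^ n) \<le> suminf (\<lambda>n. scnt n * y ^ n)"
        using snn y0 by (intro sum_le_suminf) auto
      then show ?thesis by (simp add: sum_simples[of "\<lambda>n. y ^ n"] eval_fps_def nth_S_fps)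
    qed
    then have "psum (zw (G y)) C N \<le> y" for N
      using Gy R_pos y0 by (intro supersolution_zw[where \<sigma> = "eval_fps S_fps y"]) (auto simp: G_def)
    then show False using psum_unbounded[OF Gy, of y] by (meson not_less)
  next
    case False
    then have \<rho>: "fps_conv_radius S_fps = ereal \<tau>" using rad by simp
    \<comment> \<open>\<open>S'\<close> has nonnegative coefficients, so its left limit at the
      radius is this supremum. The negated claim bounds it by \<open>B / \<tau>\<close>, less than
      the hypothesis demands.\<close>
    define l where "l = (SUP x\<in>{0<..<\<tau>}. suminf (?d x))"
    have bdd: "bdd_above ((\<lambda>x. suminf (?d x)) ` {0<..<\<tau>})"
      by (intro bdd_aboveI2[where M = "B / \<tau>"] d_le) simp_all
    have ne: "{0<..<\<tau>} \<noteq> {}" using tau_pos by simp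
    have lB: "l \<le> B / \<tau>" unfolding l_def by (intro cSUP_least ne d_le) simp_all
    have "((\<lambda>z. ereal (eval_fps (fps_deriv S_fps) (real_of_ereal z))) \<longlongrightarrow> ereal l) (at_left (ereal \<tau>))"
    proof (rule increasing_tendsto)
      have ev: "\<forall>\<^sub>F z in at_left (ereal \<tau>). ereal x < z \<and> z < ereal \<tau>" if "x < \<tau>" for x
      proof -
        have "ereal x < ereal \<tau>" using that by simp
        from eventually_at_left[OF this, of "\<lambda>z. ereal x < z \<and> z < ereal \<tau>"] this show ?thesis by blast
      qed
      have real: "\<exists>x. z = ereal x \<and> 0 < x \<and> x < \<tau>" if "ereal 0 < z \<and> z < ereal \<tau>" for z using that by (cases z) auto
      show "\<forall>\<^sub>F z in at_left (ereal \<tau>). ereal (eval_fps (fps_deriv S_fps) (real_of_ereal z)) \<le> ereal l"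
        using ev[OF tau_pos]
      proof eventually_elim
        case (elim z)
        then obtain x where x: "z = ereal x" "0 < x" "x < \<tau>" using real by auto
        have "suminf (?d x) \<le> l" unfolding l_def by (rule cSUP_upper[OF _ bdd]) (use x in simp)
        then show ?case by (simp only: x(1) e_eq real_of_ereal.simps ereal_less_eq(3))
      qed
      fix a assume a: "a < ereal l"
      show "\<forall>\<^sub>F z in at_left (ereal \<tau>). a < ereal (eval_fps (fps_deriv S_fps) (real_of_ereal z))"
      proof -
        obtain a' where a': "a \<le> ereal a'" "a' < l" using a ereal_dense2[OF a] by (auto intro: less_imp_le)
        then obtain x0 where x0: "x0 \<in> {0<..<\<tau>}" "a' < suminf (?d x0)"
          unfolding l_def using less_cSUP_iff[OF ne bdd] by auto
        have "x0 < \<tau>" using x0 by simp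
        from ev[OF this] show ?thesis
        proof eventually_elim
          case (elim z)
          then obtain x where x: "z = ereal x" "x0 < x" "x < \<tau>" using x0 by (cases z) auto
          then have "suminf (?d x0) \<le> suminf (?d x)" using d_mono(2)[of x0 x] x0 by auto
          then have "ereal a' < ereal (suminf (?d x))" using x0 by simp
          then show ?case using a'(1) x e_eq by (simp add: le_less_trans)
        qed
      qed
    qed
    \<comment> \<open>\<open>Lim\<close> is determined by convergence only along a nontrivial
      filter.\<close>
    moreover have "at_left (ereal \<tau>) \<noteq> bot"
    proof -
      have "ereal 0 < ereal \<tau>" using tau_pos by simp
      from eventually_at_left[OF this, of "\<lambda>_. False"] show ?thesis
        unfolding trivial_limit_def using dense[of _ "ereal \<tau>"] by blast
    qed
    ultimately have "deriv_at_radius S_fps = ereal l"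
      unfolding deriv_at_radius_def \<rho> by (intro tendsto_Lim)
    moreover have "2 / (1 + fps_conv_radius S_fps)\<^sup>2 - 1 = ereal (2 / (1 + \<tau>)\<^sup>2 - 1)"
      unfolding \<rho> using tau_pos by (simp, simp only: one_ereal_def ereal_minus add.commute[of \<tau> 1])
    ultimately have "2 / (1 + \<tau>)\<^sup>2 - 1 \<le> l" using hyp by simp
    also have "l \<le> B / \<tau>" by (rule lB)
    also have "\<dots> = (2 / (1 + \<tau>)\<^sup>2 - 1) - \<epsilon> / \<tau>" using tau_pos by (simp add: B_def diff_divide_distrib)
    also have "\<dots> < 2 / (1 + \<tau>)\<^sup>2 - 1" using \<epsilon> tau_pos by simp
    finally show False by simp
  qed
qed

subsection \<open>Exponential tail bounds\<close>

text \<open>The derivative at t = 0 of \<open>u + (v1 + v2) / (1 + \<tau>)\<close> from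
  \<open>supersolution\<close>, for the weight
  \<open>R ^ length \<nu> * exp (t * v \<nu>)\<close>.\<close>

definition drift :: "nat \<Rightarrow> (nat list \<Rightarrow> real) \<Rightarrow> real" where
  "drift M v = psum (\<lambda>\<nu>. R ^ length \<nu> * v \<nu>) remaining M
     - qsum (\<lambda>p. R ^ total_length p * (\<Sum>\<nu>\<leftarrow>snd p. v \<nu>)) simple_pairs M
     + ((psum (\<lambda>\<nu>. R ^ length \<nu> * v \<nu>) (inflations [1, 2]) M
         - qsum (\<lambda>p. R ^ total_length p * (\<Sum>\<nu>\<leftarrow>snd p. v \<nu>)) (binary_pairs [1, 2]) M)
       + (psum (\<lambda>\<nu>. R ^ length \<nu> * v \<nu>) (inflations [2, 1]) M
         - qsum (\<lambda>p. R ^ total_length p * (\<Sum>\<nu>\<leftarrow>snd p. v \<nu>)) (binary_pairs [2, 1]) M)) / (1 + \<tau>)"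

lemma drift_linear: "drift M (\<lambda>\<nu>. a * v \<nu> + b * w \<nu>) = a * drift M v + b * drift M w"
proof -
  have 1: "psum (\<lambda>\<nu>. R ^ length \<nu> * (a * v \<nu> + b * w \<nu>)) X M
    = a * psum (\<lambda>\<nu>. R ^ length \<nu> * v \<nu>) X M + b * psum (\<lambda>\<nu>. R ^ length \<nu> * w \<nu>) X M" for X
    by (simp add: psum_def sum_distrib_left sum.distrib[symmetric] algebra_simps)
  have 2: "qsum (\<lambda>p. R ^ total_length p * (\<Sum>\<nu>\<leftarrow>snd p. a * v \<nu> + b * w \<nu>)) K M
    = a * qsum (\<lambda>p. R ^ total_length p * (\<Sum>\<nu>\<leftarrow>snd p. v \<nu>)) K M
      + b * qsum (\<lambda>p. R ^ total_length p * (\<Sum>\<nu>\<leftarrow>snd p. w \<nu>)) K M" for K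
    by (simp add: qsum_def sum_distrib_left sum.distrib[symmetric] sum_list_addf sum_list_const_mult algebra_simps)
  have "(a * x1 + b * x2 - (a * y1 + b * y2)) + ((a * z1 + b * z2 - (a * w1 + b * w2)) + (a * s1 + b * s2 - (a * t1 + b * t2))) / c
    = a * ((x1 - y1) + ((z1 - w1) + (s1 - t1)) / c) + b * ((x2 - y2) + ((z2 - w2) + (s2 - t2)) / c)"
    for x1 x2 y1 y2 z1 z2 w1 w2 s1 s2 t1 t2 c :: real
    by (simp add: algebra_simps add_divide_distrib diff_divide_distrib)
  then show ?thesis unfolding drift_def 1 2 by simp
qed

lemma sum_list_length_parts: "(\<Sum>\<nu>\<leftarrow>snd p. real (length \<nu>)) = real (total_length p)"
proof -
  have "(\<Sum>\<nu>\<leftarrow>xs. real (length \<nu>)) = real (sum_list (map length xs))" for xs :: "nat list list"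
    by (induction xs) simp_all
  then show ?thesis by (simp add: total_length_def)
qed

text \<open>The size is additive under inflation, so all differences cancel except the contribution
  \<open>R\<close> of \<open>[1]\<close>. Hence \<open>drift M v / R\<close> is a speed per unit of
  size.\<close>

lemma drift_length:
  assumes M: "M \<ge> 1"
  shows "drift M (\<lambda>\<nu>. real (length \<nu>)) = R"
proof -
  let ?g = "\<lambda>\<nu> :: nat list. R ^ length \<nu> * real (length \<nu>)"
  have q: "qsum (\<lambda>p. ?g (inflate p)) K M = qsum (\<lambda>p. R ^ total_length p * (\<Sum>\<nu>\<leftarrow>snd p. real (length \<nu>))) K M"
    if "K \<subseteq> decomps" for K
    unfolding qsum_def sum_list_length_parts
  proof (rule sum.cong)
    fix p assume "p \<in> {p. p \<in> K \<and> total_length p \<le> M}"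
    then have "p \<in> decomps" using that by blast
    then show "?g (inflate p) = R ^ total_length p * real (total_length p)" by (simp only: length_inflate)
  qed simp
  have sub: "simple_pairs \<subseteq> decomps" "binary_pairs [1, 2] \<subseteq> decomps" "binary_pairs [2, 1] \<subseteq> decomps" by auto
  have dirs: "[1, 2] \<in> dirs" "[2, 1] \<in> dirs" by auto
  have "psum ?g remaining M = R + qsum (\<lambda>p. R ^ total_length p * (\<Sum>\<nu>\<leftarrow>snd p. real (length \<nu>))) simple_pairs M"
    using psum_remaining[OF M, of ?g] psum_inflate[OF sub(1) bij_simple_pairs, of ?g M] q[OF sub(1)] by simp
  moreover note psum_inflate[OF sub(2) bij_binary_pairs[OF dirs(1)], of ?g M] q[OF sub(2)]
    psum_inflate[OF sub(3) bij_binary_pairs[OF dirs(2)], of ?g M] q[OF sub(3)]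
  ultimately show ?thesis unfolding drift_def by simp
qed

text \<open>Strictness lets the base conditions of \<open>supersolution\<close> at size
  \<open>M\<close> persist for small t > 0.\<close>

lemma psum_less_tot:
  assumes "X \<subseteq> C" "\<nu> \<in> X" "length \<nu> = Suc M"
  shows "psum (zw R) X M < tot R X"
proof -
  have "psum (zw R) X M + R ^ Suc M = (\<Sum>\<nu>\<in>insert \<nu> {\<nu>. \<nu> \<in> X \<and> length \<nu> \<le> M}. zw R \<nu>)"
    unfolding psum_def using finite_upto_subset[OF assms(1), of M] assms(3) by (subst sum.insert) (auto simp: zw_def)
  also have "\<dots> \<le> psum (zw R) X (Suc M)" unfolding psum_def
    using finite_upto_subset[OF assms(1)] assms R_pos by (intro sum_mono2) (auto simp: zw_nonneg)
  also have "\<dots> \<le> tot R X" by (rule psum_le_tot[OF tot_R_facts assms(1)])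
  finally show ?thesis using R_pos by (smt (verit) zero_less_power)
qed

lemma ex_of_length: "n \<ge> 1 \<Longrightarrow> \<exists>\<nu>\<in>C. length \<nu> = n"
  using cnt_pos[of n] by (auto simp: cnt_def card_gt_0_iff Suc_le_eq)

lemma psum_C_less: "psum (zw R) C M < \<tau>"
  unfolding \<tau>_def using ex_of_length[of "Suc M"] psum_less_tot[of C _ M] by auto

text \<open>The object of size M + 1 missing from the truncated sum must not be an inflation of
  \<open>\<theta>\<close>; it is built as an inflation of the other direction, from
  \<open>[1]\<close> and a member of size \<open>M\<close>.\<close>

lemma psum_indecomposable_less:
  assumes \<theta>: "\<theta> \<in> dirs" and M: "M \<ge> 1"
  shows "psum (zw R) (C - inflations \<theta>) M * (1 + \<tau>) < \<tau>"
proof -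
  obtain \<nu> where \<nu>: "\<nu> \<in> C" "length \<nu> = M" using ex_of_length[OF M] by auto
  obtain \<theta>' where \<theta>': "\<theta>' \<in> dirs" "inflations \<theta>' \<inter> inflations \<theta> = {}"
    using \<theta> inflations_disjoint by (auto simp: Int_commute)
  let ?x = "substitution \<theta>' [[1], \<nu>]"
  have "?x \<in> inflations \<theta>'" using \<nu> one_in_C unfolding inflations_def by blast
  then have "?x \<in> C - inflations \<theta>" using \<theta>' inflations_subset_C[OF \<theta>'(1)] by auto
  moreover have "length ?x = Suc M" using \<nu> dirs_perms(2)[OF \<theta>'(1)] by (simp add: length_substitution)
  ultimately have "psum (zw R) (C - inflations \<theta>) M < tot R (C - inflations \<theta>)"
    by (intro psum_less_tot) auto
  then have "psum (zw R) (C - inflations \<theta>) M * (1 + \<tau>) < tot R (C - inflations \<theta>) * (1 + \<tau>)"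
    using tau_pos by (intro mult_strict_right_mono) auto
  also have "\<dots> \<le> \<tau>" unfolding \<tau>_def by (rule tot_indecomposable_le[OF tot_R_facts \<theta>])
  finally show ?thesis .
qed

text \<open>At \<open>t = 0\<close> the weight \<open>R ^ |\<nu>| * exp (t * (v \<nu> - x * |\<nu>|))\<close> satisfies the hypotheses of
  the supersolution lemma with equality in the main inequality, whose left-hand side has derivative
  \<open>drift M v - x * R\<close> in \<open>t\<close>.\<close>

lemma exponential_moment:
  assumes sub: "\<And>p. p \<in> decomps \<Longrightarrow> v (inflate p) \<le> (\<Sum>\<nu>\<leftarrow>snd p. v \<nu>)"
    and M: "M \<ge> 1" and drift: "drift M v < x * R"
  shows "\<exists>t>0. \<forall>N. psum (\<lambda>\<nu>. R ^ length \<nu> * exp (t * (v \<nu> - x * real (length \<nu>)))) C N \<le> \<tau>"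
proof -
  define y where "y \<nu> = v \<nu> - x * real (length \<nu>)" for \<nu>
  define g where "g t \<nu> = R ^ length \<nu> * exp (t * y \<nu>)" for t \<nu>
  have g0: "g 0 = zw R" by (auto simp: g_def zw_def)
  have pw: "parts_weight (g t) p = R ^ total_length p * exp (t * (\<Sum>\<nu>\<leftarrow>snd p. y \<nu>))" for t p
    unfolding g_def by (rule parts_weight_exp)
  define u where "u t = psum (g t) remaining M - qsum (parts_weight (g t)) simple_pairs M" for t
  define w where "w \<theta> t = psum (g t) (inflations \<theta>) M - qsum (parts_weight (g t)) (binary_pairs \<theta>) M" for \<theta> t
  define \<phi> where "\<phi> t = u t + (w [1, 2] t + w [2, 1] t) / (1 + \<tau>)" for t
  have dp: "((\<lambda>t. psum (g t) X M) has_real_derivative psum (\<lambda>\<nu>. R ^ length \<nu> * y \<nu>) X M) (at 0)" for X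
    unfolding psum_def g_def by (auto intro!: derivative_eq_intros simp: mult.commute)
  have dq: "((\<lambda>t. qsum (parts_weight (g t)) K M) has_real_derivative
      qsum (\<lambda>p. R ^ total_length p * (\<Sum>\<nu>\<leftarrow>snd p. y \<nu>)) K M) (at 0)" for K
    unfolding qsum_def pw by (auto intro!: derivative_eq_intros simp: mult.commute)
  have "y = (\<lambda>\<nu>. 1 * v \<nu> + (- x) * real (length \<nu>))" by (auto simp: y_def)
  then have dy: "drift M y = drift M v - x * R"
    using drift_linear[of M 1 v "- x" "\<lambda>\<nu>. real (length \<nu>)"] drift_length[OF M] by simp
  have "(\<phi> has_real_derivative drift M y) (at 0)"
    unfolding \<phi>_def u_def w_def drift_def by (intro DERIV_add DERIV_diff DERIV_cdivide dp dq)
  moreover have "drift M y < 0" using dy drift by simp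
  ultimately obtain d where d: "d > 0" "\<And>h. 0 < h \<Longrightarrow> h < d \<Longrightarrow> \<phi> (0 + h) < \<phi> 0"
    using DERIV_neg_dec_right by blast
  have w0: "w \<theta> 0 = 0" if "\<theta> \<in> dirs" for \<theta> using psum_zw_inflations[OF that] by (simp add: w_def g0)
  have \<phi>0: "\<phi> 0 = R" using psum_zw_remaining[OF M, of R] w0 by (simp add: \<phi>_def u_def g0)
  have ev1: "\<forall>\<^sub>F t in at_right 0. \<phi> t < R" unfolding eventually_at_right_field
    using d \<phi>0 by (intro exI[of _ d]) auto
  have cont: "((\<lambda>t. psum (g t) X M) \<longlongrightarrow> psum (g 0) X M) (at 0)" for X
    using DERIV_isCont[OF dp] by (simp add: isCont_def)
  have "\<forall>\<^sub>F t in at 0. psum (g t) C M < \<tau>"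
    by (rule order_tendstoD(2)[OF cont]) (simp add: g0 psum_C_less)
  then have ev2: "\<forall>\<^sub>F t in at_right 0. psum (g t) C M < \<tau>" by (simp add: eventually_at_split)
  have ev3: "\<forall>\<^sub>F t in at_right 0. psum (g t) (C - inflations \<theta>) M * (1 + \<tau>) + w \<theta> t < \<tau>" if \<theta>: "\<theta> \<in> dirs" for \<theta>
  proof -
    have "((\<lambda>t. w \<theta> t) \<longlongrightarrow> w \<theta> 0) (at 0)"
      unfolding w_def using DERIV_isCont[OF DERIV_diff[OF dp dq]] by (simp add: isCont_def)
    then have "((\<lambda>t. psum (g t) (C - inflations \<theta>) M * (1 + \<tau>) + w \<theta> t) \<longlongrightarrow>
        psum (g 0) (C - inflations \<theta>) M * (1 + \<tau>) + w \<theta> 0) (at 0)"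
      by (intro tendsto_add tendsto_mult cont tendsto_const)
    then have "\<forall>\<^sub>F t in at 0. psum (g t) (C - inflations \<theta>) M * (1 + \<tau>) + w \<theta> t < \<tau>"
      by (rule order_tendstoD(2)) (simp add: g0 w0[OF \<theta>] psum_indecomposable_less[OF \<theta> M])
    then show ?thesis by (simp add: eventually_at_split)
  qed
  have "\<forall>\<^sub>F t in at_right 0. (0 :: real) < t" by (rule eventually_at_right_less)
  with ev1 ev2 ev3[of "[1, 2]"] ev3[of "[2, 1]"]
  have "\<forall>\<^sub>F t in at_right 0. 0 < t \<and> \<phi> t < R \<and> psum (g t) C M < \<tau>
    \<and> psum (g t) (C - inflations [1, 2]) M * (1 + \<tau>) + w [1, 2] t < \<tau>
    \<and> psum (g t) (C - inflations [2, 1]) M * (1 + \<tau>) + w [2, 1] t < \<tau>"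
    by (simp add: eventually_conj_iff)
  then obtain t where t: "0 < t" "\<phi> t < R" "psum (g t) C M < \<tau>"
    "psum (g t) (C - inflations [1, 2]) M * (1 + \<tau>) + w [1, 2] t < \<tau>"
    "psum (g t) (C - inflations [2, 1]) M * (1 + \<tau>) + w [2, 1] t < \<tau>"
    by (auto dest!: eventually_happens)
  have "psum (g t) C N \<le> \<tau>" for N
  proof (rule supersolution[where M = M and g = "g t" and \<sigma> = "tot R remaining - R"])
    show "0 \<le> g t \<nu>" for \<nu> using R_pos by (simp add: g_def)
    show "g t (inflate p) \<le> parts_weight (g t) p" if p: "p \<in> decomps" for p
    proof -
      have "(\<Sum>\<nu>\<leftarrow>snd p. y \<nu>) = (\<Sum>\<nu>\<leftarrow>snd p. v \<nu>) - x * real (total_length p)"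
        unfolding y_def sum_list_subtractf sum_list_const_mult sum_list_length_parts ..
      then have "y (inflate p) \<le> (\<Sum>\<nu>\<leftarrow>snd p. y \<nu>)" using sub[OF p] length_inflate[OF p] by (simp add: y_def)
      then show ?thesis using t(1) R_pos unfolding pw g_def length_inflate[OF p] by simp
    qed
    show "(\<Sum>\<alpha> | \<alpha> \<in> simples C \<and> length \<alpha> \<le> n. \<tau> ^ length \<alpha>) \<le> tot R remaining - R" for n by (rule simple_sum)
    show "u t + (w [1, 2] t + w [2, 1] t) / (1 + \<tau>) + (tot R remaining - R) + 2 * \<tau>\<^sup>2 / (1 + \<tau>) \<le> \<tau>"
      using t(2) tot_equation[OF tot_R_facts] unfolding \<phi>_def \<tau>_def by simp
    show "psum (g t) (C - inflations [1, 2]) M \<le> (\<tau> - w [1, 2] t) / (1 + \<tau>)"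
      "psum (g t) (C - inflations [2, 1]) M \<le> (\<tau> - w [2, 1] t) / (1 + \<tau>)"
      using t(4,5) tau_pos by (simp_all add: le_divide_eq)
  qed (use M t tau_pos in \<open>simp_all add: u_def w_def\<close>)
  then show ?thesis using t(1) unfolding g_def y_def by blast
qed

text \<open>A Chernoff bound: \<open>exponential_moment\<close> controls all sizes at once, in
  particular size n, and \<open>cnt_ge\<close> turns the weight \<open>R ^ n\<close> into a
  proportion of the class.\<close>

lemma tail_bound:
  assumes sub: "\<And>p. p \<in> decomps \<Longrightarrow> v (inflate p) \<le> (\<Sum>\<nu>\<leftarrow>snd p. v \<nu>)"
    and M: "M \<ge> 1" and drift: "drift M v < x * R" and xx: "x < x'"
  shows "(\<lambda>n. real (card {\<nu> \<in> C. length \<nu> = n \<and> v \<nu> \<ge> x' * real n}) / real (cnt n)) \<longlonglongrightarrow> 0"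
proof -
  obtain t where t: "t > 0" "\<And>N. psum (\<lambda>\<nu>. R ^ length \<nu> * exp (t * (v \<nu> - x * real (length \<nu>)))) C N \<le> \<tau>"
    using exponential_moment[OF sub M drift] by auto
  \<comment> \<open>The excess \<open>x' - x\<close> gains \<open>exp (2 * \<epsilon> * n)\<close>;
    passing from \<open>R ^ n\<close> to \<open>1 / cnt n\<close> costs
    \<open>exp (\<epsilon> * n)\<close>.\<close>
  define \<epsilon> where "\<epsilon> = t * (x' - x) / 2"
  have \<epsilon>: "\<epsilon> > 0" using t xx by (simp add: \<epsilon>_def)
  obtain \<kappa> where \<kappa>: "\<kappa> > 0" "\<And>n. n \<ge> 1 \<Longrightarrow> real (cnt n) * R ^ n \<ge> \<kappa> * exp (- \<epsilon> * real n)"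
    using cnt_ge[OF \<epsilon>] by auto
  have bound: "real (card {\<nu> \<in> C. length \<nu> = n \<and> v \<nu> \<ge> x' * real n}) / real (cnt n) \<le> \<tau> / \<kappa> * exp (- \<epsilon> * real n)"
    if n: "n \<ge> 1" for n
  proof -
    let ?T = "{\<nu> \<in> C. length \<nu> = n \<and> v \<nu> \<ge> x' * real n}"
    have e2: "t * (x' * real n - x * real n) = 2 * \<epsilon> * real n" by (simp add: \<epsilon>_def algebra_simps)
    have "real (card ?T) * (R ^ n * exp (2 * \<epsilon> * real n)) = (\<Sum>\<nu>\<in>?T. R ^ n * exp (t * (x' * real n - x * real n)))"
      by (simp add: e2)
    also have "\<dots> \<le> (\<Sum>\<nu>\<in>?T. R ^ length \<nu> * exp (t * (v \<nu> - x * real (length \<nu>))))"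
      using t(1) R_pos by (intro sum_mono) auto
    also have "\<dots> \<le> psum (\<lambda>\<nu>. R ^ length \<nu> * exp (t * (v \<nu> - x * real (length \<nu>)))) C n"
      unfolding psum_def using finite_upto R_pos by (intro sum_mono2) auto
    also have "\<dots> \<le> \<tau>" by (rule t(2))
    finally have 1: "real (card ?T) * R ^ n * exp (2 * \<epsilon> * real n) \<le> \<tau>" by (simp add: mult.assoc)
    have "real (card ?T) * \<kappa> * exp (- \<epsilon> * real n) * exp (2 * \<epsilon> * real n)
      \<le> real (card ?T) * (real (cnt n) * R ^ n) * exp (2 * \<epsilon> * real n)"
      using \<kappa>(2)[OF n] by (simp add: mult.assoc mult_left_mono)
    also have "\<dots> \<le> real (cnt n) * \<tau>" using mult_left_mono[OF 1, of "real (cnt n)"] by (simp add: mult_ac)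
    also have "real (card ?T) * \<kappa> * exp (- \<epsilon> * real n) * exp (2 * \<epsilon> * real n) = real (card ?T) * \<kappa> * exp (\<epsilon> * real n)"
      by (simp add: mult.assoc exp_add[symmetric])
    finally have "real (card ?T) * \<kappa> * exp (\<epsilon> * real n) * exp (- \<epsilon> * real n) \<le> real (cnt n) * \<tau> * exp (- \<epsilon> * real n)"
      by (rule mult_right_mono) simp
    then have "real (card ?T) * \<kappa> \<le> real (cnt n) * \<tau> * exp (- \<epsilon> * real n)"
      by (simp add: mult.assoc exp_add[symmetric])
    moreover have "real (cnt n) > 0" using cnt_pos[OF n] by simp
    ultimately show ?thesis using \<kappa>(1) by (simp add: field_simps)
  qed
  have "(\<lambda>n. \<tau> / \<kappa> * exp (- \<epsilon>) ^ n) \<longlonglongrightarrow> \<tau> / \<kappa> * 0"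
    using \<epsilon> by (intro tendsto_mult tendsto_const LIMSEQ_realpow_zero) auto
  then have lim: "(\<lambda>n. \<tau> / \<kappa> * exp (- \<epsilon> * real n)) \<longlonglongrightarrow> 0"
    by (simp add: exp_of_nat_mult[symmetric] mult.commute)
  show ?thesis
  proof (rule tendsto_sandwich[OF _ _ tendsto_const lim])
    show "\<forall>\<^sub>F n in sequentially. real (card {\<nu> \<in> C. length \<nu> = n \<and> v \<nu> \<ge> x' * real n}) / real (cnt n) \<le> \<tau> / \<kappa> * exp (- \<epsilon> * real n)"
      using bound by (intro eventually_sequentiallyI[of 1])
  qed simp
qed

text \<open>As \<open>M\<close> grows, the drift of the constant function tends to \<open>\<tau> G'(\<tau>)\<close>.\<close>

lemma drift_one:
  assumes hyp: "deriv_at_radius S_fps \<ge> 2 / (1 + fps_conv_radius S_fps)\<^sup>2 - 1" and \<epsilon>: "\<epsilon> > 0"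
  shows "\<exists>M\<ge>1. drift M (\<lambda>_. 1) \<le> \<epsilon>"
proof -
  obtain m0 where m0: "(\<Sum>\<alpha> | \<alpha> \<in> simples C \<and> length \<alpha> \<le> m0. real (length \<alpha>) * \<tau> ^ length \<alpha>)
      \<ge> \<tau> * (2 / (1 + \<tau>)\<^sup>2 - 1) - \<epsilon> / 2"
    using critical[OF hyp, of "\<epsilon> / 2"] \<epsilon> by auto
  let ?S = "\<lambda>c. \<Sum>\<alpha> | \<alpha> \<in> simples C \<and> length \<alpha> \<le> m0. real (length \<alpha>) * c ^ length \<alpha>"
  let ?P = "\<lambda>X M. psum (zw R) X M"
  define d where "d = tot R (inflations [1, 2]) + tot R (inflations [2, 1])"
  \<comment> \<open>An upper bound for the drift at \<open>M = m * m\<close>, the cutoff of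
    \<open>qsum_simple_ge\<close>. Simple permutations are cut off at the fixed size
    \<open>m0\<close>, so that the limit in m passes through a finite sum.\<close>
  define W where "W m = ?P remaining (m * m) - ?S (?P C m) - (?P (inflations [1, 2]) (m * m) + ?P (inflations [2, 1]) (m * m)) / (1 + \<tau>)" for m
  have sq: "filterlim (\<lambda>m :: nat. m * m) at_top sequentially"
    by (rule filterlim_at_top_mono[OF filterlim_ident]) (auto intro!: always_eventually)
  have lim2: "(\<lambda>m. ?P X (m * m)) \<longlonglongrightarrow> tot R X" if "X \<subseteq> C" for X
    using filterlim_compose[OF psum_tendsto_tot[OF tot_R_facts that] sq] by simp
  have "W \<longlonglongrightarrow> tot R remaining - ?S \<tau> - d / (1 + \<tau>)"
    unfolding W_def d_def using inflations_in_C tau_pos psum_tendsto_tot[OF tot_R_facts, of C]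
    by (intro tendsto_intros lim2) (auto simp: \<tau>_def)
  moreover have "tot R remaining - ?S \<tau> - d / (1 + \<tau>) < \<epsilon>"
  proof -
    define q where "q = \<tau>\<^sup>2 / (1 + \<tau>)"
    have d: "d \<ge> 2 * q" using tot_inflations_ge_square[OF tot_R_facts, of "[1, 2]"] tot_inflations_ge_square[OF tot_R_facts, of "[2, 1]"]
      by (simp add: d_def \<tau>_def q_def)
    have r: "tot R remaining = \<tau> - d" using tot_C[OF tot_R_facts] by (simp add: d_def \<tau>_def)
    have "2 * q / (1 + \<tau>) \<le> d / (1 + \<tau>)" using d tau_pos by (intro divide_right_mono) auto
    \<comment> \<open>This is \<open>\<tau> G'(\<tau>) = 0\<close> for the borderline value
      \<open>S'(\<tau>) = 2 / (1 + \<tau>)^2 - 1\<close>, with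
      \<open>q = \<tau>^2 / (1 + \<tau>)\<close>.\<close>
    moreover have "\<tau> - 2 * q - \<tau> * (2 / (1 + \<tau>)\<^sup>2 - 1) - 2 * q / (1 + \<tau>) = 0"
      using tau_pos unfolding q_def by (simp add: divide_simps power2_eq_square) (simp add: algebra_simps)
    ultimately show ?thesis using d r m0 \<epsilon> by linarith
  qed
  ultimately have "\<forall>\<^sub>F m in sequentially. W m < \<epsilon>" by (rule order_tendstoD(2))
  then have "\<forall>\<^sub>F m in sequentially. W m < \<epsilon> \<and> m \<ge> max 1 m0" by (intro eventually_conj eventually_ge_at_top)
  then obtain m where m: "W m < \<epsilon>" "m \<ge> 1" "m \<ge> m0" by (auto dest!: eventually_happens)
  have mm: "m * m \<ge> 1" using m by simp
  have "qsum (\<lambda>p. R ^ total_length p * (\<Sum>\<nu>\<leftarrow>snd p. 1)) simple_pairs (m * m)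
      = qsum (\<lambda>p. real (length (fst p)) * parts_weight (zw R) p) simple_pairs (m * m)"
    unfolding qsum_def by (intro sum.cong refl) (auto simp: parts_weight_zw simple_pairs_def sum_list_triv)
  also have "\<dots> \<ge> (\<Sum>\<alpha> | \<alpha> \<in> simples C \<and> length \<alpha> \<le> m. real (length \<alpha>) * ?P C m ^ length \<alpha>)"
    using R_pos by (intro qsum_simple_ge) (auto simp: zw_nonneg)
  moreover have "(\<Sum>\<alpha> | \<alpha> \<in> simples C \<and> length \<alpha> \<le> m. real (length \<alpha>) * ?P C m ^ length \<alpha>) \<ge> ?S (?P C m)"
    using m(3) finite_upto_subset[of "simples C" m] psum_nonneg[of C "zw R" m] R_pos
    by (intro sum_mono2) (auto simp: simples_def zw_nonneg)
  ultimately have s: "qsum (\<lambda>p. R ^ total_length p * (\<Sum>\<nu>\<leftarrow>snd p. 1)) simple_pairs (m * m) \<ge> ?S (?P C m)" by simp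
  \<comment> \<open>One object against its two parts: 1 - 2 = -1 times the weight.\<close>
  have b: "psum (\<lambda>\<nu>. R ^ length \<nu> * 1) (inflations \<theta>) (m * m) - qsum (\<lambda>p. R ^ total_length p * (\<Sum>\<nu>\<leftarrow>snd p. 1)) (binary_pairs \<theta>) (m * m)
      = - ?P (inflations \<theta>) (m * m)" if \<theta>: "\<theta> \<in> dirs" for \<theta>
  proof -
    have "qsum (\<lambda>p. R ^ total_length p * (\<Sum>\<nu>\<leftarrow>snd p. 1)) (binary_pairs \<theta>) (m * m)
      = 2 * qsum (parts_weight (zw R)) (binary_pairs \<theta>) (m * m)"
      unfolding qsum_def sum_distrib_left by (intro sum.cong refl) (auto simp: parts_weight_zw binary_pairs_def)
    then show ?thesis using psum_zw_inflations[OF \<theta>, of R "m * m"] by (simp add: zw_def[abs_def])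
  qed
  have "drift (m * m) (\<lambda>_. 1) \<le> W m"
    unfolding drift_def W_def b[of "[1, 2]", simplified] using s b[of "[1, 2]"] b[of "[2, 1]"]
    by (simp add: zw_def[abs_def] add_divide_distrib diff_divide_distrib)
  then show ?thesis using m(1) mm by (intro exI[of _ "m * m"]) auto
qed

end

subsection \<open>Concentration\<close>

lemma pmf_not_subset:
  assumes "measure_pmf.prob p A < 1"
  obtains x where "x \<in> set_pmf p" "x \<notin> A"
proof -
  have "\<not> (AE x in measure_pmf p. x \<in> A)"
  proof
    assume "AE x in measure_pmf p. x \<in> A"
    then have "measure_pmf.prob p A = 1" by (subst measure_pmf.prob_eq_1) auto
    then show False using assms by simp
  qed
  then show ?thesis using that by (auto simp: AE_measure_pmf_iff)
qed

text \<open>The centre may depend on \<open>\<epsilon>\<close>. For centres at accuracies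
  \<open>1 / (j + 1)\<close>, two exceptional events of probability below 1/2 leave a common point,
  so two centres differ by at most the sum of their accuracies. They form a Cauchy sequence, whose
  limit serves every \<open>\<epsilon>\<close> and inherits the range from points of the
  supports.\<close>

lemma tendsto_in_prob_of_concentration:
  fixes p :: "nat \<Rightarrow> 'a pmf" and Y :: "nat \<Rightarrow> 'a \<Rightarrow> real"
  assumes conc: "\<And>\<epsilon>. \<epsilon> > 0 \<Longrightarrow> \<exists>\<gamma>. (\<lambda>n. measure_pmf.prob (p n) {x. \<bar>Y n x - \<gamma>\<bar> > \<epsilon>}) \<longlonglongrightarrow> 0"
    and range: "\<And>n x. n \<ge> 1 \<Longrightarrow> x \<in> set_pmf (p n) \<Longrightarrow> 0 \<le> Y n x \<and> Y n x \<le> 1"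
  shows "\<exists>\<gamma>. 0 \<le> \<gamma> \<and> \<gamma> \<le> 1 \<and> tendsto_in_prob (\<lambda>n. measure_pmf (p n)) Y \<gamma>"
proof -
  let ?e = "\<lambda>j. 1 / real (Suc j)"
  have "\<forall>j. \<exists>\<gamma>. (\<lambda>n. measure_pmf.prob (p n) {x. \<bar>Y n x - \<gamma>\<bar> > ?e j}) \<longlonglongrightarrow> 0" using conc by simp
  from choice[OF this] obtain \<gamma> where
    "\<forall>j. (\<lambda>n. measure_pmf.prob (p n) {x. \<bar>Y n x - \<gamma> j\<bar> > ?e j}) \<longlonglongrightarrow> 0" by (rule exE)
  note \<gamma> = this[rule_format]
  have close: "\<bar>\<gamma> i - \<gamma> j\<bar> \<le> ?e i + ?e j" for i j
  proof -
    have "\<forall>\<^sub>F n in sequentially. measure_pmf.prob (p n) {x. \<bar>Y n x - \<gamma> l\<bar> > ?e l} < 1 / 2" for l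
      by (rule order_tendstoD(2)[OF \<gamma>]) simp
    from eventually_conj[OF this[of i] this[of j]]
    obtain n where n: "measure_pmf.prob (p n) {x. \<bar>Y n x - \<gamma> i\<bar> > ?e i} < 1 / 2"
      "measure_pmf.prob (p n) {x. \<bar>Y n x - \<gamma> j\<bar> > ?e j} < 1 / 2"
      by (auto dest!: eventually_happens)
    have "measure_pmf.prob (p n) ({x. \<bar>Y n x - \<gamma> i\<bar> > ?e i} \<union> {x. \<bar>Y n x - \<gamma> j\<bar> > ?e j}) < 1"
      using measure_Un_le[of "{x. \<bar>Y n x - \<gamma> i\<bar> > ?e i}" "measure_pmf (p n)" "{x. \<bar>Y n x - \<gamma> j\<bar> > ?e j}"] n by simp
    then obtain x where "x \<notin> {x. \<bar>Y n x - \<gamma> i\<bar> > ?e i} \<union> {x. \<bar>Y n x - \<gamma> j\<bar> > ?e j}" by (rule pmf_not_subset)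
    then have "\<bar>Y n x - \<gamma> i\<bar> \<le> ?e i" "\<bar>Y n x - \<gamma> j\<bar> \<le> ?e j" by simp_all
    then show ?thesis by linarith
  qed
  have e_small: "\<exists>J. \<forall>j\<ge>J. ?e j < \<epsilon>" if "\<epsilon> > 0" for \<epsilon> :: real
  proof -
    have "?e \<longlonglongrightarrow> 0" by (rule LIMSEQ_inverse_real_of_nat[unfolded inverse_eq_divide])
    then have "\<forall>\<^sub>F j in sequentially. ?e j < \<epsilon>" using that by (rule order_tendstoD(2))
    then show ?thesis by (simp add: eventually_sequentially)
  qed
  have "Cauchy \<gamma>"
  proof (rule metric_CauchyI)
    fix \<epsilon> :: real assume "\<epsilon> > 0"
    then obtain J where J: "\<And>j. j \<ge> J \<Longrightarrow> ?e j < \<epsilon> / 2" using e_small[of "\<epsilon> / 2"] by auto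
    have "dist (\<gamma> i) (\<gamma> j) < \<epsilon>" if "i \<ge> J" "j \<ge> J" for i j
      using close[of i j] J[OF that(1)] J[OF that(2)] unfolding dist_real_def by linarith
    then show "\<exists>J. \<forall>i\<ge>J. \<forall>j\<ge>J. dist (\<gamma> i) (\<gamma> j) < \<epsilon>" by blast
  qed
  from Cauchy_convergent[OF this] obtain g where g: "\<gamma> \<longlonglongrightarrow> g" unfolding convergent_def by (rule exE)
  have lim: "(\<lambda>n. measure_pmf.prob (p n) {x. \<bar>Y n x - g\<bar> > \<epsilon>}) \<longlonglongrightarrow> 0" if \<epsilon>: "\<epsilon> > 0" for \<epsilon>
  proof -
    obtain J where J: "\<And>j. j \<ge> J \<Longrightarrow> ?e j < \<epsilon> / 2" using e_small[of "\<epsilon> / 2"] \<epsilon> by auto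
    obtain J' where J': "\<And>j. j \<ge> J' \<Longrightarrow> \<bar>\<gamma> j - g\<bar> < \<epsilon> / 2" using LIMSEQ_D[OF g, of "\<epsilon> / 2"] \<epsilon> by auto
    define j where "j = max J J'"
    have j: "?e j < \<epsilon> / 2" "\<bar>\<gamma> j - g\<bar> < \<epsilon> / 2" using J[of j] J'[of j] by (simp_all add: j_def)
    have "{x. \<bar>Y n x - g\<bar> > \<epsilon>} \<subseteq> {x. \<bar>Y n x - \<gamma> j\<bar> > ?e j}" for n
    proof
      fix x assume "x \<in> {x. \<bar>Y n x - g\<bar> > \<epsilon>}"
      then have "\<bar>Y n x - g\<bar> > \<epsilon>" by simp
      then have "\<bar>Y n x - \<gamma> j\<bar> > ?e j" using j by linarith
      then show "x \<in> {x. \<bar>Y n x - \<gamma> j\<bar> > ?e j}" by simp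
    qed
    then have "measure_pmf.prob (p n) {x. \<bar>Y n x - g\<bar> > \<epsilon>} \<le> measure_pmf.prob (p n) {x. \<bar>Y n x - \<gamma> j\<bar> > ?e j}" for n
      by (intro measure_pmf.finite_measure_mono) auto
    then show ?thesis by (intro tendsto_sandwich[OF _ _ tendsto_const \<gamma>[of j]]) auto
  qed
  have ex: "\<exists>y. 0 \<le> y \<and> y \<le> 1 \<and> \<bar>y - g\<bar> \<le> \<epsilon>" if "\<epsilon> > 0" for \<epsilon>
  proof -
    have "\<forall>\<^sub>F n in sequentially. measure_pmf.prob (p n) {x. \<bar>Y n x - g\<bar> > \<epsilon>} < 1 \<and> n \<ge> 1"
      by (intro eventually_conj eventually_ge_at_top order_tendstoD(2)[OF lim[OF that]]) simp
    then obtain n where n: "measure_pmf.prob (p n) {x. \<bar>Y n x - g\<bar> > \<epsilon>} < 1" "n \<ge> 1"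
      by (auto dest!: eventually_happens)
    obtain x where "x \<in> set_pmf (p n)" "x \<notin> {x. \<bar>Y n x - g\<bar> > \<epsilon>}" using n(1) by (rule pmf_not_subset)
    then show ?thesis using range[OF n(2)] by (intro exI[of _ "Y n x"]) auto
  qed
  have "0 \<le> g"
  proof (rule ccontr)
    assume "\<not> 0 \<le> g"
    then show False using ex[of "- g / 2"] by auto
  qed
  moreover have "g \<le> 1"
  proof (rule ccontr)
    assume "\<not> g \<le> 1"
    then show False using ex[of "(g - 1) / 2"] by (auto simp: field_simps abs_if split: if_splits)
  qed
  ultimately show ?thesis using lim by (auto simp: tendsto_in_prob_def)
qed

context growth_class
begin

lemma prob_uniform_perm:
  assumes "n \<ge> 1"
  shows "measure_pmf.prob (uniform_perm C n) A = real (card {\<nu> \<in> C. length \<nu> = n \<and> \<nu> \<in> A}) / real (cnt n)"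
    "set_pmf (uniform_perm C n) = {\<nu> \<in> C. length \<nu> = n}"
proof -
  have ne: "{\<nu> \<in> C. length \<nu> = n} \<noteq> {}" using ex_of_length[OF assms] by auto
  have "{\<nu> \<in> C. length \<nu> = n} \<inter> A = {\<nu> \<in> C. length \<nu> = n \<and> \<nu> \<in> A}" by auto
  then show "measure_pmf.prob (uniform_perm C n) A = real (card {\<nu> \<in> C. length \<nu> = n \<and> \<nu> \<in> A}) / real (cnt n)"
    unfolding uniform_perm_def using ne finite_size by (simp add: measure_pmf_of_set cnt_def)
  show "set_pmf (uniform_perm C n) = {\<nu> \<in> C. length \<nu> = n}"
    unfolding uniform_perm_def using ne finite_size by (rule set_pmf_of_set)
qed

lemma c_occ_concentration:
  assumes hyp: "deriv_at_radius S_fps \<ge> 2 / (1 + fps_conv_radius S_fps)\<^sup>2 - 1"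
    and \<pi>: "\<pi> \<in> C" and \<epsilon>: "\<epsilon> > 0"
  shows "\<exists>\<gamma>. (\<lambda>n. measure_pmf.prob (uniform_perm C n) {\<nu>. \<bar>real (c_occ \<pi> \<nu>) / real n - \<gamma>\<bar> > \<epsilon>}) \<longlonglongrightarrow> 0"
proof -
  have \<pi>0: "\<pi> \<noteq> []" using C_length[OF \<pi>] by auto
  define k where "k = real (length \<pi>)"
  have k: "k > 0" using \<pi>0 by (simp add: k_def)
  define X where "X \<nu> = real (c_occ \<pi> \<nu>)" for \<nu>
  \<comment> \<open>Two thirds of \<open>\<epsilon>\<close> cover the contribution of
    \<open>k\<close> to the drift; the last third is the gap \<open>x < x'\<close> in
    \<open>tail_bound\<close>.\<close>
  define e where "e = \<epsilon> / 3"
  have e: "e > 0" using \<epsilon> by (simp add: e_def)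
  obtain M where M: "M \<ge> 1" "drift M (\<lambda>_. 1) \<le> e * R / k" using drift_one[OF hyp, of "e * R / k"] e R_pos k by auto
  \<comment> \<open>Depends on \<open>M\<close> and thereby on \<open>\<epsilon>\<close>;
    \<open>tendsto_in_prob_of_concentration\<close> removes this dependence.\<close>
  define \<gamma> where "\<gamma> = drift M X / R"
  have \<gamma>R: "drift M X = \<gamma> * R" using R_pos by (simp add: \<gamma>_def)
  have k1: "k * drift M (\<lambda>_. 1) < 2 * e * R"
  proof -
    have "k * drift M (\<lambda>_. 1) \<le> k * (e * R / k)" using M(2) k by (intro mult_left_mono) auto
    also have "\<dots> = e * R" using k by simp
    also have "\<dots> < 2 * e * R" using e R_pos by simp
    finally show ?thesis .
  qed
  have cs: "(\<Sum>\<nu>\<leftarrow>snd p. X \<nu>) \<le> X (inflate p)" "X (inflate p) + k \<le> (\<Sum>\<nu>\<leftarrow>snd p. X \<nu> + k)" if p: "p \<in> decomps" for p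
  proof -
    note d = decomps_props[OF p]
    have ne: "fst p \<noteq> []" and ps: "set (snd p) \<subseteq> perms" using d C_perms by auto
    have sums: "(\<Sum>\<nu>\<leftarrow>xs. real (f \<nu>)) = real (\<Sum>\<nu>\<leftarrow>xs. f \<nu>)" for xs :: "nat list list" and f
      by (induction xs) simp_all
    have "(\<Sum>\<nu>\<leftarrow>snd p. c_occ \<pi> \<nu>) \<le> c_occ \<pi> (inflate p)"
      using c_occ_substitution(1)[OF \<pi>0 ne d(2) ps] by (simp add: split_def)
    then show "(\<Sum>\<nu>\<leftarrow>snd p. X \<nu>) \<le> X (inflate p)" unfolding X_def sums by (simp only: of_nat_le_iff)
    have "c_occ \<pi> (inflate p) + length \<pi> \<le> (\<Sum>\<nu>\<leftarrow>snd p. c_occ \<pi> \<nu> + length \<pi>)"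
      using c_occ_substitution(2)[OF \<pi>0 ne d(2) ps] by (simp add: split_def)
    then have "real (c_occ \<pi> (inflate p) + length \<pi>) \<le> (\<Sum>\<nu>\<leftarrow>snd p. real (c_occ \<pi> \<nu> + length \<pi>))"
      unfolding sums by (simp only: of_nat_le_iff)
    then show "X (inflate p) + k \<le> (\<Sum>\<nu>\<leftarrow>snd p. X \<nu> + k)" unfolding X_def k_def by (simp only: of_nat_add)
  qed
  \<comment> \<open>Both functions are subadditive: in \<open>?v1\<close> the constant
    \<open>k\<close> absorbs occurrences across cuts, and in \<open>?v2\<close> the count itself is
    superadditive. The factors 1 and -1 match \<open>drift_linear\<close>.\<close>
  let ?v1 = "\<lambda>\<nu>. 1 * X \<nu> + k * 1" and ?v2 = "\<lambda>\<nu>. (- 1) * X \<nu> + k * 1"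
  let ?r = "\<lambda>v x n. real (card {\<nu> \<in> C. length \<nu> = n \<and> v \<nu> \<ge> x * real n}) / real (cnt n)"
  have t1: "?r ?v1 (\<gamma> + \<epsilon>) \<longlonglongrightarrow> 0"
  proof (rule tail_bound[OF _ M(1), of _ "\<gamma> + 2 * e"])
    show "?v1 (inflate p) \<le> (\<Sum>\<nu>\<leftarrow>snd p. ?v1 \<nu>)" if "p \<in> decomps" for p using cs(2)[OF that] by simp
    show "drift M ?v1 < (\<gamma> + 2 * e) * R" unfolding drift_linear using k1 \<gamma>R by (simp add: distrib_right)
  qed (use e in \<open>simp add: e_def\<close>)
  have t2: "?r ?v2 (- \<gamma> + \<epsilon>) \<longlonglongrightarrow> 0"
  proof (rule tail_bound[OF _ M(1), of _ "- \<gamma> + 2 * e"])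
    show "?v2 (inflate p) \<le> (\<Sum>\<nu>\<leftarrow>snd p. ?v2 \<nu>)" if p: "p \<in> decomps" for p
    proof -
      have "(\<Sum>\<nu>\<leftarrow>snd p. ?v2 \<nu>) = - (\<Sum>\<nu>\<leftarrow>snd p. X \<nu>) + real (length (snd p)) * k"
        unfolding sum_list_addf sum_list_const_mult by (simp add: sum_list_triv)
      moreover have "1 * k \<le> real (length (snd p)) * k"
        using decomps_props(2,4)[OF p] k by (intro mult_right_mono) auto
      ultimately show ?thesis using cs(1)[OF p] by linarith
    qed
    show "drift M ?v2 < (- \<gamma> + 2 * e) * R" unfolding drift_linear using k1 \<gamma>R by (simp add: algebra_simps)
  qed (use e in \<open>simp add: e_def\<close>)
  have le: "measure_pmf.prob (uniform_perm C n) {\<nu>. \<bar>real (c_occ \<pi> \<nu>) / real n - \<gamma>\<bar> > \<epsilon>}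
      \<le> ?r ?v1 (\<gamma> + \<epsilon>) n + ?r ?v2 (- \<gamma> + \<epsilon>) n" if n: "n \<ge> 1" for n
  proof -
    let ?A = "{\<nu> \<in> C. length \<nu> = n \<and> ?v1 \<nu> \<ge> (\<gamma> + \<epsilon>) * real n}"
    let ?B = "{\<nu> \<in> C. length \<nu> = n \<and> ?v2 \<nu> \<ge> (- \<gamma> + \<epsilon>) * real n}"
    have "{\<nu> \<in> C. length \<nu> = n \<and> \<nu> \<in> {\<nu>. \<bar>real (c_occ \<pi> \<nu>) / real n - \<gamma>\<bar> > \<epsilon>}} \<subseteq> ?A \<union> ?B"
    proof
      fix \<nu> assume "\<nu> \<in> {\<nu> \<in> C. length \<nu> = n \<and> \<nu> \<in> {\<nu>. \<bar>real (c_occ \<pi> \<nu>) / real n - \<gamma>\<bar> > \<epsilon>}}"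
      then have \<nu>: "\<nu> \<in> C" "length \<nu> = n" "\<bar>X \<nu> / real n - \<gamma>\<bar> > \<epsilon>" by (auto simp: X_def)
      then consider "X \<nu> / real n > \<gamma> + \<epsilon>" | "X \<nu> / real n < \<gamma> - \<epsilon>" by linarith
      then show "\<nu> \<in> ?A \<union> ?B"
      proof cases
        case 1
        then have "X \<nu> > (\<gamma> + \<epsilon>) * real n" using n by (simp add: less_divide_eq)
        then show ?thesis using \<nu> k by simp
      next
        case 2
        then have "X \<nu> < (\<gamma> - \<epsilon>) * real n" using n by (simp add: divide_less_eq)
        then have "(- \<gamma> + \<epsilon>) * real n \<le> ?v2 \<nu>" using k by (simp add: algebra_simps)
        then show ?thesis using \<nu> by blast
      qed
    qed
    then have "card {\<nu> \<in> C. length \<nu> = n \<and> \<nu> \<in> {\<nu>. \<bar>real (c_occ \<pi> \<nu>) / real n - \<gamma>\<bar> > \<epsilon>}} \<le> card (?A \<union> ?B)"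
      by (intro card_mono) (auto intro: finite_subset[OF _ finite_size[of n]])
    also have "\<dots> \<le> card ?A + card ?B" by (rule card_Un_le)
    finally show ?thesis unfolding prob_uniform_perm(1)[OF n] add_divide_distrib[symmetric] of_nat_add[symmetric]
      by (intro divide_right_mono) (simp_all only: of_nat_le_iff of_nat_0_le_iff)
  qed
  show ?thesis
  proof (rule exI[of _ \<gamma>], rule tendsto_sandwich[OF _ _ tendsto_const])
    show "(\<lambda>n. ?r ?v1 (\<gamma> + \<epsilon>) n + ?r ?v2 (- \<gamma> + \<epsilon>) n) \<longlonglongrightarrow> 0" using tendsto_add[OF t1 t2] by simp
    show "\<forall>\<^sub>F n in sequentially. measure_pmf.prob (uniform_perm C n) {\<nu>. \<bar>real (c_occ \<pi> \<nu>) / real n - \<gamma>\<bar> > \<epsilon>}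
      \<le> ?r ?v1 (\<gamma> + \<epsilon>) n + ?r ?v2 (- \<gamma> + \<epsilon>) n"
      using le by (intro eventually_sequentiallyI[of 1])
  qed simp
qed

end

theorem theorem1p2:
  fixes C :: "nat list set"
  assumes "proper_class C"
    and "substitution_closed C"
    and "[1, 2] \<in> C" and "[2, 1] \<in> C"
    and "deriv_at_radius (gen_fun (simples C))
           \<ge> 2 / (1 + fps_conv_radius (gen_fun (simples C)))\<^sup>2 - 1"
  shows "\<forall>\<pi>\<in>C. \<exists>\<gamma>::real. 0 \<le> \<gamma> \<and> \<gamma> \<le> 1 \<and>
           tendsto_in_prob (\<lambda>n. measure_pmf (uniform_perm C n))
             (\<lambda>n \<nu>. real (c_occ \<pi> \<nu>) / real n) \<gamma>"
proof
  fix \<pi> assume \<pi>: "\<pi> \<in> C"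
  have cl: "permutation_class C" and ne: "C \<noteq> perms" using assms(1) by (auto simp: proper_class_def)
  interpret subst_class C by unfold_locales (use cl assms in auto)
  \<comment> \<open>Properness supplies a missing permutation, and avoiding it forces at most
    exponential growth, hence \<open>R > 0\<close>.\<close>
  have "\<exists>\<pi>\<in>perms. \<pi> \<notin> C" using ne C_perms by blast
  then obtain K where "\<And>n. cnt n \<le> K ^ n" using stanley_wilf_bound[OF cl] unfolding cnt_def by blast
  from growth_rate[OF this] obtain R :: real where R: "0 < R" "\<And>n. n \<ge> 1 \<Longrightarrow> real (cnt n) * R ^ n \<le> 1"
    "\<And>\<epsilon>. \<epsilon> > 0 \<Longrightarrow> \<exists>\<kappa>>0. \<forall>n\<ge>1. real (cnt n) * R ^ n \<ge> \<kappa> * exp (- \<epsilon> * real n)"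
    by blast
  interpret growth_class C R by unfold_locales (use R in auto)
  have \<pi>0: "\<pi> \<noteq> []" using C_length[OF \<pi>] by auto
  show "\<exists>\<gamma>::real. 0 \<le> \<gamma> \<and> \<gamma> \<le> 1 \<and>
           tendsto_in_prob (\<lambda>n. measure_pmf (uniform_perm C n))
             (\<lambda>n \<nu>. real (c_occ \<pi> \<nu>) / real n) \<gamma>"
  proof (rule tendsto_in_prob_of_concentration)
    show "\<exists>\<gamma>. (\<lambda>n. measure_pmf.prob (uniform_perm C n) {\<nu>. \<bar>real (c_occ \<pi> \<nu>) / real n - \<gamma>\<bar> > \<epsilon>}) \<longlonglongrightarrow> 0"
      if "\<epsilon> > 0" for \<epsilon> by (rule c_occ_concentration[OF assms(5) \<pi> that])
    show "0 \<le> real (c_occ \<pi> \<nu>) / real n \<and> real (c_occ \<pi> \<nu>) / real n \<le> 1"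
      if "n \<ge> 1" "\<nu> \<in> set_pmf (uniform_perm C n)" for n \<nu>
      using c_occ_le_length[OF \<pi>0, of \<nu>] that prob_uniform_perm(2)[OF that(1)] by (auto simp: divide_le_eq)
  qed
qed

end
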